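(* Assume that the boundary value problem $Lf=\lambda f$, $f_2(0)=Hf_1(0)$ is of class $(T_B)$, with transformation kernel $K$. Let $\sigma$ be its spectral function and $\sigma_0(\lambda)=\frac{1}{2\pi}B_1^{-1}\lambda$. Then with $$F(x,t):=\frac{\partial^2}{\partial x\,\partial t}\tilde F(x,t),\qquad \tilde F(x,t):=\int_{\mathbb{R}}\tilde e_0(x,\lambda)\,d(\sigma-\sigma_0)(\lambda)\,\tilde e_0(t,\lambda)^*,\qquad \tilde e_0(x,\lambda):=\int_0^xe_0(s,\lambda)\,ds,$$ the Gelfand–Levitan equation $$F(x,t)+K(x,t)+\int_0^xK(x,s)F(s,t)\,ds=0,\qquad t<x,$$ holds.
   Context: Let $n\ge 1$, $\mathbb{R}_+=[0,\infty)$. Let $B=\mathrm{diag}(B_1,-B_2)$ with $B_1,B_2\in \mathrm{M}(n,\mathbb{C})$ self-adjoint positive definite, let $H\in \mathrm{M}(n,\mathbb{C})$ satisfy $B_1=H^*B_2H$, and let $Q:\mathbb{R}_+\to \mathrm{M}(2n,\mathbb{C})$ be continuous with self-adjoint values. Put $L:=B\frac1i\frac{d}{dx}+Q(x)$, let $Y(x,\lambda)$ be the $2n\times n$ matrix solution of $LY=\lambda Y$, $Y(0,\lambda)=\binom{I}{H}$, and let $e_0(x,\lambda):=e^{i\lambda B^{-1}x}\binom{I}{H}$. The problem is of class $(T_B)$ if there is a continuous function $K:\{(x,t)\mid 0\le t\le x\}\to \mathrm{M}(2n,\mathbb{C})$ with $Y(x,\lambda)=e_0(x,\lambda)+\int_0^xK(x,t)e_0(t,\lambda)\,dt$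 for all $x\ge0$, $\lambda\in\mathbb{C}$; this $K$ is unique and is called the transformation kernel. An $n\times n$ matrix function $\sigma$ on $\mathbb{R}$ is increasing if its values are self-adjoint and $\sigma(\lambda)-\sigma(\mu)\ge0$ for $\mu<\lambda$; $L^2_\sigma(\mathbb{R})$ is the Hilbert space completion of $C_0(\mathbb{R},\mathbb{C}^n)$ with respect to $\int f^*d\sigma\, g:=\sum_{i,j}\int\overline{f_i}g_j\,d\sigma_{ij}$. The spectral function is the unique increasing right-continuous $n\times n$ matrix function $\sigma$ with $\sigma(0)=0$ for which $f\mapsto\int_0^\infty Y(x,\lambda)^*f(x)\,dx$ (for compactly supported $f\in L^2(\mathbb{R}_+,\mathbb{C}^{2n})$) extends to an isometry $L^2(\mathbb{R}_+,\mathbb{C}^{2n})\to L^2_\sigma(\mathbb{R})$. Here $\sigma_0$ is the spectral function for $Q=0$. Writing $d\sigma=\Phi\,d(\operatorname{tr}\sigma)$ with a nonnegative matrix density $\Phi$, $\int U\,d\sigma\,V^*$ means $\int U\Phi V^*\,d(\operatorname{tr}\sigma)$, and integrals against $d(\sigma-\sigma_0)$ are differences of those against $d\sigma$ and $d\sigma_0$. *)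

theory Defs
  imports "HOL-Analysis.Analysis"
begin

section \<open>Complex matrices\<close>

definition cadjoint :: "complex^'c^'r \<Rightarrow> complex^'r^'c"
  where "cadjoint A = (\<chi> i j. cnj (A $ j $ i))"

definition cscale :: "complex \<Rightarrow> complex^'c^'r \<Rightarrow> complex^'c^'r"
  where "cscale c A = (\<chi> i j. c * A $ i $ j)"

definition self_adjoint :: "complex^'n^'n \<Rightarrow> bool"
  where "self_adjoint A \<longleftrightarrow> cadjoint A = A"

text \<open>The number \<open>v\<^sup>* A v\<close>; it is real for self-adjoint \<open>A\<close>.\<close>

definition quad_form :: "complex^'n^'n \<Rightarrow> complex^'n \<Rightarrow> complex"
  where "quad_form A v = (\<Sum>i\<in>UNIV. cnj (v $ i) * (A *v v) $ i)"

definition nonneg_matrix :: "complex^'n^'n \<Rightarrow> bool"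
  where "nonneg_matrix A \<longleftrightarrow> self_adjoint A \<and> (\<forall>v. 0 \<le> Re (quad_form A v))"

definition pos_def_matrix :: "complex^'n^'n \<Rightarrow> bool"
  where "pos_def_matrix A \<longleftrightarrow> self_adjoint A \<and> (\<forall>v. v \<noteq> 0 \<longrightarrow> 0 < Re (quad_form A v))"

text \<open>Size \<open>2n\<close> is encoded by the index type \<open>'n + 'n\<close>; \<open>Inl\<close> and \<open>Inr\<close> index the
  first and the second block.\<close>

definition block_diag :: "complex^'n^'n \<Rightarrow> complex^'n^'n \<Rightarrow> complex^('n + 'n)^('n + 'n)"
  where "block_diag A D = (\<chi> i j. case i of
      Inl a \<Rightarrow> (case j of Inl b \<Rightarrow> A $ a $ b | Inr b \<Rightarrow> 0)
    | Inr a \<Rightarrow> (case j of Inl b \<Rightarrow> 0 | Inr b \<Rightarrow> D $ a $ b))"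

definition block_col :: "complex^'n^'n \<Rightarrow> complex^'n^'n \<Rightarrow> complex^'n^('n + 'n)"
  where "block_col A C = (\<chi> i j. case i of Inl a \<Rightarrow> A $ a $ j | Inr a \<Rightarrow> C $ a $ j)"

text \<open>The library's \<open>exp\<close> and \<open>(^)\<close> are not available for the matrix product, since \<open>(*)\<close>
  on \<^typ>\<open>complex^'n^'n\<close> is the componentwise product.\<close>

definition matrix_pow :: "complex^'n^'n \<Rightarrow> nat \<Rightarrow> complex^'n^'n"
  where "matrix_pow A k = ((\<lambda>X. A ** X) ^^ k) (mat 1)"

definition matrix_exp :: "complex^'n^'n \<Rightarrow> complex^'n^'n"
  where "matrix_exp A = (\<Sum>k. cscale (1 / fact k) (matrix_pow A k))"


section \<open>The boundary value problem and the transformation kernel\<close>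

definition L_op ::
  "complex^'m^'m \<Rightarrow> (real \<Rightarrow> complex^'m^'m) \<Rightarrow> (real \<Rightarrow> complex^'c^'m) \<Rightarrow> real \<Rightarrow> complex^'c^'m"
  where "L_op B Q f x =
    B ** cscale (1 / \<i>) (vector_derivative f (at x within {0..})) + Q x ** f x"

definition is_fundamental_solution ::
  "complex^('n + 'n)^('n + 'n) \<Rightarrow> complex^'n^'n \<Rightarrow> (real \<Rightarrow> complex^('n + 'n)^('n + 'n)) \<Rightarrow>
   (real \<Rightarrow> complex \<Rightarrow> complex^'n^('n + 'n)) \<Rightarrow> bool"
  where "is_fundamental_solution B H Q Y \<longleftrightarrow>
    (\<forall>l. Y 0 l = block_col (mat 1) H \<and>
      (\<forall>x\<ge>0. (\<lambda>s. Y s l) differentiable (at x within {0..}) \<and>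
        L_op B Q (\<lambda>s. Y s l) x = cscale l (Y x l)))"

definition e0 ::
  "complex^('n + 'n)^('n + 'n) \<Rightarrow> complex^'n^'n \<Rightarrow> real \<Rightarrow> complex \<Rightarrow> complex^'n^('n + 'n)"
  where "e0 B H x l =
    matrix_exp (cscale (\<i> * l * of_real x) (matrix_inv B)) ** block_col (mat 1) H"

text \<open>The problem with fundamental solution \<open>Y\<close> is of class \<open>(T\<^sub>B)\<close> iff a transformation kernel
  exists. A kernel is determined only on the triangle; the values of \<open>K\<close> elsewhere are
  irrelevant.\<close>

definition is_transformation_kernel ::
  "complex^('n + 'n)^('n + 'n) \<Rightarrow> complex^'n^'n \<Rightarrow> (real \<Rightarrow> complex \<Rightarrow> complex^'n^('n + 'n)) \<Rightarrow>
   (real \<Rightarrow> real \<Rightarrow> complex^('n + 'n)^('n + 'n)) \<Rightarrow> bool"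
  where "is_transformation_kernel B H Y K \<longleftrightarrow>
    continuous_on {(x, t). 0 \<le> t \<and> t \<le> x} (\<lambda>(x, t). K x t) \<and>
    (\<forall>x\<ge>0. \<forall>l. Y x l = e0 B H x l + integral {0..x} (\<lambda>t. K x t ** e0 B H t l))"


section \<open>Matrix measures\<close>

definition increasing_matrix :: "(real \<Rightarrow> complex^'n^'n) \<Rightarrow> bool"
  where "increasing_matrix \<sigma> \<longleftrightarrow>
    (\<forall>l. self_adjoint (\<sigma> l)) \<and> (\<forall>m l. m < l \<longrightarrow> nonneg_matrix (\<sigma> l - \<sigma> m))"

definition trace_measure :: "(real \<Rightarrow> complex^'n^'n) \<Rightarrow> real measure"
  where "trace_measure \<sigma> = interval_measure (\<lambda>l. Re (trace (\<sigma> l)))"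

definition is_matrix_density ::
  "(real \<Rightarrow> complex^'n^'n) \<Rightarrow> (real \<Rightarrow> complex^'n^'n) \<Rightarrow> bool"
  where "is_matrix_density \<sigma> \<Phi> \<longleftrightarrow>
    \<Phi> \<in> borel_measurable borel \<and> (\<forall>l. nonneg_matrix (\<Phi> l)) \<and>
    (\<forall>m l. m < l \<longrightarrow> set_integrable (trace_measure \<sigma>) {m<..l} \<Phi> \<and>
      \<sigma> l - \<sigma> m = (LINT s:{m<..l}|trace_measure \<sigma>. \<Phi> s))"

text \<open>For increasing right-continuous \<open>\<sigma>\<close> a density exists by Radon-Nikodym and is unique up
  to null sets of the trace measure, so nothing below depends on the choice.\<close>

definition matrix_density :: "(real \<Rightarrow> complex^'n^'n) \<Rightarrow> real \<Rightarrow> complex^'n^'n"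
  where "matrix_density \<sigma> = (SOME \<Phi>. is_matrix_density \<sigma> \<Phi>)"

definition sigma_integrable ::
  "(real \<Rightarrow> complex^'n^'n) \<Rightarrow> (real \<Rightarrow> complex^'n^'m) \<Rightarrow> (real \<Rightarrow> complex^'n^'m) \<Rightarrow> bool"
  where "sigma_integrable \<sigma> U V \<longleftrightarrow>
    integrable (trace_measure \<sigma>) (\<lambda>l. U l ** matrix_density \<sigma> l ** cadjoint (V l))"

definition sigma_integral ::
  "(real \<Rightarrow> complex^'n^'n) \<Rightarrow> (real \<Rightarrow> complex^'n^'m) \<Rightarrow> (real \<Rightarrow> complex^'n^'m) \<Rightarrow> complex^'m^'m"
  where "sigma_integral \<sigma> U V =
    integral\<^sup>L (trace_measure \<sigma>) (\<lambda>l. U l ** matrix_density \<sigma> l ** cadjoint (V l))"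


section \<open>The spectral function\<close>

definition L2_normsq :: "(real \<Rightarrow> complex^'m) \<Rightarrow> ennreal"
  where "L2_normsq f = (\<integral>\<^sup>+x. ennreal ((norm (f x))\<^sup>2) \<partial>lebesgue_on {0..})"

definition L2_halfline :: "(real \<Rightarrow> complex^'m) set"
  where "L2_halfline = {f. f \<in> borel_measurable (lebesgue_on {0..}) \<and> L2_normsq f < \<infinity>}"

definition L2_comp :: "(real \<Rightarrow> complex^'m) set"
  where "L2_comp = {f \<in> L2_halfline. \<exists>R. \<forall>x>R. f x = 0}"

definition sigma_normsq :: "(real \<Rightarrow> complex^'n^'n) \<Rightarrow> (real \<Rightarrow> complex^'n) \<Rightarrow> ennreal"
  where "sigma_normsq \<sigma> g =
    (\<integral>\<^sup>+l. ennreal (Re (quad_form (matrix_density \<sigma> l) (g l))) \<partial>trace_measure \<sigma>)"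

definition C0_functions :: "(real \<Rightarrow> complex^'n) set"
  where "C0_functions = {g. continuous_on UNIV g \<and> (\<exists>R. \<forall>l. R < \<bar>l\<bar> \<longrightarrow> g l = 0)}"

text \<open>The completion of the compactly supported continuous functions with respect to
  \<open>\<integral> g\<^sup>* d\<sigma> g\<close>, realised by the functions that are limits of compactly supported
  continuous functions; functions at distance 0 represent the same element.\<close>

definition L2_sigma :: "(real \<Rightarrow> complex^'n^'n) \<Rightarrow> (real \<Rightarrow> complex^'n) set"
  where "L2_sigma \<sigma> = {g. g \<in> borel_measurable borel \<and> sigma_normsq \<sigma> g < \<infinity> \<and>
    (\<exists>\<phi> :: nat \<Rightarrow> real \<Rightarrow> complex^'n. (\<forall>k. \<phi> k \<in> C0_functions) \<and>
      (\<lambda>k. sigma_normsq \<sigma> (\<lambda>l. \<phi> k l - g l)) \<longlonglongrightarrow> 0)}"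

definition Y_transform ::
  "(real \<Rightarrow> complex \<Rightarrow> complex^'n^'m) \<Rightarrow> (real \<Rightarrow> complex^'m) \<Rightarrow> real \<Rightarrow> complex^'n"
  where "Y_transform Y f l =
    integral\<^sup>L (lebesgue_on {0..}) (\<lambda>x. cadjoint (Y x (of_real l)) *v f x)"

definition is_L2_isometry ::
  "(real \<Rightarrow> complex^'n^'n) \<Rightarrow> ((real \<Rightarrow> complex^'m) \<Rightarrow> real \<Rightarrow> complex^'n) \<Rightarrow> bool"
  where "is_L2_isometry \<sigma> V \<longleftrightarrow>
    (\<forall>f\<in>L2_halfline. V f \<in> L2_sigma \<sigma> \<and> sigma_normsq \<sigma> (V f) = L2_normsq f) \<and>
    (\<forall>f\<in>L2_halfline. \<forall>g\<in>L2_halfline. \<forall>a b.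
      sigma_normsq \<sigma> (\<lambda>l. V (\<lambda>x. a *s f x + b *s g x) l - (a *s V f l + b *s V g l)) = 0)"

definition is_spectral_function ::
  "(real \<Rightarrow> complex \<Rightarrow> complex^'n^'m) \<Rightarrow> (real \<Rightarrow> complex^'n^'n) \<Rightarrow> bool"
  where "is_spectral_function Y \<sigma> \<longleftrightarrow>
    increasing_matrix \<sigma> \<and> (\<forall>l. continuous (at_right l) \<sigma>) \<and> \<sigma> 0 = 0 \<and>
    (\<exists>V. is_L2_isometry \<sigma> V \<and> (\<forall>f\<in>L2_comp. V f = Y_transform Y f))"


section \<open>The Gelfand-Levitan data\<close>

definition e0_tilde ::
  "complex^('n + 'n)^('n + 'n) \<Rightarrow> complex^'n^'n \<Rightarrow> real \<Rightarrow> real \<Rightarrow> complex^'n^('n + 'n)"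
  where "e0_tilde B H x l = integral {0..x} (\<lambda>s. e0 B H s (of_real l))"

definition F_tilde ::
  "complex^('n + 'n)^('n + 'n) \<Rightarrow> complex^'n^'n \<Rightarrow> (real \<Rightarrow> complex^'n^'n) \<Rightarrow>
   (real \<Rightarrow> complex^'n^'n) \<Rightarrow> real \<Rightarrow> real \<Rightarrow> complex^('n + 'n)^('n + 'n)"
  where "F_tilde B H \<sigma> \<sigma>\<^sub>0 x t =
    sigma_integral \<sigma> (e0_tilde B H x) (e0_tilde B H t) -
    sigma_integral \<sigma>\<^sub>0 (e0_tilde B H x) (e0_tilde B H t)"

text \<open>\<open>\<partial>F_tilde/\<partial>t\<close> and \<open>\<partial>\<^sup>2F_tilde/\<partial>x\<partial>t\<close>; the variables range over \<open>[0,\<infinity>)\<close>, so the derivatives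
  at 0 are one-sided. The mixed derivative need not exist on the diagonal \<open>x = t\<close>, where the
  value of \<open>F_kernel\<close> is then unspecified.\<close>

definition F_tilde_dt ::
  "complex^('n + 'n)^('n + 'n) \<Rightarrow> complex^'n^'n \<Rightarrow> (real \<Rightarrow> complex^'n^'n) \<Rightarrow>
   (real \<Rightarrow> complex^'n^'n) \<Rightarrow> real \<Rightarrow> real \<Rightarrow> complex^('n + 'n)^('n + 'n)"
  where "F_tilde_dt B H \<sigma> \<sigma>\<^sub>0 x t =
    vector_derivative (\<lambda>t'. F_tilde B H \<sigma> \<sigma>\<^sub>0 x t') (at t within {0..})"

definition F_kernel ::
  "complex^('n + 'n)^('n + 'n) \<Rightarrow> complex^'n^'n \<Rightarrow> (real \<Rightarrow> complex^'n^'n) \<Rightarrow>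
   (real \<Rightarrow> complex^'n^'n) \<Rightarrow> real \<Rightarrow> real \<Rightarrow> complex^('n + 'n)^('n + 'n)"
  where "F_kernel B H \<sigma> \<sigma>\<^sub>0 x t =
    vector_derivative (\<lambda>x'. F_tilde_dt B H \<sigma> \<sigma>\<^sub>0 x' t) (at x within {0..})"

end

theory Submission
  imports Defs "HOL-Probability.Sinc_Integral"
begin

text \<open>
  The kernel \<open>K\<close> has a continuous Volterra resolvent \<open>R\<close>, so that \<open>(I + K)(I + R) = I\<close> and
  \<open>e\<^sub>0 = (I + R) Y\<close>. The \<open>e\<^sub>0\<close>-transform of \<open>f\<close> is therefore the \<open>Y\<close>-transform of \<open>(I + R)\<^sup>* f\<close>, and
  the isometry property of \<open>\<sigma>\<close>, applied to indicator functions, evaluates the \<open>\<sigma>\<close>-part of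
  \<open>F_tilde\<close>; the \<open>\<sigma>\<^sub>0\<close>-part is \<open>min x t\<close> times the identity. Differentiating gives
  \<open>I + F = (I + R)(I + R)\<^sup>*\<close>, hence \<open>(I + K)(I + F) = (I + R)\<^sup>*\<close>, whose kernel vanishes for \<open>t < x\<close>.
  All bilinear identities are tested with the real inner product \<open>u \<bullet> (M *v w)\<close>, which determines
  a complex matrix \<open>M\<close>.
\<close>

section \<open>Matrices and the real inner product\<close>

text \<open>The separate integrals of \<open>e0\<close> against \<open>\<sigma>\<close> and
  \<open>\<sigma>\<^sub>0\<close> need not converge, whereas the adjoint of \<open>e0_tilde\<close>,
  applied to a vector, is the transform of an L2 function; hence \<open>F\<close> is a mixed
  derivative of \<open>F_tilde\<close>. That derivative jumps across the diagonal, from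
  \<open>R x t\<close> for t < x to the adjoint of \<open>R t x\<close> for x < t, so the integral
  of \<open>K x s ** F s t\<close> has to tolerate an unspecified value at s = t. The resolvent is
  built on [0, X] only, with X beyond the points at hand: the contraction acts on bounded functions,
  and the derivatives as well as the final equation are local, so different X never have to be
  compared. The free part is not read off from an isometry, since \<open>\<sigma>\<^sub>0\<close>
  enters as an explicit function. Eigenvectors of \<open>matrix_inv B\<close> reduce it to Dirichlet
  integrals, and the relation between \<open>B\<^sub>1\<close>, \<open>B\<^sub>2\<close> and
  \<open>H\<close> makes positive and negative eigenvalues contribute alike. As
  \<open>matrix_density\<close> is a choice, existence of a density comes first, and a.e. uniqueness
  then links the choice to the explicit free density.\<close>

lemma inner_complex_vec: "(x::complex^'n) \<bullet> y = Re (\<Sum>i\<in>UNIV. cnj (x $ i) * y $ i)"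
  by (simp add: inner_vec_def inner_complex_def)

lemma Re_quad_form: "Re (quad_form A v) = v \<bullet> (A *v v)"
  by (simp add: quad_form_def inner_complex_vec)

lemma cadjoint_nth [simp]: "cadjoint A $ i $ j = cnj (A $ j $ i)"
  by (simp add: cadjoint_def)

lemma cadjoint_mat_1 [simp]: "cadjoint (mat 1) = mat 1"
  by (simp add: vec_eq_iff mat_def)

lemma cadjoint_mult: "cadjoint (A ** B) = cadjoint B ** cadjoint A"
  by (simp add: vec_eq_iff matrix_matrix_mult_def mult.commute)

lemma inner_matrix_vector_mult:
  fixes A :: "complex^'c^'r"
  shows "u \<bullet> (A *v w) = (cadjoint A *v u) \<bullet> w"
proof -
  have "(\<Sum>i\<in>UNIV. cnj (u $ i) * (\<Sum>j\<in>UNIV. A $ i $ j * w $ j)) =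
        (\<Sum>j\<in>UNIV. \<Sum>i\<in>UNIV. cnj (u $ i) * (A $ i $ j * w $ j))"
    by (subst sum.swap) (simp add: sum_distrib_left)
  also have "\<dots> = (\<Sum>j\<in>UNIV. cnj (\<Sum>i\<in>UNIV. cnj (A $ i $ j) * u $ i) * w $ j)"
    by (simp add: sum_distrib_left sum_distrib_right mult_ac)
  finally show ?thesis
    by (simp add: inner_complex_vec matrix_vector_mult_def)
qed

lemma bounded_linear_cadjoint: "bounded_linear (cadjoint :: complex^'c^'r \<Rightarrow> complex^'r^'c)"
  by (rule linear_conv_bounded_linear[THEN iffD1])
     (auto intro!: linearI simp: vec_eq_iff complex_eq_iff)

lemma bounded_bilinear_matrix_mult:
  "bounded_bilinear ((**) :: complex^'b^'a \<Rightarrow> complex^'c^'b \<Rightarrow> complex^'c^'a)"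
proof (rule bilinear_conv_bounded_bilinear[THEN iffD1], unfold bilinear_def, intro conjI allI linearI)
qed (simp_all add: vec_eq_iff matrix_matrix_mult_def sum.distrib distrib_left distrib_right
        scaleR_sum_right)

lemma bounded_bilinear_matrix_vector_mult:
  "bounded_bilinear ((*v) :: complex^'b^'a \<Rightarrow> complex^'b \<Rightarrow> complex^'a)"
proof (rule bilinear_conv_bounded_bilinear[THEN iffD1], unfold bilinear_def, intro conjI allI linearI)
qed (simp_all add: vec_eq_iff matrix_vector_mult_def sum.distrib distrib_left distrib_right
        scaleR_sum_right)

lemma bounded_linear_matrix_form:
  "bounded_linear (\<lambda>M :: complex^'b^'a. u \<bullet> (M *v w))"
  by (intro bounded_linear_compose[OF bounded_linear_inner_right]
      bounded_bilinear.bounded_linear_left[OF bounded_bilinear_matrix_vector_mult])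

lemma matrix_eqI_inner:
  fixes M N :: "complex^'b^'a"
  assumes "\<And>u w. u \<bullet> (M *v w) = u \<bullet> (N *v w)"
  shows "M = N"
proof -
  have "M *v w = N *v w" for w
    by (rule vector_eq_rdot[THEN iffD1]) (use assms in \<open>simp add: inner_commute\<close>)
  then show ?thesis
    by (simp add: matrix_eq)
qed

lemma matrix_vector_axis: "((M::complex^'b^'a) *v axis j c) $ i = M $ i $ j * c"
  by (simp add: matrix_vector_mult_def axis_def if_distrib cong: if_cong)

text \<open>Real and imaginary parts of each entry are values of the form
  \<open>u \<bullet> (M *v w)\<close>. Integrability, continuity and summability of matrix-valued
  maps thereby reduce to scalar or vector statements.\<close>

lemma Basis_matrix_inner:
  fixes b :: "complex^'b^'a"
  assumes "b \<in> Basis"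
  obtains u w where "\<And>M. M \<bullet> b = u \<bullet> (M *v w)"
proof -
  obtain i j c where b: "b = axis i (axis j c)"
    using assms by (auto simp: Basis_vec_def)
  have "M \<bullet> b = axis i c \<bullet> (M *v axis j 1)" for M :: "complex^'b^'a"
    by (simp add: b inner_axis inner_axis' matrix_vector_axis inner_commute)
  then show ?thesis
    by (rule that)
qed

lemma integrable_matrixI:
  fixes f :: "'x \<Rightarrow> complex^'b^'a"
  assumes "\<And>u w. integrable M (\<lambda>x. u \<bullet> (f x *v w))"
  shows "integrable M f"
proof -
  have "integrable M (\<lambda>x. f x \<bullet> b)" if "b \<in> Basis" for b
    by (rule Basis_matrix_inner[OF that]) (simp add: assms)
  then have "integrable M (\<lambda>x. \<Sum>b\<in>Basis. (f x \<bullet> b) *\<^sub>R b)"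
    by (intro Bochner_Integration.integrable_sum integrable_scaleR_left)
  then show ?thesis
    by (simp add: euclidean_representation)
qed

lemma integral_matrixI:
  fixes f :: "'x \<Rightarrow> complex^'b^'a"
  assumes "\<And>u w. has_bochner_integral M (\<lambda>x. u \<bullet> (f x *v w)) (u \<bullet> (S *v w))"
  shows "integrable M f" "integral\<^sup>L M f = S"
proof -
  show f: "integrable M f"
    using assms by (intro integrable_matrixI) (auto simp: has_bochner_integral_iff)
  show "integral\<^sup>L M f = S"
    using integral_bounded_linear[OF bounded_linear_matrix_form f] assms
    by (intro matrix_eqI_inner) (simp add: has_bochner_integral_iff)
qed

lemma cscale_vector_mult: "cscale c A *v w = c *s (A *v w)"
  by (simp add: vec_eq_iff cscale_def matrix_vector_mult_def sum_distrib_left mult.assoc)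

section \<open>Integrals over trapezoids\<close>

text \<open>Moving to the fixed interval [0, 1] puts the endpoints into the integrand, so that
  continuity of parametrised integrals over a fixed box also covers moving endpoints, degenerate
  intervals included.\<close>

lemma integral_unit_interval:
  fixes f :: "real \<Rightarrow> 'a::euclidean_space"
  assumes "a \<le> b" "continuous_on {a..b} f"
  shows "integral {a..b} f = (b - a) *\<^sub>R integral {0..1} (\<lambda>u. f (a + u * (b - a)))"
proof (cases "a = b")
  case False
  then have ab: "b - a \<noteq> 0" and "a < b"
    using assms by auto
  have "(f has_integral integral {a..b} f) (cbox a b)"
    using integrable_continuous_interval[OF assms(2)] by (simp add: has_integral_integral)
  from has_integral_affinity[OF this ab, of a]
  have "((\<lambda>u. f (a + u * (b - a))) has_integral
      inverse (b - a) *\<^sub>R integral {a..b} f) ((\<lambda>x. (1 / (b - a)) *\<^sub>R x + - ((1 / (b - a)) *\<^sub>R a)) ` {a..b})"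
    using \<open>a < b\<close> by (simp add: algebra_simps divide_simps)
  also have "(\<lambda>x. (1 / (b - a)) *\<^sub>R x + - ((1 / (b - a)) *\<^sub>R a)) ` {a..b} = {0..1}"
  proof (intro equalityI subsetI)
    fix y :: real assume "y \<in> {0..1}"
    then have "a + 0 * (b - a) \<le> a + y * (b - a)" "a + y * (b - a) \<le> a + 1 * (b - a)"
      using \<open>a < b\<close> by (intro add_left_mono mult_right_mono; simp)+
    then have "a + y * (b - a) \<in> {a..b}"
      by simp
    moreover have "y = (1 / (b - a)) *\<^sub>R (a + y * (b - a)) + - ((1 / (b - a)) *\<^sub>R a)"
      using ab by (simp add: distrib_left)
    ultimately show "y \<in> (\<lambda>x. (1 / (b - a)) *\<^sub>R x + - ((1 / (b - a)) *\<^sub>R a)) ` {a..b}"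
      by (rule rev_image_eqI)
  qed (use \<open>a < b\<close> in \<open>auto simp: divide_le_eq simp flip: diff_divide_distrib\<close>)
  finally show ?thesis
    using ab by (simp add: integral_unique)
qed simp

lemma continuous_on_integral_bounds:
  fixes f :: "'p::topological_space \<Rightarrow> real \<Rightarrow> 'a::euclidean_space"
  assumes f: "continuous_on {(p, s). p \<in> U \<and> a p \<le> s \<and> s \<le> b p} (\<lambda>(p, s). f p s)"
    and a: "continuous_on U a" and b: "continuous_on U b"
    and ab: "\<And>p. p \<in> U \<Longrightarrow> a p \<le> b p"
  shows "continuous_on U (\<lambda>p. integral {a p..b p} (f p))"
proof -
  have fp: "continuous_on {a p..b p} (f p)" if "p \<in> U" for p
    using that by (intro continuous_on_compose2[OF f, of _ "\<lambda>s. (p, s)", simplified] continuous_intros) auto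
  have in01: "a p + u * (b p - a p) \<le> b p" "a p \<le> a p + u * (b p - a p)"
    if "p \<in> U" "0 \<le> u" "u \<le> 1" for p u
    using ab[OF that(1)] that mult_left_le_one_le[of "b p - a p" u] by auto
  have "continuous_on (U \<times> cbox 0 1) (\<lambda>(p, u::real). f p (a p + u * (b p - a p)))"
  proof -
    have fst: "continuous_on (U \<times> cbox 0 (1::real)) (\<lambda>x. a (fst x))"
      "continuous_on (U \<times> cbox 0 (1::real)) (\<lambda>x. b (fst x))"
      by (intro continuous_on_compose2[OF a] continuous_on_compose2[OF b] continuous_intros; auto)+
    have "continuous_on (U \<times> cbox 0 (1::real))
        (\<lambda>x. (\<lambda>(p, s). f p s) (fst x, a (fst x) + snd x * (b (fst x) - a (fst x))))"
      by (intro continuous_on_compose2[OF f] continuous_intros fst) (auto simp: in01 ab)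
    then show ?thesis
      by (simp add: case_prod_beta')
  qed
  from integral_continuous_on_param[OF this]
  have "continuous_on U (\<lambda>p. (b p - a p) *\<^sub>R integral {0..1} (\<lambda>u. f p (a p + u * (b p - a p))))"
    using a b by (auto intro!: continuous_intros)
  then show ?thesis
    by (rule continuous_on_eq) (simp add: integral_unit_interval ab fp)
qed

text \<open>Both sides are the integral of \<open>N\<close> over the trapezoid \<open>0 \<le> s \<le> m\<close>, \<open>s \<le> y \<le> x\<close>.\<close>

lemma integral_swap_trapezoid:
  fixes N :: "real \<Rightarrow> real \<Rightarrow> 'a::euclidean_space"
  assumes m: "0 \<le> m" and x: "0 \<le> x"
    and N: "continuous_on {(y, s). 0 \<le> s \<and> s \<le> m \<and> s \<le> y \<and> y \<le> x} (\<lambda>(y, s). N y s)"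
  shows "integral {0..min m x} (\<lambda>s. integral {s..x} (\<lambda>y. N y s)) =
         integral {0..x} (\<lambda>y. integral {0..min y m} (N y))"
proof -
  define S where "S = {(y, s). 0 \<le> s \<and> s \<le> m \<and> s \<le> y \<and> y \<le> x}"
  \<comment> \<open>The cut-off to the compact set \<open>S\<close> is integrable on the plane
    although discontinuous, and its sections give exactly the two inner integrals.\<close>
  define f where "f = (\<lambda>y s. indicator S (y, s) *\<^sub>R N y s)"
  have "S = ({0..x} \<times> {0..m}) \<inter> {p. snd p \<le> fst p}"
    by (auto simp: S_def)
  then have "compact S"
    by (auto intro!: compact_Int_closed compact_Times closed_Collect_le continuous_intros)
  then have "integrable lborel (\<lambda>p. indicator S p *\<^sub>R (\<lambda>(y, s). N y s) p)"
    using N unfolding S_def by (rule borel_integrable_compact)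
  then have int: "integrable (lborel \<Otimes>\<^sub>M lborel) (case_prod f)"
    by (simp add: lborel_prod f_def case_prod_beta')
  have sec1: "continuous_on {s..x} (\<lambda>y. N y s)" if "s \<in> {0..min m x}" for s
    using that
    by (intro continuous_on_compose2[OF N, of _ "\<lambda>y. (y, s)", simplified] continuous_intros) auto
  have sec2: "continuous_on {0..min y m} (N y)" if "y \<in> {0..x}" for y
    using that
    by (intro continuous_on_compose2[OF N, of _ "\<lambda>s. (y, s)", simplified] continuous_intros) auto
  have fst: "(\<integral>y. f y s \<partial>lborel) =
      (if s \<in> {0..min m x} then integral {s..x} (\<lambda>y. N y s) else 0)" for s
  proof (cases "s \<in> {0..min m x}")
    case True
    then have "(\<lambda>y. f y s) = (\<lambda>y. indicator {s..x} y *\<^sub>R N y s)"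
      by (auto simp: f_def S_def indicator_def)
    then show ?thesis
      using True set_borel_integral_eq_integral(2)[OF borel_integrable_atLeastAtMost'[OF sec1[OF True]]]
      by (simp add: set_lebesgue_integral_def)
  next
    case False
    then have "(\<lambda>y. f y s) = (\<lambda>y. 0)"
      by (auto simp: f_def S_def indicator_def)
    then show ?thesis
      using False by auto
  qed
  have snd: "(\<integral>s. f y s \<partial>lborel) = (if y \<in> {0..x} then integral {0..min y m} (N y) else 0)" for y
  proof (cases "y \<in> {0..x}")
    case True
    then have "(\<lambda>s. f y s) = (\<lambda>s. indicator {0..min y m} s *\<^sub>R N y s)"
      by (auto simp: f_def S_def indicator_def)
    then show ?thesis
      using True set_borel_integral_eq_integral(2)[OF borel_integrable_atLeastAtMost'[OF sec2[OF True]]]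
      by (simp add: set_lebesgue_integral_def)
  next
    case False
    then have "(\<lambda>s. f y s) = (\<lambda>s. 0)"
      by (auto simp: f_def S_def indicator_def)
    then show ?thesis
      using False by auto
  qed
  have "integral {0..min m x} (\<lambda>s. integral {s..x} (\<lambda>y. N y s)) = (\<integral>s. \<integral>y. f y s \<partial>lborel \<partial>lborel)"
    using integral_lborel[OF lborel_pair.integrable_snd[OF int]]
    by (simp only: fst integral_restrict_UNIV)
  also have "\<dots> = (\<integral>y. \<integral>s. f y s \<partial>lborel \<partial>lborel)"
    by (rule lborel_pair.Fubini_integral[OF int])
  also have "\<dots> = integral {0..x} (\<lambda>y. integral {0..min y m} (N y))"
    using integral_lborel[OF lborel_pair.integrable_fst[OF int]]
    by (simp only: snd integral_restrict_UNIV)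
  finally show ?thesis .
qed

text \<open>As written, \<open>x\<close> occurs in both ranges of integration. After exchanging the
  order it is only an upper limit, and the fundamental theorem applies with mere continuity of
  \<open>N\<close>.\<close>

lemma has_vector_derivative_trapezoid:
  fixes N :: "real \<Rightarrow> real \<Rightarrow> 'a::euclidean_space"
  assumes m: "0 \<le> m" and x: "0 \<le> x"
    and N: "continuous_on UNIV (\<lambda>(y, s). N y s)"
  shows "((\<lambda>x. integral {0..min m x} (\<lambda>s. integral {s..x} (\<lambda>y. N y s))) has_vector_derivative
      integral {0..min x m} (N x)) (at x within {0..})"
proof -
  have "continuous_on {0..x + 1} (\<lambda>y. integral {0..min y m} (N y))"
    using m by (intro continuous_on_integral_bounds continuous_on_subset[OF N] continuous_intros) auto
  then have "((\<lambda>x. integral {0..x} (\<lambda>y. integral {0..min y m} (N y))) has_vector_derivative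
      integral {0..min x m} (N x)) (at x within {0..x + 1})"
    using x by (intro integral_has_vector_derivative) auto
  \<comment> \<open>\<open>{0..x + 1}\<close> and \<open>{0..}\<close> coincide near
    \<open>x\<close>; the extra 1 keeps \<open>x\<close> away from the right end.\<close>
  then have "((\<lambda>x. integral {0..x} (\<lambda>y. integral {0..min y m} (N y))) has_vector_derivative
      integral {0..min x m} (N x)) (at x within {0..})"
    using x by (subst (asm) at_within_nhd[of x "{..<x + 1}" _ "{0..}"]) auto
  then show ?thesis
    by (rule has_vector_derivative_transform[rotated 2])
       (use x in \<open>auto intro!: integral_swap_trapezoid continuous_on_subset[OF N] m\<close>)
qed

section \<open>Volterra equations\<close>

lemma integral_exp_weight:
  assumes "(a::real) \<le> b" "0 < c"
  shows "((\<lambda>s. exp (- c * (b - s))) has_integral (1 - exp (- c * (b - a))) / c) {a..b}"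
proof -
  have "((\<lambda>s. exp (- c * (b - s))) has_integral
      exp (- c * (b - b)) / c - exp (- c * (b - a)) / c) {a..b}"
    using assms
    by (intro fundamental_theorem_of_calculus)
       (auto intro!: derivative_eq_intros simp: has_real_derivative_iff_has_vector_derivative[symmetric])
  then show ?thesis
    by (simp add: diff_divide_distrib)
qed

text \<open>The weight has mass at most 1 / c on every interval ending at \<open>b\<close>, however
  long. A large \<open>c\<close> therefore beats the size of any bounded kernel.\<close>

lemma norm_weighted_integral_le:
  fixes g :: "real \<Rightarrow> 'a::euclidean_space"
  assumes ab: "a \<le> b" and c: "0 < c" and N: "0 \<le> N"
    and g: "continuous_on {a..b} g" "\<And>s. s \<in> {a..b} \<Longrightarrow> norm (g s) \<le> N"
  shows "norm (integral {a..b} (\<lambda>s. exp (- c * (b - s)) *\<^sub>R g s)) \<le> N / c"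
proof -
  have "norm (integral {a..b} (\<lambda>s. exp (- c * (b - s)) *\<^sub>R g s)) \<le>
      integral {a..b} (\<lambda>s. exp (- c * (b - s)) * N)"
    using g by (intro integral_norm_bound_integral integrable_continuous_interval continuous_intros)
      (auto intro!: mult_left_mono)
  also have "\<dots> = (1 - exp (- c * (b - a))) / c * N"
    using has_integral_mult_left[OF integral_exp_weight[OF ab c], of N] by (rule integral_unique)
  also have "\<dots> \<le> 1 / c * N"
    using c N by (intro mult_right_mono divide_right_mono) auto
  finally show ?thesis
    by simp
qed

lemma bound_on_triangle:
  fixes K :: "real \<Rightarrow> real \<Rightarrow> 'a::real_normed_vector"
  assumes "continuous_on {(x, t). 0 \<le> t \<and> t \<le> x} (\<lambda>(x, t). K x t)"
  obtains M where "0 < M" "\<And>x t. 0 \<le> t \<Longrightarrow> t \<le> x \<Longrightarrow> x \<le> X \<Longrightarrow> norm (K x t) \<le> M"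
proof -
  let ?T = "({0..X} \<times> {0..X}) \<inter> {p. snd p \<le> fst p}"
  have "compact ?T"
    by (auto intro!: compact_Int_closed compact_Times closed_Collect_le continuous_intros)
  moreover have "continuous_on ?T (\<lambda>(x, t). K x t)"
    by (rule continuous_on_subset[OF assms]) auto
  ultimately have "bounded ((\<lambda>(x, t). K x t) ` ?T)"
    by (intro compact_imp_bounded compact_continuous_image)
  then obtain M where M: "0 < M" "\<And>y. y \<in> (\<lambda>(x, t). K x t) ` ?T \<Longrightarrow> norm y \<le> M"
    by (auto simp: bounded_pos)
  show ?thesis
  proof (rule that[OF M(1)])
    fix x t assume "0 \<le> t" "t \<le> x" "x \<le> X"
    then have "K x t \<in> (\<lambda>(x, t). K x t) ` ?T"
      by (intro image_eqI[of _ _ "(x, t)"]) auto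
    then show "norm (K x t) \<le> M"
      by (rule M)
  qed
qed

text \<open>The weight \<open>exp (- c x)\<close> turns the Volterra operator into a contraction. Composing with the
  retraction \<open>(b, a)\<close> of the plane onto the triangle makes the fixed point space that of bounded
  continuous functions on the plane.\<close>

lemma volterra_resolvent_exists:
  fixes K :: "real \<Rightarrow> real \<Rightarrow> complex^'m^'m"
  assumes K: "continuous_on {(x, t). 0 \<le> t \<and> t \<le> x} (\<lambda>(x, t). K x t)" and X: "0 \<le> X"
  obtains R :: "real \<Rightarrow> real \<Rightarrow> complex^'m^'m" where
    "continuous_on UNIV (\<lambda>(x, t). R x t)"
    "\<And>x t. 0 \<le> t \<Longrightarrow> t \<le> x \<Longrightarrow> x \<le> X \<Longrightarrow>
      R x t + K x t + integral {t..x} (\<lambda>s. K x s ** R s t) = 0"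
proof -
  obtain M where M: "0 < M" "\<And>x t. 0 \<le> t \<Longrightarrow> t \<le> x \<Longrightarrow> x \<le> X \<Longrightarrow> norm (K x t) \<le> M"
    by (rule bound_on_triangle[OF K, where X=X]) blast
  obtain C where C: "0 < C" "\<And>(A :: complex^'m^'m) (B :: complex^'m^'m). norm (A ** B) \<le> norm A * norm B * C"
    using bounded_bilinear.pos_bounded[OF bounded_bilinear_matrix_mult[where 'a='m and 'b='m and 'c='m]]
    by auto
  \<comment> \<open>With \<open>C\<close> the constant of the matrix product and \<open>M\<close> a
    bound for \<open>K\<close>, the weighted operator has Lipschitz constant C * M / c, which is 1 /
    2 for this choice.\<close>
  define c where "c = 2 * C * M"
  have c: "0 < c"
    using C(1) M(1) by (simp add: c_def)
  define b where "b = (\<lambda>p :: real \<times> real. max 0 (min X (fst p)))"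
  define a where "a = (\<lambda>p :: real \<times> real. max 0 (min (b p) (snd p)))"
  have ab: "0 \<le> a p" "a p \<le> b p" "b p \<le> X" for p
    using X by (auto simp: a_def b_def)
  have cont_b: "continuous_on S (\<lambda>z. b (f z))" and cont_a: "continuous_on S (\<lambda>z. a (f z))"
    if "continuous_on S f" for S :: "'z::topological_space set" and f
    unfolding a_def b_def by (intro continuous_intros that)+
  have contK: "continuous_on S (\<lambda>z. K (f z) (g z))"
    if "continuous_on S f" "continuous_on S g" "\<And>z. z \<in> S \<Longrightarrow> 0 \<le> g z \<and> g z \<le> f z"
    for S :: "'z::topological_space set" and f g
    by (intro continuous_on_compose2[OF K, of _ "\<lambda>z. (f z, g z)", simplified] continuous_intros that)
      (use that in auto)
  \<comment> \<open>A fixed point of \<open>T\<close> stands for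
    \<open>exp (- c * x) *\<^sub>R R x t\<close>: multiplying the resolvent equation by exp (- c x)
    leaves the weight exp (- c (x - s)) on the rescaled unknown. The second variable is a mere
    parameter, whence the argument \<open>(s, a p)\<close>.\<close>
  define G where "G = (\<lambda>(\<phi> :: real \<times> real \<Rightarrow> complex^'m^'m) p s. K (b p) s ** \<phi> (s, a p))"
  define T where "T = (\<lambda>(\<phi> :: real \<times> real \<Rightarrow> complex^'m^'m) p. - (exp (- c * b p) *\<^sub>R K (b p) (a p)) -
      integral {a p..b p} (\<lambda>s. exp (- c * (b p - s)) *\<^sub>R G \<phi> p s))"
  have contG: "continuous_on {(p, s). p \<in> UNIV \<and> a p \<le> s \<and> s \<le> b p} (\<lambda>z. G \<phi> (fst z) (snd z))"
    if \<phi>: "continuous_on UNIV \<phi>" for \<phi>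
    unfolding G_def
    by (intro bounded_bilinear.continuous_on[OF bounded_bilinear_matrix_mult] contK
        continuous_on_compose2[OF \<phi>] continuous_intros cont_a cont_b) (auto intro: order_trans[OF ab(1)])
  have contGp: "continuous_on {a p..b p} (G \<phi> p)" if \<phi>: "continuous_on UNIV \<phi>" for \<phi> p
    by (intro continuous_on_compose2[OF contG[OF \<phi>], of _ "\<lambda>s. (p, s)", simplified] continuous_intros) auto
  have G_bound: "norm (G \<phi> p s) \<le> C * M * N" if "\<And>z. norm (\<phi> z) \<le> N" "s \<in> {a p..b p}" for \<phi> p s N
  proof -
    have "norm (G \<phi> p s) \<le> norm (K (b p) s) * norm (\<phi> (s, a p)) * C"
      unfolding G_def by (rule C)
    also have "\<dots> \<le> M * N * C"
      using that ab[of p] C(1) M(1)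
      by (intro mult_right_mono mult_mono M(2)) (auto intro: order_trans)
    finally show ?thesis
      by (simp add: mult_ac)
  qed
  have T_bcont: "T \<phi> \<in> bcontfun" if \<phi>: "continuous_on UNIV \<phi>" "\<And>z. norm (\<phi> z) \<le> N" for \<phi> N
  proof (rule bcontfun_normI)
    have "continuous_on {(p, s). p \<in> UNIV \<and> a p \<le> s \<and> s \<le> b p}
        (\<lambda>(p, s). exp (- c * (b p - s)) *\<^sub>R G \<phi> p s)"
      unfolding case_prod_beta'
      by (intro continuous_intros contG[OF \<phi>(1), unfolded case_prod_beta']
          cont_b)
    then have "continuous_on UNIV
        (\<lambda>p. integral {a p..b p} (\<lambda>s. exp (- c * (b p - s)) *\<^sub>R G \<phi> p s))"
      by (rule continuous_on_integral_bounds) (intro cont_a cont_b continuous_on_id ab)+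
    moreover have "continuous_on UNIV (\<lambda>p. K (b p) (a p))"
      by (intro contK cont_a cont_b continuous_on_id) (simp add: ab)
    ultimately show "continuous_on UNIV (T \<phi>)"
      unfolding T_def by (intro continuous_intros cont_b)
  next
    fix p
    have N: "0 \<le> N"
      using \<phi>(2) norm_ge_zero order_trans by blast
    have "norm (T \<phi> p) \<le> norm (exp (- c * b p) *\<^sub>R K (b p) (a p)) +
        norm (integral {a p..b p} (\<lambda>s. exp (- c * (b p - s)) *\<^sub>R G \<phi> p s))"
      unfolding T_def by (rule order_trans[OF norm_triangle_ineq4]) simp
    also have "norm (exp (- c * b p) *\<^sub>R K (b p) (a p)) \<le> 1 * M"
      using c ab[of p] M(1) unfolding norm_scaleR by (intro mult_mono M(2)) auto
    also have "norm (integral {a p..b p} (\<lambda>s. exp (- c * (b p - s)) *\<^sub>R G \<phi> p s)) \<le> (C * M * N) / c"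
      using c ab[of p] C(1) M(1) N
      by (intro norm_weighted_integral_le contGp \<phi>(1) G_bound \<phi>(2)) auto
    finally show "norm (T \<phi> p) \<le> 1 * M + (C * M * N) / c"
      by simp_all
  qed
  have T_lipschitz: "dist (T \<phi> p) (T \<psi> p) \<le> 1 / 2 * N"
    if \<phi>: "continuous_on UNIV \<phi>" and \<psi>: "continuous_on UNIV \<psi>" and N: "\<And>z. dist (\<phi> z) (\<psi> z) \<le> N"
    for \<phi> \<psi> p N
  proof -
    have N0: "0 \<le> N"
      using N zero_le_dist order_trans by blast
    have G_diff: "G \<phi> p s - G \<psi> p s = G (\<lambda>z. \<phi> z - \<psi> z) p s" for s
      by (simp add: G_def bounded_bilinear.diff_right[OF bounded_bilinear_matrix_mult])
    have int: "(\<lambda>s. exp (- c * (b p - s)) *\<^sub>R G \<xi> p s) integrable_on {a p..b p}"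
      if "continuous_on UNIV \<xi>" for \<xi>
      by (intro integrable_continuous_interval continuous_intros contGp that)
    have "T \<psi> p - T \<phi> p = integral {a p..b p} (\<lambda>s. exp (- c * (b p - s)) *\<^sub>R (G \<phi> p s - G \<psi> p s))"
      unfolding T_def scaleR_diff_right
        Henstock_Kurzweil_Integration.integral_diff[OF int[OF \<phi>] int[OF \<psi>]] by simp
    also have "norm \<dots> \<le> C * M * N / c"
      unfolding G_diff using c ab[of p] C(1) M(1) N0 N
      by (intro norm_weighted_integral_le contGp continuous_intros \<phi> \<psi> G_bound) (auto simp: dist_norm)
    also have "\<dots> = 1 / 2 * N"
      using C(1) M(1) by (simp add: c_def)
    finally show ?thesis
      by (simp add: dist_norm norm_minus_commute)
  qed
  define T' :: "((real \<times> real) \<Rightarrow>\<^sub>C (complex^'m^'m)) \<Rightarrow> _" where "T' = (\<lambda>f. Bcontfun (T (apply_bcontfun f)))"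
  have T': "apply_bcontfun (T' f) = T (apply_bcontfun f)" for f
    unfolding T'_def by (intro Bcontfun_inverse T_bcont[OF _ norm_bounded[of f]] continuous_on_apply_bcontfun)
  have lip: "dist (T' f) (T' g) \<le> 1 / 2 * dist f g" for f g
    by (rule dist_bound)
       (unfold T', intro T_lipschitz dist_bounded continuous_on_apply_bcontfun)
  have "\<exists>!f. T' f = f"
    by (rule banach_fix_type[of "1 / 2"], simp, simp, intro allI lip)
  then obtain f where "T' f = f"
    by blast
  then have fixp: "f p = T f p" for p
    using T'[of f] by simp
  show ?thesis
  proof (rule that)
    show "continuous_on UNIV (\<lambda>(x, t). exp (c * x) *\<^sub>R f (x, t))"
      unfolding case_prod_beta' prod.collapse by (intro continuous_intros continuous_on_apply_bcontfun)
    fix x t assume xt: "0 \<le> t" "t \<le> x" "x \<le> X"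
    then have abxt: "a (x, t) = t" "b (x, t) = x"
      by (auto simp: a_def b_def)
    have "exp (c * x) *\<^sub>R integral {t..x} (\<lambda>s. exp (- c * (x - s)) *\<^sub>R (K x s ** f (s, t))) =
        integral {t..x} (\<lambda>s. exp (c * x) *\<^sub>R (exp (- c * (x - s)) *\<^sub>R (K x s ** f (s, t))))"
      by (rule integral_cmul[symmetric])
    also have "\<dots> = integral {t..x} (\<lambda>s. K x s ** (exp (c * s) *\<^sub>R f (s, t)))"
      by (intro integral_cong)
         (simp add: bounded_bilinear.scaleR_right[OF bounded_bilinear_matrix_mult] right_diff_distrib
           flip: exp_add)
    finally show "exp (c * x) *\<^sub>R f (x, t) + K x t +
        integral {t..x} (\<lambda>s. K x s ** (exp (c * s) *\<^sub>R f (s, t))) = 0"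
      by (subst fixp) (simp add: T_def G_def abxt scaleR_diff_right flip: exp_add)
  qed
qed

text \<open>Where \<open>exp (- c * x) * norm (z x)\<close> attains its maximum over [0, X], the
  equation bounds this maximum by half of itself, so it is zero.\<close>

lemma volterra_unique:
  fixes K :: "real \<Rightarrow> real \<Rightarrow> complex^'m^'m" and z :: "real \<Rightarrow> complex^'n^'m"
  assumes K: "continuous_on {(x, t). 0 \<le> t \<and> t \<le> x} (\<lambda>(x, t). K x t)"
    and z: "continuous_on {0..X} z"
    and eq: "\<And>x. x \<in> {0..X} \<Longrightarrow> z x + integral {0..x} (\<lambda>t. K x t ** z t) = 0"
    and x: "x \<in> {0..X}"
  shows "z x = 0"
proof -
  obtain M where M: "0 < M" "\<And>x t. 0 \<le> t \<Longrightarrow> t \<le> x \<Longrightarrow> x \<le> X \<Longrightarrow> norm (K x t) \<le> M"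
    by (rule bound_on_triangle[OF K, where X=X]) blast
  obtain C where C: "0 < C" "\<And>(A :: complex^'m^'m) (B :: complex^'n^'m). norm (A ** B) \<le> norm A * norm B * C"
    using bounded_bilinear.pos_bounded[OF bounded_bilinear_matrix_mult[where 'a='m and 'b='m and 'c='n]]
    by auto
  define c where "c = 2 * C * M"
  have c: "0 < c"
    using C(1) M(1) by (simp add: c_def)
  define g where "g = (\<lambda>x. exp (- c * x) * norm (z x))"
  have "continuous_on {0..X} g"
    unfolding g_def by (intro continuous_intros z)
  then obtain w where w: "w \<in> {0..X}" "\<And>y. y \<in> {0..X} \<Longrightarrow> g y \<le> g w"
    using continuous_attains_sup[of "{0..X}" g] x by auto
  have contK: "continuous_on {0..w} (K w)"
    by (intro continuous_on_compose2[OF K, of _ "\<lambda>t. (w, t)", simplified] continuous_intros) auto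
  have "z w = - integral {0..w} (\<lambda>t. K w t ** z t)"
    using eq[OF w(1)] by (simp add: eq_neg_iff_add_eq_0)
  also have "integral {0..w} (\<lambda>t. K w t ** z t) =
      exp (c * w) *\<^sub>R integral {0..w} (\<lambda>t. exp (- c * (w - t)) *\<^sub>R (K w t ** (exp (- c * t) *\<^sub>R z t)))"
    by (subst integral_cmul[symmetric], intro integral_cong)
       (simp add: bounded_bilinear.scaleR_right[OF bounded_bilinear_matrix_mult] algebra_simps flip: exp_add)
  finally have "g w = norm (integral {0..w} (\<lambda>t. exp (- c * (w - t)) *\<^sub>R (K w t ** (exp (- c * t) *\<^sub>R z t))))"
    by (simp add: g_def exp_minus)
  also have "\<dots> \<le> C * M * g w / c"
  proof (rule norm_weighted_integral_le)
    show "continuous_on {0..w} (\<lambda>t. K w t ** (exp (- c * t) *\<^sub>R z t))"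
      using w by (intro bounded_bilinear.continuous_on[OF bounded_bilinear_matrix_mult] contK
        continuous_intros continuous_on_subset[OF z]) auto
    fix t assume t: "t \<in> {0..w}"
    have "norm (K w t ** (exp (- c * t) *\<^sub>R z t)) \<le> norm (K w t) * norm (exp (- c * t) *\<^sub>R z t) * C"
      by (rule C)
    also have "\<dots> \<le> M * g w * C"
      using t w M(1) C(1) w(2)[of t] by (intro mult_right_mono mult_mono M(2)) (auto simp: g_def)
    finally show "norm (K w t ** (exp (- c * t) *\<^sub>R z t)) \<le> C * M * g w"
      by (simp add: mult_ac)
  qed (use w c C(1) M(1) in \<open>auto simp: g_def\<close>)
  also have "\<dots> = g w / 2"
    using C(1) M(1) by (simp add: c_def)
  finally have "g w \<le> 0"
    by simp
  with w(2)[OF x] have "g x \<le> 0"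
    by simp
  then show ?thesis
    by (simp add: g_def mult_le_0_iff)
qed

section \<open>Dirichlet integrals\<close>

text \<open>Integration by parts of the squared sine over the squared variable leads to
  \<open>Si (2 * y)\<close> minus sin^2 y / y. Written with \<open>sinc\<close>, this antiderivative
  makes sense at 0; the limit of \<open>Si\<close> gives half of the value and evenness the
  rest.\<close>

lemma has_bochner_integral_sinc_squared:
  "has_bochner_integral lborel (\<lambda>y::real. (sinc y)\<^sup>2) pi"
proof -
  define G where "G = (\<lambda>y::real. Si (2 * y) - y * (sinc y)\<^sup>2)"
  have der: "(G has_real_derivative (sinc y)\<^sup>2) (at y)" for y
  proof -
    have Si: "((\<lambda>y. Si (2 * y)) has_real_derivative sinc (2 * y) * 2) (at y)"
      using DERIV_Si[of "2 * y"] by (intro DERIV_chain2[of Si]) (auto intro!: derivative_eq_intros)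
    show ?thesis
    proof (cases "y = 0")
      \<comment> \<open>The quotient sin^2 y / y of the other case cannot be differentiated at 0;
        here the difference quotient of \<open>y * (sinc y)\<^sup>2\<close> is
        \<open>(sinc h)\<^sup>2\<close> itself.\<close>
      case True
      have "((\<lambda>h::real. (sinc h)\<^sup>2) \<longlongrightarrow> (sinc 0)\<^sup>2) (at 0)"
        using isCont_sinc[of 0] by (intro tendsto_power) (simp add: isCont_def)
      moreover have "(h * (sinc h)\<^sup>2 - 0 * (sinc 0)\<^sup>2) / (h - 0) = (sinc h)\<^sup>2" if "h \<noteq> 0" for h :: real
        using that by simp
      ultimately have "((\<lambda>h::real. (h * (sinc h)\<^sup>2 - 0 * (sinc 0)\<^sup>2) / (h - 0)) \<longlongrightarrow> (sinc 0)\<^sup>2) (at 0)"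
        by (subst LIM_equal[where g="\<lambda>h. (sinc h)\<^sup>2"]) blast+
      then have "((\<lambda>h. h * (sinc h)\<^sup>2) has_real_derivative (sinc 0)\<^sup>2) (at (0::real))"
        by (simp only: has_field_derivative_iff)
      from DERIV_diff[OF Si[unfolded True] this] show ?thesis
        unfolding G_def True by simp
    next
      case False
      have "((\<lambda>y. (sin y)\<^sup>2 / y) has_real_derivative
          (2 * sin y * cos y * y - (sin y)\<^sup>2) / y\<^sup>2) (at y)"
        using False by (auto intro!: derivative_eq_intros simp: power2_eq_square)
      moreover have "(sin h)\<^sup>2 / h = h * (sinc h)\<^sup>2" for h :: real
        by (simp add: power2_eq_square)
      ultimately have "((\<lambda>y. y * (sinc y)\<^sup>2) has_real_derivative
          (2 * sin y * cos y * y - (sin y)\<^sup>2) / y\<^sup>2) (at y)"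
        by (simp only:)
      from DERIV_diff[OF Si this]
      have "(G has_real_derivative
          sinc (2 * y) * 2 - (2 * sin y * cos y * y - (sin y)\<^sup>2) / y\<^sup>2) (at y)"
        unfolding G_def .
      also have "sinc (2 * y) * 2 - (2 * sin y * cos y * y - (sin y)\<^sup>2) / y\<^sup>2 = (sinc y)\<^sup>2"
        using False sin_double[of y] by (simp add: field_simps power2_eq_square)
      finally show ?thesis .
    qed
  qed
  have "((\<lambda>y::real. y * (sinc y)\<^sup>2) \<longlongrightarrow> 0) at_top"
  proof (rule Lim_null_comparison)
    show "\<forall>\<^sub>F y in at_top. norm (y * (sinc y)\<^sup>2) \<le> inverse (y::real)"
      using eventually_gt_at_top[of "0::real"]
    proof eventually_elim
      case (elim y)
      then show ?case
        using abs_square_le_1[of "sin y"] by (simp add: power2_eq_square abs_mult field_simps)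
    qed
    show "(inverse \<longlongrightarrow> (0::real)) at_top"
      by (rule tendsto_inverse_0_at_top[OF filterlim_ident])
  qed
  moreover have "((\<lambda>y::real. Si (2 * y)) \<longlongrightarrow> pi / 2) at_top"
    by (rule filterlim_compose[OF Si_at_top])
       (auto intro!: filterlim_tendsto_pos_mult_at_top[OF tendsto_const] filterlim_ident)
  ultimately have lim: "(G \<longlongrightarrow> pi / 2) at_top"
    unfolding G_def by (auto intro: tendsto_eq_intros)
  have "(\<integral>\<^sup>+y. ennreal ((sinc y)\<^sup>2) * indicator {0..} y \<partial>lborel) = pi / 2 - G 0"
    by (rule nn_integral_FTC_atLeast) (rule borel_measurable_power borel_measurable_sinc der lim zero_le_power2)+
  then have "(\<integral>\<^sup>+y. ennreal (indicator {0..} y *\<^sub>R (sinc y)\<^sup>2) \<partial>lborel) = ennreal (pi / 2)"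
    by (simp add: G_def Si_def zero_ereal_def ennreal_mult' mult.commute ennreal_indicator)
  then have "has_bochner_integral lborel (\<lambda>y::real. indicator {0..} y *\<^sub>R (sinc y)\<^sup>2) (pi / 2)"
    by (intro has_bochner_integral_nn_integral) (auto)
  from has_bochner_integral_even_function[OF this] show ?thesis
    by simp
qed

text \<open>By the half-angle formula the integrand is, off l = 0, a rescaled squared
  \<open>sinc\<close> with factor \<open>c\<^sup>2 / 2\<close>; the modulus of \<open>c\<close>
  comes from the Jacobian.\<close>

lemma has_bochner_integral_one_minus_cos:
  "has_bochner_integral lborel (\<lambda>l::real. (1 - cos (c * l)) / l\<^sup>2) (pi * \<bar>c\<bar>)"
proof (cases "c = 0")
  case False
  have "has_bochner_integral lborel (\<lambda>l. (sinc (0 + c / 2 * l))\<^sup>2) (pi /\<^sub>R \<bar>c / 2\<bar>)"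
    using False has_bochner_integral_sinc_squared
    by (subst (asm) lborel_has_bochner_integral_real_affine_iff[of "c / 2" _ _ 0]) (auto)
  then have *: "has_bochner_integral lborel (\<lambda>l. c\<^sup>2 / 2 * (sinc (0 + c / 2 * l))\<^sup>2) (c\<^sup>2 / 2 * (pi /\<^sub>R \<bar>c / 2\<bar>))"
    by (rule has_bochner_integral_mult_right)
  have "AE l in lborel. c\<^sup>2 / 2 * (sinc (0 + c / 2 * l))\<^sup>2 = (1 - cos (c * l)) / l\<^sup>2"
    using AE_lborel_singleton[of "0::real"]
  proof eventually_elim
    case (elim l)
    have "cos (c * l) = 1 - 2 * (sin (c / 2 * l))\<^sup>2"
      using cos_double_sin[of "c / 2 * l"] by simp
    then show ?case
      using elim False by (simp add: field_simps power2_eq_square)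
  qed
  then have "has_bochner_integral lborel (\<lambda>l. (1 - cos (c * l)) / l\<^sup>2) (c\<^sup>2 / 2 * (pi /\<^sub>R \<bar>c / 2\<bar>))"
    using * by (subst has_bochner_integral_cong_AE[symmetric]) auto
  also have "c\<^sup>2 / 2 * (pi /\<^sub>R \<bar>c / 2\<bar>) = pi * \<bar>c\<bar>"
    using False by (simp add: power2_eq_square field_simps abs_if)
  finally show ?thesis .
qed (simp add: has_bochner_integral_zero)

lemma norm_cis_minus_one_squared: "(norm (cis \<theta> - 1))\<^sup>2 = 2 * (1 - cos \<theta>)"
proof -
  have "(norm (cis \<theta> - 1))\<^sup>2 = (cos \<theta>)\<^sup>2 + (sin \<theta>)\<^sup>2 + 1 - 2 * cos \<theta>"
    by (simp add: cmod_power2 power2_diff)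
  then show ?thesis
    by simp
qed

text \<open>The real part splits into three integrals of the previous kind. For \<open>p\<close> and
  \<open>q\<close> of equal sign the value is 2 pi times the smaller modulus, the origin of
  \<open>min x t\<close>; for opposite signs it is zero. The imaginary part is odd.\<close>

lemma has_bochner_integral_cis_products:
  fixes p q :: real
  defines "E \<equiv> \<lambda>l. (cis (p * l) - 1) * cnj (cis (q * l) - 1) / of_real (l\<^sup>2)"
  shows "has_bochner_integral lborel (\<lambda>l. Re (E l)) (pi * (\<bar>p\<bar> + \<bar>q\<bar> - \<bar>p - q\<bar>))" (is ?Re)
    and "has_bochner_integral lborel (\<lambda>l. Im (E l)) 0" (is ?Im)
proof -
  have "has_bochner_integral lborel (\<lambda>l. (1 - cos (p * l)) / l\<^sup>2 + (1 - cos (q * l)) / l\<^sup>2 -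
      (1 - cos ((p - q) * l)) / l\<^sup>2) (pi * \<bar>p\<bar> + pi * \<bar>q\<bar> - pi * \<bar>p - q\<bar>)"
    by (intro has_bochner_integral_add has_bochner_integral_diff has_bochner_integral_one_minus_cos)
  moreover have "Re (E l) = (1 - cos (p * l)) / l\<^sup>2 + (1 - cos (q * l)) / l\<^sup>2 - (1 - cos ((p - q) * l)) / l\<^sup>2" for l
    by (simp add: E_def Re_divide_of_real cos_diff left_diff_distrib add_divide_distrib[symmetric] diff_divide_distrib[symmetric])
       (simp add: algebra_simps)
  ultimately show ?Re
    by (simp only: distrib_left right_diff_distrib)
  have meas: "E \<in> borel_measurable borel"
    unfolding E_def cis_conv_exp
    by (intro borel_measurable_divide borel_measurable_continuous_onI continuous_intros)
  \<comment> \<open>Oddness gives integral zero only for an integrable function. The product of the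
    two moduli is at most half the sum of their squares, and these are integrands already
    treated.\<close>
  have "integrable lborel (\<lambda>l. (1 - cos (p * l)) / l\<^sup>2 + (1 - cos (q * l)) / l\<^sup>2)"
    using has_bochner_integral_one_minus_cos by (intro Bochner_Integration.integrable_add) (auto simp: has_bochner_integral_iff)
  then have int: "integrable lborel (\<lambda>l. Im (E l))"
  proof (rule Bochner_Integration.integrable_bound)
    show "(\<lambda>l. Im (E l)) \<in> borel_measurable lborel"
      using meas by measurable
    show "AE l in lborel. norm (Im (E l)) \<le> norm ((1 - cos (p * l)) / l\<^sup>2 + (1 - cos (q * l)) / l\<^sup>2)"
    proof (intro AE_I2)
      fix l
      let ?a = "norm (cis (p * l) - 1)" and ?b = "norm (cis (q * l) - 1)"
      have "norm (Im (E l)) \<le> norm (E l)"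
        using abs_Im_le_cmod by simp
      also have "\<dots> = ?a * ?b / l\<^sup>2"
        unfolding E_def norm_divide norm_mult complex_mod_cnj by (simp add: norm_power)
      also have "\<dots> \<le> ((?a\<^sup>2 + ?b\<^sup>2) / 2) / l\<^sup>2"
        using sum_squares_bound[of ?a ?b] by (intro divide_right_mono) auto
      also have "\<dots> = (1 - cos (p * l)) / l\<^sup>2 + (1 - cos (q * l)) / l\<^sup>2"
        unfolding norm_cis_minus_one_squared by (cases "l = 0") (simp_all add: field_simps)
      also have "\<dots> \<le> norm \<dots>"
        by simp
      finally show "norm (Im (E l)) \<le> norm ((1 - cos (p * l)) / l\<^sup>2 + (1 - cos (q * l)) / l\<^sup>2)" .
    qed
  qed
  have odd: "Im (E (- l)) = - Im (E l)" for l
  proof -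
    have "E (- l) = cnj (E l)"
      by (simp add: E_def cis_cnj mult.commute)
    then show ?thesis
      by simp
  qed
  have "integrable lborel (\<lambda>l. indicator {0..} l *\<^sub>R Im (E l))"
    by (intro integrable_mult_indicator int) auto
  then show ?Im
    using odd by (intro has_bochner_integral_odd_function[of _ "\<integral>l. indicator {0..} l *\<^sub>R Im (E l) \<partial>lborel"])
      (auto simp: has_bochner_integral_iff)
qed

section \<open>Eigenvectors and the matrix exponential\<close>

text \<open>Otherwise the orthogonal complement \<open>W\<close> of all eigenvectors is nonzero and
  invariant under \<open>T\<close>. A maximiser of the Rayleigh quotient on its unit sphere would
  then be an eigenvector in \<open>W\<close>, hence orthogonal to itself.\<close>

lemma span_eigenvectors:
  fixes T :: "'a::euclidean_space \<Rightarrow> 'a"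
  assumes T: "linear T" and sym: "\<And>x y. x \<bullet> T y = T x \<bullet> y"
  shows "span {v. \<exists>a. T v = a *\<^sub>R v} = UNIV"
proof (rule ccontr)
  define S where "S = span {v. \<exists>a. T v = a *\<^sub>R v}"
  define W where "W = {x. \<forall>v\<in>{v. \<exists>a. T v = a *\<^sub>R v}. v \<bullet> x = 0}"
  interpret T: linear T by (rule T)
  assume "span {v. \<exists>a. T v = a *\<^sub>R v} \<noteq> UNIV"
  then obtain z where z: "z \<notin> S"
    by (auto simp: S_def)
  obtain y w where yw: "y \<in> S" "\<And>v. v \<in> S \<Longrightarrow> orthogonal w v" "z = y + w"
    using orthogonal_subspace_decomp_exists[of "{v. \<exists>a. T v = a *\<^sub>R v}" z] unfolding S_def by blast
  have "w \<noteq> 0" "w \<in> W"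
    using z yw by (auto simp: W_def S_def orthogonal_def inner_commute span_base)
  have W: "subspace W"
    by (auto simp: W_def subspace_def inner_add_right)
  have TW: "T x \<in> W" if "x \<in> W" for x
    using that by (auto simp: W_def sym)
  have "compact (W \<inter> sphere 0 1)"
    using closed_subspace[OF W] by (simp add: closed_Int_compact)
  moreover have "w /\<^sub>R norm w \<in> W \<inter> sphere 0 1"
    using \<open>w \<noteq> 0\<close> \<open>w \<in> W\<close> subspace_mul[OF W] by auto
  then have "W \<inter> sphere 0 1 \<noteq> {}"
    by blast
  moreover have "continuous_on (W \<inter> sphere 0 1) (\<lambda>x. x \<bullet> T x)"
    by (intro continuous_intros linear_continuous_on T.linear_axioms[unfolded linear_conv_bounded_linear])
  ultimately obtain x0 where x0': "x0 \<in> W \<inter> sphere 0 1"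
      "\<forall>x\<in>W \<inter> sphere 0 1. x \<bullet> T x \<le> x0 \<bullet> T x0"
    using continuous_attains_sup[of "W \<inter> sphere 0 1" "\<lambda>x. x \<bullet> T x"] by blast
  then have x0: "x0 \<in> W" "norm x0 = 1"
    by (blast, meson IntD2 mem_sphere_0)
  have max: "x \<bullet> T x \<le> x0 \<bullet> T x0" if "x \<in> W" "norm x = 1" for x
  proof -
    have "x \<in> W \<inter> sphere 0 1"
      using that by simp
    with x0'(2) show ?thesis
      by blast
  qed
  define m where "m = x0 \<bullet> T x0"
  \<comment> \<open>\<open>A\<close> is nonnegative on \<open>W\<close> and vanishes at the
    maximiser \<open>x0\<close>. The vector \<open>d\<close> below is half its gradient at
    \<open>x0\<close>, so it has to vanish.\<close>
  define A where "A = (\<lambda>y. m * (y \<bullet> y) - y \<bullet> T y)"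
  have A: "0 \<le> A y" if "y \<in> W" for y
  proof (cases "y = 0")
    case False
    have "(y /\<^sub>R norm y) \<bullet> T (y /\<^sub>R norm y) \<le> m"
      unfolding m_def using that False subspace_mul[OF W] by (intro max) auto
    then have "(y \<bullet> T y) / (norm y)\<^sup>2 \<le> m"
      by (simp add: T.scaleR power2_eq_square divide_inverse mult_ac)
    then show ?thesis
      using False by (simp add: A_def power2_norm_eq_inner divide_le_eq mult.commute)
  qed (simp add: A_def T.zero)
  define d where "d = m *\<^sub>R x0 - T x0"
  have d: "d \<in> W"
    unfolding d_def using W x0(1) TW by (intro subspace_diff subspace_mul)
  have expand: "A (x0 + s *\<^sub>R d) = 2 * s * (d \<bullet> d) + s\<^sup>2 * A d" for s
  proof -
    have "A x0 = 0"
      using x0(2) by (simp add: A_def m_def norm_eq_1)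
    moreover have "A (x0 + s *\<^sub>R d) = A x0 + 2 * s * (m * (x0 \<bullet> d) - T x0 \<bullet> d) + s\<^sup>2 * A d"
      by (simp add: A_def T.add T.scaleR inner_add_left inner_add_right sym[of x0 d] inner_commute[of d x0]
          inner_commute[of d "T x0"]
          power2_eq_square algebra_simps)
    moreover have "m * (x0 \<bullet> d) - T x0 \<bullet> d = d \<bullet> d"
      by (simp add: d_def inner_diff_left)
    ultimately show ?thesis
      by simp
  qed
  define b where "b = d \<bullet> d"
  have b: "0 \<le> 2 * s * b + s\<^sup>2 * A d" for s
    using A[of "x0 + s *\<^sub>R d"] d x0(1) W unfolding expand b_def by (simp add: subspace_add subspace_mul)
  have "0 \<le> A d"
    by (rule A[OF d])
  \<comment> \<open>A step against the gradient: for this \<open>s\<close>, the quadratic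
    \<open>2 * s * b + s\<^sup>2 * A d\<close> equals - b^2 (A d + 2) / (A d + 1)^2, negative unless
    b = 0. The added 1 keeps the denominator positive.\<close>
  define s where "s = - b / (A d + 1)"
  have s: "s * (A d + 1) = - b"
    using \<open>0 \<le> A d\<close> by (simp add: s_def)
  have "0 \<le> (2 * s * b + s\<^sup>2 * A d) * (A d + 1)\<^sup>2"
    by (intro mult_nonneg_nonneg b) simp
  also have "\<dots> = 2 * b * (s * (A d + 1)) * (A d + 1) + (s * (A d + 1))\<^sup>2 * A d"
    by (simp add: power2_eq_square algebra_simps)
  also have "\<dots> = - (b\<^sup>2 * (A d + 2))"
    unfolding s by (simp add: power2_eq_square algebra_simps)
  finally have "0 \<le> - (b\<^sup>2 * (A d + 2))" .
  then have "b = 0"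
    using \<open>0 \<le> A d\<close> by (simp add: mult_le_0_iff)
  then have "T x0 = m *\<^sub>R x0"
    by (simp add: b_def d_def)
  with x0 show False
    by (auto simp: W_def norm_eq_1)
qed

lemma bounded_linear_eqI_span:
  assumes "bounded_linear f" "bounded_linear g" "span S = UNIV" "\<And>x. x \<in> S \<Longrightarrow> f x = g x"
  shows "f x = g x"
  using linear_eq_on_span[of f g S x] assms by (simp add: bounded_linear.linear)

lemma scaleR_conv_vector_scalar_mult: "r *\<^sub>R (u :: complex^'n) = of_real r *s u"
  by (simp only: vec_eq_iff vector_scaleR_component vector_smult_component)
     (simp add: scaleR_conv_of_real)

lemma inner_scalar_mult_left: "(c *s u) \<bullet> w = u \<bullet> (cnj c *s (w :: complex^'n))"
  by (simp add: inner_complex_vec mult_ac)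

text \<open>The real inner product sees only the real part of the Hermitian one, so the imaginary
  part of a complex factor pairs with \<open>\<i> *s u\<close>. This separates the even and odd
  parts of the oscillating integrands.\<close>

lemma inner_scalar_mult:
  "(c *s u) \<bullet> (d *s w) = Re (cnj c * d) * (u \<bullet> w) - Im (cnj c * d) * ((\<i> *s u) \<bullet> (w :: complex^'n))"
proof -
  have 1: "(\<Sum>i\<in>UNIV. cnj ((c *s u) $ i) * (d *s w) $ i) = (cnj c * d) * (\<Sum>i\<in>UNIV. cnj (u $ i) * w $ i)"
    by (simp add: sum_distrib_left mult_ac)
  have 2: "(\<Sum>i\<in>UNIV. cnj ((\<i> *s u) $ i) * w $ i) = - \<i> * (\<Sum>i\<in>UNIV. cnj (u $ i) * w $ i)"
    by (simp add: sum_distrib_left mult_ac)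
  show ?thesis
    unfolding inner_complex_vec 1 2 by simp
qed

lemma matrix_mult_scalar_mult: "A *v (c *s u) = c *s (A *v (u :: complex^'n))"
  by (simp add: vec_eq_iff matrix_vector_mult_def sum_distrib_left mult_ac)

lemma bounded_linear_scalar_mult: "bounded_linear (\<lambda>c. c *s (u :: complex^'n))"
  by (rule linear_conv_bounded_linear[THEN iffD1])
     (auto intro!: linearI simp: vec_eq_iff distrib_right)

lemma bounded_linear_matrix_vector: "bounded_linear ((*v) (A :: complex^'b^'a))"
  by (rule bounded_bilinear.bounded_linear_right[OF bounded_bilinear_matrix_vector_mult])

lemma bounded_linear_matrix_vector_left: "bounded_linear (\<lambda>A :: complex^'b^'a. A *v w)"
  by (rule bounded_bilinear.bounded_linear_left[OF bounded_bilinear_matrix_vector_mult])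

lemma continuous_on_matrixI:
  fixes f :: "'x::topological_space \<Rightarrow> complex^'b^'a"
  assumes "\<And>w. continuous_on S (\<lambda>x. f x *v w)"
  shows "continuous_on S f"
proof -
  have "continuous_on S (\<lambda>x. f x \<bullet> b)" if "b \<in> Basis" for b
    by (rule Basis_matrix_inner[OF that]) (auto intro: continuous_on_inner assms continuous_on_const)
  then have "continuous_on S (\<lambda>x. \<Sum>b\<in>Basis. (f x \<bullet> b) *\<^sub>R b)"
    by (intro continuous_on_sum continuous_on_scaleR continuous_on_const)
  then show ?thesis
    by (simp add: euclidean_representation)
qed

lemma summable_matrixI:
  fixes f :: "nat \<Rightarrow> complex^'b^'a"
  assumes "\<And>w. summable (\<lambda>k. f k *v w)"
  shows "summable f"
proof -
  have "summable (\<lambda>k. f k \<bullet> b)" if "b \<in> Basis" for b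
    by (rule Basis_matrix_inner[OF that])
       (auto intro: bounded_linear.summable[OF bounded_linear_inner_right] assms)
  then have "summable (\<lambda>k. \<Sum>b\<in>Basis. (f k \<bullet> b) *\<^sub>R b)"
    by (intro summable_sum summable_scaleR_left)
  then show ?thesis
    by (simp add: euclidean_representation)
qed

text \<open>This takes the place of diagonalisation: a property stable under real linear
  combinations is checked on eigenvectors alone, without choosing an eigenbasis.\<close>

lemma span_eq_UNIV_induct:
  assumes "span S = UNIV" "subspace {x. P x}" "\<And>x. x \<in> S \<Longrightarrow> P x"
  shows "P x"
  using span_minimal[of S "{x. P x}"] assms by auto

section \<open>Functional calculus of a self-adjoint matrix through its eigenvectors\<close>

context
  fixes M :: "complex^'m^'m"
  assumes M: "self_adjoint M"
begin

lemma span_matrix_eigenvectors: "span {u. \<exists>\<beta>::real. M *v u = \<beta> *\<^sub>R u} = UNIV"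
  using M by (intro span_eigenvectors bounded_linear.linear bounded_linear_matrix_vector)
    (simp add: inner_matrix_vector_mult self_adjoint_def)

lemma eigenvectors_orthogonal:
  assumes "M *v u = \<beta> *\<^sub>R u" "M *v w = \<gamma> *\<^sub>R w" "\<beta> \<noteq> (\<gamma> :: real)"
  shows "u \<bullet> w = 0"
proof -
  have "\<gamma> * (u \<bullet> w) = \<beta> * (u \<bullet> w)"
    using inner_matrix_vector_mult[of u M w] assms(1,2) M by (simp add: self_adjoint_def)
  then show ?thesis
    using assms(3) by simp
qed

lemma matrix_pow_eigenvector:
  assumes "A *v u = c *s u"
  shows "matrix_pow A k *v u = c ^ k *s u"
  by (induction k)
     (simp_all add: matrix_pow_def matrix_vector_mul_assoc[symmetric] matrix_mult_scalar_mult assms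
       vector_smult_assoc mult.commute)

lemma exp_series_eigenvector:
  assumes "M *v u = \<beta> *\<^sub>R u"
  shows "(\<lambda>k. cscale (1 / fact k) (matrix_pow (cscale z M) k) *v u) sums (exp (z * of_real \<beta>) *s u)"
proof -
  have "cscale z M *v u = (z * of_real \<beta>) *s u"
    by (simp add: cscale_vector_mult assms scaleR_conv_vector_scalar_mult vector_smult_assoc)
  then have "cscale (1 / fact k) (matrix_pow (cscale z M) k) *v u =
      ((z * of_real \<beta>) ^ k /\<^sub>R fact k) *s u" for k
    unfolding cscale_vector_mult[of _ "matrix_pow _ _"] matrix_pow_eigenvector[OF \<open>cscale z M *v u = _\<close>]
    by (simp add: vector_smult_assoc scaleR_conv_of_real divide_inverse mult.commute)
  then show ?thesis
    using bounded_linear.sums[OF bounded_linear_scalar_mult exp_converges] by simp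
qed

text \<open>On an eigenvector the series is the scalar exponential series, and the eigenvectors
  span. Summability is recorded separately because \<open>suminf\<close> commutes with application
  to a vector only once the matrix series converges.\<close>

lemma matrix_exp_vector:
  shows "summable (\<lambda>k. cscale (1 / fact k) (matrix_pow (cscale z M) k))"
    and "M *v u = \<beta> *\<^sub>R u \<Longrightarrow> matrix_exp (cscale z M) *v u = exp (z * of_real \<beta>) *s u"
proof -
  define f where "f = (\<lambda>k. cscale (1 / fact k) (matrix_pow (cscale z M) k))"
  have "summable (\<lambda>k. f k *v w)" for w
  proof (rule span_eq_UNIV_induct[OF span_matrix_eigenvectors])
    show "subspace {w. summable (\<lambda>k. f k *v w)}"
      by (auto simp: subspace_def matrix_vector_right_distrib
          bounded_bilinear.scaleR_right[OF bounded_bilinear_matrix_vector_mult] intro: summable_add summable_scaleR_right)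
  qed (auto dest!: exp_series_eigenvector sums_summable simp: f_def)
  then show sum: "summable (\<lambda>k. cscale (1 / fact k) (matrix_pow (cscale z M) k))"
    unfolding f_def by (rule summable_matrixI)
  assume "M *v u = \<beta> *\<^sub>R u"
  from sums_unique[OF exp_series_eigenvector[OF this, of z]]
  show "matrix_exp (cscale z M) *v u = exp (z * of_real \<beta>) *s u"
    unfolding matrix_exp_def bounded_linear.suminf[OF bounded_linear_matrix_vector_left sum] by simp
qed

lemma continuous_on_matrix_exp: "continuous_on S (\<lambda>s::real. matrix_exp (cscale (z * of_real s) M))"
proof (rule continuous_on_matrixI)
  fix w
  show "continuous_on S (\<lambda>s. matrix_exp (cscale (z * of_real s) M) *v w)"
  proof (rule span_eq_UNIV_induct[OF span_matrix_eigenvectors])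
    show "subspace {w. continuous_on S (\<lambda>s. matrix_exp (cscale (z * of_real s) M) *v w)}"
      by (auto simp: subspace_def matrix_vector_right_distrib
          bounded_bilinear.scaleR_right[OF bounded_bilinear_matrix_vector_mult] intro!: continuous_intros)
    fix u assume "u \<in> {u. \<exists>\<beta>::real. M *v u = \<beta> *\<^sub>R u}"
    then obtain \<beta> :: real where "M *v u = \<beta> *\<^sub>R u"
      by auto
    then show "continuous_on S (\<lambda>s. matrix_exp (cscale (z * of_real s) M) *v u)"
      unfolding matrix_exp_vector(2)[OF \<open>M *v u = _\<close>]
      by (intro bounded_linear.continuous_on[OF bounded_linear_scalar_mult] continuous_intros)
  qed
qed

text \<open>Tested against an eigenvector \<open>w\<close>, the adjoint moves the exponential onto
  \<open>w\<close>. Only eigenvectors with the same eigenvalue are seen by \<open>u\<close>, and for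
  these the factor comes back conjugated.\<close>

lemma cadjoint_matrix_exp_vector:
  assumes "M *v u = \<beta> *\<^sub>R u"
  shows "cadjoint (matrix_exp (cscale (\<i> * of_real \<theta>) M)) *v u = cis (- (\<theta> * \<beta>)) *s u"
proof -
  have "(cadjoint (matrix_exp (cscale (\<i> * of_real \<theta>) M)) *v u) \<bullet> w = (cis (- (\<theta> * \<beta>)) *s u) \<bullet> w" for w
  proof (rule bounded_linear_eqI_span[OF bounded_linear_inner_right bounded_linear_inner_right
        span_matrix_eigenvectors])
    fix w assume "w \<in> {u. \<exists>\<beta>::real. M *v u = \<beta> *\<^sub>R u}"
    then obtain \<gamma> :: real where \<gamma>: "M *v w = \<gamma> *\<^sub>R w"
      by auto
    have "(cadjoint (matrix_exp (cscale (\<i> * of_real \<theta>) M)) *v u) \<bullet> w = u \<bullet> (cis (\<theta> * \<gamma>) *s w)"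
      using matrix_exp_vector(2)[OF \<gamma>, of "\<i> * of_real \<theta>"]
      by (simp add: inner_matrix_vector_mult[symmetric] cis_conv_exp mult.assoc)
    also have "\<dots> = u \<bullet> (cis (\<theta> * \<beta>) *s w)"
    proof (cases "\<beta> = \<gamma>")
      case False
      \<comment> \<open>Complex multiples of \<open>w\<close> stay in the same eigenspace, so both
        pairings vanish although orthogonality is that of the real inner product.\<close>
      have "M *v (c *s w) = \<gamma> *\<^sub>R (c *s w)" for c
        by (simp add: matrix_mult_scalar_mult \<gamma> vec_eq_iff)
      then show ?thesis
        using eigenvectors_orthogonal[OF assms _ False] by simp
    qed simp
    also have "\<dots> = (cis (- (\<theta> * \<beta>)) *s u) \<bullet> w"
      by (simp add: inner_scalar_mult_left cis_cnj)
    finally show "(cadjoint (matrix_exp (cscale (\<i> * of_real \<theta>) M)) *v u) \<bullet> w = (cis (- (\<theta> * \<beta>)) *s u) \<bullet> w" .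
  qed
  then show ?thesis
    by (metis vector_eq_rdot)
qed

end

section \<open>Densities of measures on the line\<close>

lemma borel_measure_eqI_Ioc:
  assumes sets: "sets M = sets (borel :: real measure)" "sets N = sets borel"
    and eq: "\<And>a b. a < b \<Longrightarrow> emeasure M {a<..b} = emeasure N {a<..b}"
    and fin: "\<And>a b. emeasure M {a<..b} \<noteq> \<infinity>"
  shows "M = N"
proof (rule measure_eqI_generator_eq)
  let ?E = "range (\<lambda>(a, b). {a<..b::real})"
  let ?A = "\<lambda>n::nat. {- real n<..real n}"
  show "Int_stable ?E"
  proof (rule Int_stableI, clarify)
    fix a b c d :: real
    show "{a<..b} \<inter> {c<..d} \<in> ?E"
      by (rule range_eqI[of _ _ "(max a c, min b d)"]) (simp add: Int_greaterThanAtMost)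
  qed
  show "?E \<subseteq> Pow UNIV"
    by simp
  show "emeasure M X = emeasure N X" if "X \<in> ?E" for X
  proof -
    from that obtain a b where "X = {a<..b}"
      by auto
    then show ?thesis
      using eq[of a b] by (cases "a < b") auto
  qed
  show "sets M = sigma_sets UNIV ?E" "sets N = sigma_sets UNIV ?E"
    by (simp_all only: sets, (subst borel_sigma_sets_Ioc, simp add: sets_measure_of)+)
  show "range ?A \<subseteq> ?E"
    by auto
  show "(\<Union>n. ?A n) = UNIV"
  proof (intro equalityI subsetI)
    fix x :: real
    obtain n :: nat where "\<bar>x\<bar> < real n"
      using reals_Archimedean2 by blast
    then show "x \<in> (\<Union>n. ?A n)"
      by (intro UN_I[of n]) auto
  qed simp
  show "emeasure M (?A n) \<noteq> \<infinity>" for n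
    by (rule fin)
qed

lemma sigma_finite_measure_Ioc:
  assumes sets: "sets M = sets (borel :: real measure)"
    and fin: "\<And>a b. emeasure M {a<..b} \<noteq> \<infinity>"
  shows "sigma_finite_measure M"
proof
  have "(\<Union>n. {- real n<..real n}) = space M"
  proof (intro equalityI subsetI)
    fix x :: real
    obtain n :: nat where "\<bar>x\<bar> < real n"
      using reals_Archimedean2 by blast
    then show "x \<in> (\<Union>n. {- real n<..real n})"
      by (intro UN_I[of n]) auto
  qed (simp add: sets_eq_imp_space_eq[OF sets])
  then show "\<exists>A. countable A \<and> A \<subseteq> sets M \<and> \<Union>A = space M \<and> (\<forall>a\<in>A. emeasure M a \<noteq> \<infinity>)"
    using fin sets by (intro exI[of _ "range (\<lambda>n::nat. {- real n<..real n})"]) auto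
qed

text \<open>The positive and negative parts of \<open>h\<close> are densities of two measures that
  agree on half-open intervals, hence everywhere. Uniqueness of densities makes the parts equal
  a.e., which forces both to vanish. Comparing measures is what handles an \<open>h\<close> that is
  only locally integrable.\<close>

lemma AE_eq_0_Ioc:
  fixes h :: "real \<Rightarrow> real"
  assumes sets: "sets M = sets borel" and fin: "\<And>a b. emeasure M {a<..b} \<noteq> \<infinity>"
    and h: "h \<in> borel_measurable borel"
    and int: "\<And>a b. a < b \<Longrightarrow> has_bochner_integral M (\<lambda>x. indicator {a<..b} x *\<^sub>R h x) 0"
  shows "AE x in M. h x = 0"
proof -
  note [measurable_cong] = sets and [measurable] = h
  interpret sigma_finite_measure M
    by (rule sigma_finite_measure_Ioc[OF sets fin])
  have eqI: "x = y" if "x \<noteq> \<infinity>" "y \<noteq> \<infinity>" "enn2real x = enn2real y" for x y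
    using that by (cases x; cases y) auto
  have pos: "emeasure (density M (\<lambda>x. ennreal (h x))) {a<..b} =
        (\<integral>\<^sup>+x. ennreal (indicator {a<..b} x *\<^sub>R h x) \<partial>M)"
    and neg: "emeasure (density M (\<lambda>x. ennreal (- h x))) {a<..b} =
        (\<integral>\<^sup>+x. ennreal (- (indicator {a<..b} x *\<^sub>R h x)) \<partial>M)" for a b
    by (subst emeasure_density; auto intro!: nn_integral_cong simp: sets split: split_indicator)+
  have pos_fin: "(\<integral>\<^sup>+x. ennreal (indicator {a<..b} x *\<^sub>R h x) \<partial>M) \<noteq> \<infinity>"
    and neg_fin: "(\<integral>\<^sup>+x. ennreal (- (indicator {a<..b} x *\<^sub>R h x)) \<partial>M) \<noteq> \<infinity>"
    and eq0: "enn2real (\<integral>\<^sup>+x. ennreal (indicator {a<..b} x *\<^sub>R h x) \<partial>M) =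
      enn2real (\<integral>\<^sup>+x. ennreal (- (indicator {a<..b} x *\<^sub>R h x)) \<partial>M)" if "a < b" for a b
    using int[OF that] real_lebesgue_integral_def[of M "\<lambda>x. indicator {a<..b} x *\<^sub>R h x"]
    by (auto simp: has_bochner_integral_iff real_integrable_def)
  have "density M (\<lambda>x. ennreal (h x)) = density M (\<lambda>x. ennreal (- h x))"
  proof (rule borel_measure_eqI_Ioc)
    fix a b :: real
    show "emeasure (density M (\<lambda>x. ennreal (h x))) {a<..b} = emeasure (density M (\<lambda>x. ennreal (- h x))) {a<..b}"
      if "a < b"
      using that unfolding pos neg by (intro eqI pos_fin neg_fin eq0)
    show "emeasure (density M (\<lambda>x. ennreal (h x))) {a<..b} \<noteq> \<infinity>"
      using pos_fin[of a b] unfolding pos by (cases "a < b") auto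
  qed (simp_all add: sets)
  from density_unique[OF _ _ this] have "AE x in M. ennreal (h x) = ennreal (- h x)"
    by simp
  then show ?thesis
  proof eventually_elim
    case (elim x)
    then show ?case
      by (cases "0 \<le> h x") (auto simp: ennreal_neg ennreal_eq_0_iff)
  qed
qed

lemma AE_eq_Ioc:
  fixes f g :: "real \<Rightarrow> 'a::euclidean_space"
  assumes sets: "sets M = sets borel" and fin: "\<And>a b. emeasure M {a<..b} \<noteq> \<infinity>"
    and f: "f \<in> borel_measurable borel" and g: "g \<in> borel_measurable borel"
    and intf: "\<And>a b. a < b \<Longrightarrow> has_bochner_integral M (\<lambda>x. indicator {a<..b} x *\<^sub>R f x) (D a b)"
    and intg: "\<And>a b. a < b \<Longrightarrow> has_bochner_integral M (\<lambda>x. indicator {a<..b} x *\<^sub>R g x) (D a b)"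
  shows "AE x in M. f x = g x"
proof -
  have "AE x in M. (f x - g x) \<bullet> b = 0" if "b \<in> Basis" for b
  proof (rule AE_eq_0_Ioc[OF sets fin])
    show "(\<lambda>x. (f x - g x) \<bullet> b) \<in> borel_measurable borel"
      using f g by measurable
    show "has_bochner_integral M (\<lambda>x. indicator {c<..d} x *\<^sub>R ((f x - g x) \<bullet> b)) 0" if "c < d" for c d
      using has_bochner_integral_inner_left[OF has_bochner_integral_diff[OF intf[OF that] intg[OF that]], of b]
      by (simp add: scaleR_diff_right inner_diff_left right_diff_distrib)
  qed
  then have "AE x in M. \<forall>b\<in>Basis. (f x - g x) \<bullet> b = 0"
    by (intro AE_finite_allI) auto
  then show ?thesis
    by eventually_elim (auto simp: inner_diff_left intro: euclidean_eqI)
qed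

text \<open>\<open>G - F\<close> is again increasing and right-continuous, and its measure added to
  that of \<open>F\<close> is the measure of \<open>G\<close>, as comparison on half-open intervals
  shows.\<close>

lemma emeasure_le_Ioc:
  assumes F: "\<And>x y. x \<le> y \<Longrightarrow> F x \<le> (F y :: real)" "\<And>a. continuous (at_right a) F"
    and G: "\<And>x y. x \<le> y \<Longrightarrow> G x \<le> (G y :: real)" "\<And>a. continuous (at_right a) G"
    and GF: "\<And>x y. x \<le> y \<Longrightarrow> G x - F x \<le> G y - F y"
    and A: "A \<in> sets borel"
  shows "emeasure (interval_measure F) A \<le> emeasure (interval_measure G) A"
proof -
  define D where "D = (\<lambda>x. G x - F x)"
  have D: "\<And>x y. x \<le> y \<Longrightarrow> D x \<le> D y" "\<And>a. continuous (at_right a) D"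
    using GF F(2) G(2) by (auto simp: D_def intro: continuous_diff)
  define S where "S = measure_of UNIV (sets borel)
    (\<lambda>A. emeasure (interval_measure F) A + emeasure (interval_measure D) A)"
  have S: "emeasure S A = emeasure (interval_measure F) A + emeasure (interval_measure D) A"
    if "A \<in> sets borel" for A
    unfolding S_def
  proof (rule emeasure_measure_of_sigma[OF _ _ _ that])
    show "sigma_algebra UNIV (sets (borel :: real measure))"
      using sets.sigma_algebra_axioms[of "borel :: real measure"] by simp
    show "positive (sets borel) (\<lambda>A. emeasure (interval_measure F) A + emeasure (interval_measure D) A)"
      by (simp add: positive_def)
    show "countably_additive (sets borel) (\<lambda>A. emeasure (interval_measure F) A + emeasure (interval_measure D) A)"
      unfolding countably_additive_def
    proof (intro allI impI)
      fix A :: "nat \<Rightarrow> real set"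
      assume A: "range A \<subseteq> sets borel" "disjoint_family A"
      show "(\<Sum>i. emeasure (interval_measure F) (A i) + emeasure (interval_measure D) (A i)) =
          emeasure (interval_measure F) (\<Union>(range A)) + emeasure (interval_measure D) (\<Union>(range A))"
        using A by (subst suminf_add[symmetric]) (simp_all add: suminf_emeasure)
    qed
  qed
  have "S = interval_measure G"
  proof (rule borel_measure_eqI_Ioc)
    show "sets S = sets borel"
      using sets.sigma_sets_eq[of "borel :: real measure"] by (simp add: S_def)
    show "emeasure S {a<..b} = emeasure (interval_measure G) {a<..b}" if "a < b" for a b
      using that F(1)[of a b] D(1)[of a b]
      by (simp add: S emeasure_interval_measure_Ioc F G D ennreal_plus[symmetric] del: ennreal_plus)
        (simp add: D_def)
    show "emeasure S {a<..b} \<noteq> \<infinity>" for a b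
      by (simp add: S emeasure_interval_measure_Ioc_eq F D)
  qed simp
  then show ?thesis
    using S[OF A] by simp
qed

text \<open>Domination of increments passes to all Borel sets and gives absolute continuity, so
  Radon-Nikodym applies. In the application \<open>G\<close> is the trace and \<open>F\<close> a
  quadratic form.\<close>

lemma interval_measure_density_exists:
  assumes F: "\<And>x y. x \<le> y \<Longrightarrow> F x \<le> (F y :: real)" "\<And>a. continuous (at_right a) F"
    and G: "\<And>x y. x \<le> y \<Longrightarrow> G x \<le> (G y :: real)" "\<And>a. continuous (at_right a) G"
    and FG: "\<And>x y. x \<le> y \<Longrightarrow> F y - F x \<le> C * (G y - G x)" and C: "0 \<le> C"
  obtains f :: "real \<Rightarrow> real" where "f \<in> borel_measurable borel" "\<And>x. 0 \<le> f x"
    "\<And>a b. a < b \<Longrightarrow> has_bochner_integral (interval_measure G) (\<lambda>x. indicator {a<..b} x *\<^sub>R f x) (F b - F a)"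
proof -
  interpret sigma_finite_measure "interval_measure G"
    by (rule sigma_finite_interval_measure) (use G in auto)
  have CG: "\<And>x y. x \<le> y \<Longrightarrow> C * G x \<le> C * G y" "\<And>a. continuous (at_right a) (\<lambda>x. C * G x)"
    using C G by (auto intro: mult_left_mono continuous_intros)
  have scale: "interval_measure (\<lambda>x. C * G x) = scale_measure (ennreal C) (interval_measure G)"
  proof (rule borel_measure_eqI_Ioc)
    show "emeasure (interval_measure (\<lambda>x. C * G x)) {a<..b} =
        emeasure (scale_measure (ennreal C) (interval_measure G)) {a<..b}" if "a < b" for a b
      using that C G(1)[of a b]
      by (simp add: emeasure_interval_measure_Ioc CG G ennreal_mult[symmetric] right_diff_distrib)
    show "emeasure (interval_measure (\<lambda>x. C * G x)) {a<..b} \<noteq> \<infinity>" for a b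
      by (simp add: emeasure_interval_measure_Ioc_eq[OF CG])
  qed simp_all
  have "absolutely_continuous (interval_measure G) (interval_measure F)"
    unfolding absolutely_continuous_def
  proof
    fix A assume "A \<in> null_sets (interval_measure G)"
    then have A: "A \<in> sets borel" "emeasure (interval_measure G) A = 0"
      by auto
    have "emeasure (interval_measure F) A \<le> emeasure (interval_measure (\<lambda>x. C * G x)) A"
    proof (rule emeasure_le_Ioc[OF F CG _ A(1)])
      show "C * G x - F x \<le> C * G y - F y" if "x \<le> y" for x y
        using FG[OF that] by (simp add: algebra_simps)
    qed
    then show "A \<in> null_sets (interval_measure F)"
      using A by (simp add: scale null_sets_def)
  qed
  then obtain f where f: "f \<in> borel_measurable (interval_measure G)"
    and dens: "density (interval_measure G) f = interval_measure F"
    using Radon_Nikodym[of "interval_measure F"] by auto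
  have [measurable]: "f \<in> borel_measurable borel"
    using f measurable_cong_sets[OF sets_interval_measure refl] by blast
  show ?thesis
  proof (rule that[of "\<lambda>x. enn2real (f x)"])
    fix a b :: real assume ab: "a < b"
    have nn: "(\<integral>\<^sup>+x. f x * indicator {a<..b} x \<partial>interval_measure G) = ennreal (F b - F a)"
      using emeasure_density[of f "interval_measure G" "{a<..b}"] ab
      by (simp add: dens emeasure_interval_measure_Ioc F)
    \<comment> \<open>The Radon-Nikodym density takes extended values; a finite integral over each
      bounded interval makes it finite a.e. there, so \<open>enn2real\<close> does not alter the
      integral.\<close>
    then have "AE x in interval_measure G. f x * indicator {a<..b} x \<noteq> \<infinity>"
      by (intro nn_integral_PInf_AE) auto
    then have "AE x in interval_measure G.
        ennreal (indicator {a<..b} x *\<^sub>R enn2real (f x)) = f x * indicator {a<..b} x"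
      by eventually_elim (auto simp: less_top split: split_indicator)
    then have "(\<integral>\<^sup>+x. ennreal (indicator {a<..b} x *\<^sub>R enn2real (f x)) \<partial>interval_measure G) = ennreal (F b - F a)"
      unfolding nn[symmetric] by (rule nn_integral_cong_AE)
    then show "has_bochner_integral (interval_measure G) (\<lambda>x. indicator {a<..b} x *\<^sub>R enn2real (f x)) (F b - F a)"
      using ab F(1)[of a b] by (intro has_bochner_integral_nn_integral) auto
  qed auto
qed

section \<open>Existence and uniqueness of the matrix density\<close>

lemma nonneg_matrix_iff: "nonneg_matrix M \<longleftrightarrow> self_adjoint M \<and> (\<forall>v. 0 \<le> v \<bullet> (M *v v))"
  by (simp add: nonneg_matrix_def Re_quad_form)

lemma self_adjoint_inner_commute: "self_adjoint M \<Longrightarrow> u \<bullet> (M *v w) = w \<bullet> (M *v u)"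
  by (metis inner_commute inner_matrix_vector_mult self_adjoint_def)

lemma form_add:
  assumes "self_adjoint M"
  shows "(u + w) \<bullet> (M *v (u + w)) = u \<bullet> (M *v u) + w \<bullet> (M *v w) + 2 * (u \<bullet> (M *v w))"
  using self_adjoint_inner_commute[OF assms, of w u]
  by (simp add: matrix_vector_right_distrib inner_add_left inner_add_right)

lemma form_polarization:
  assumes "self_adjoint M"
  shows "u \<bullet> (M *v w) = ((u + w) \<bullet> (M *v (u + w)) - u \<bullet> (M *v u) - w \<bullet> (M *v w)) / 2"
  by (simp add: form_add[OF assms])

lemma nonneg_matrix_diag:
  assumes "nonneg_matrix M"
  shows "0 \<le> Re (M $ i $ i)"
proof -
  have "0 \<le> axis i 1 \<bullet> (M *v axis i 1)"
    using assms by (simp add: nonneg_matrix_iff)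
  then show ?thesis
    by (simp add: inner_axis' matrix_vector_axis inner_complex_def)
qed

text \<open>The vectors admitting such a constant form a real subspace. For a basis vector the form
  is a diagonal entry, at most the trace because no diagonal entry is negative.\<close>

lemma form_le_trace:
  fixes v :: "complex^'n"
  shows "\<exists>C\<ge>0. \<forall>M. nonneg_matrix M \<longrightarrow> v \<bullet> (M *v v) \<le> C * Re (trace M)"
proof (rule span_eq_UNIV_induct[OF span_Basis])
  show "subspace {v::complex^'n. \<exists>C\<ge>0. \<forall>M. nonneg_matrix M \<longrightarrow> v \<bullet> (M *v v) \<le> C * Re (trace M)}"
    (is "subspace ?S")
  proof (rule subspaceI)
    show "0 \<in> ?S"
      by (auto intro!: exI[of _ 0])
    fix u w assume "u \<in> ?S" "w \<in> ?S"
    then obtain C D where CD: "0 \<le> C" "0 \<le> D"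
      "\<And>M. nonneg_matrix M \<Longrightarrow> u \<bullet> (M *v u) \<le> C * Re (trace M)"
      "\<And>M. nonneg_matrix M \<Longrightarrow> w \<bullet> (M *v w) \<le> D * Re (trace M)"
      by blast
    have "(u + w) \<bullet> (M *v (u + w)) \<le> (2 * C + 2 * D) * Re (trace M)" if M: "nonneg_matrix M" for M
    proof -
      \<comment> \<open>Nonnegativity at u - w bounds the mixed term by the two pure ones, at the
        cost of a factor 2.\<close>
      have "0 \<le> (u + - w) \<bullet> (M *v (u + - w))"
        using M by (simp add: nonneg_matrix_iff)
      also have "\<dots> = u \<bullet> (M *v u) + w \<bullet> (M *v w) - 2 * (u \<bullet> (M *v w))"
        using M form_add[of M u "- w"] linear_neg[OF bounded_linear.linear[OF bounded_linear_matrix_vector], of M w]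
        by (simp add: nonneg_matrix_iff)
      finally have "(u + w) \<bullet> (M *v (u + w)) \<le> 2 * (u \<bullet> (M *v u)) + 2 * (w \<bullet> (M *v w))"
        using M form_add[of M u w] by (simp add: nonneg_matrix_iff)
      also have "\<dots> \<le> 2 * (C * Re (trace M)) + 2 * (D * Re (trace M))"
        using CD(3,4)[OF M] by simp
      finally show ?thesis
        by (simp add: algebra_simps)
    qed
    then show "u + w \<in> ?S"
      using CD(1,2) by (intro CollectI exI[of _ "2 * C + 2 * D"]) auto
  next
    fix c u assume "u \<in> ?S"
    then obtain C where C: "0 \<le> C" "\<And>M. nonneg_matrix M \<Longrightarrow> u \<bullet> (M *v u) \<le> C * Re (trace M)"
      by blast
    have "(c *\<^sub>R u) \<bullet> (M *v (c *\<^sub>R u)) \<le> (c\<^sup>2 * C) * Re (trace M)" if "nonneg_matrix M" for M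
    proof -
      have "(c *\<^sub>R u) \<bullet> (M *v (c *\<^sub>R u)) = c\<^sup>2 * (u \<bullet> (M *v u))"
        by (simp add: bounded_bilinear.scaleR_right[OF bounded_bilinear_matrix_vector_mult] power2_eq_square)
      also have "\<dots> \<le> c\<^sup>2 * (C * Re (trace M))"
        by (intro mult_left_mono C(2) that) simp
      finally show ?thesis
        by simp
    qed
    then show "c *\<^sub>R u \<in> ?S"
      using C(1) by (intro CollectI exI[of _ "c\<^sup>2 * C"]) auto
  qed
  fix b :: "complex^'n" assume "b \<in> Basis"
  then obtain i c where b: "b = axis i c" and c: "c \<in> Basis"
    by (auto simp: Basis_vec_def)
  have "b \<bullet> (M *v b) \<le> 1 * Re (trace M)" if M: "nonneg_matrix M" for M
  proof -
    have "Re (M $ i $ i) \<le> Re (trace M)"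
      using member_le_sum[of i UNIV "\<lambda>j. Re (M $ j $ j)"] nonneg_matrix_diag[OF M] by (simp add: trace_def)
    moreover have "b \<bullet> (M *v b) = Re (M $ i $ i)"
      using c by (auto simp: b inner_axis' matrix_vector_axis inner_complex_def Basis_complex_def)
    ultimately show ?thesis
      by simp
  qed
  then show "\<exists>C\<ge>0. \<forall>M. nonneg_matrix M \<longrightarrow> b \<bullet> (M *v b) \<le> C * Re (trace M)"
    by (intro exI[of _ 1]) auto
qed

lemma bounded_linear_trace: "bounded_linear (trace :: complex^'n^'n \<Rightarrow> complex)"
  by (rule linear_conv_bounded_linear[THEN iffD1])
     (auto intro!: linearI simp: trace_def sum.distrib scaleR_sum_right)

lemma nonneg_matrix_trace: "nonneg_matrix (M :: complex^'n^'n) \<Longrightarrow> 0 \<le> Re (trace M)"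
  by (simp add: trace_def sum_nonneg nonneg_matrix_diag)

section \<open>The trace measure and the matrix density of an increasing function\<close>

context
  fixes \<sigma> :: "real \<Rightarrow> complex^'n^'n"
  assumes inc: "increasing_matrix \<sigma>" and rc: "\<And>l. continuous (at_right l) \<sigma>"
begin

lemma nonneg_matrix_increment: "m \<le> l \<Longrightarrow> nonneg_matrix (\<sigma> l - \<sigma> m)"
proof (cases "m = l")
  case True
  have "cadjoint (0 :: complex^'n^'n) = 0"
    by (simp add: vec_eq_iff)
  then show ?thesis
    using True by (simp add: nonneg_matrix_iff self_adjoint_def)
qed (use inc in \<open>simp add: increasing_matrix_def\<close>)

lemma trace_mono: "x \<le> y \<Longrightarrow> Re (trace (\<sigma> x)) \<le> Re (trace (\<sigma> y))"
  using nonneg_matrix_trace[OF nonneg_matrix_increment, of x y]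
  by (simp add: linear_diff[OF bounded_linear.linear[OF bounded_linear_trace]])

lemma trace_right_continuous: "continuous (at_right a) (\<lambda>l. Re (trace (\<sigma> l)))"
  by (intro bounded_linear.continuous[OF bounded_linear_Re] bounded_linear.continuous[OF bounded_linear_trace] rc)

lemma sets_trace_measure: "sets (trace_measure \<sigma>) = sets borel"
  by (simp add: trace_measure_def)

lemma emeasure_trace_measure_finite: "emeasure (trace_measure \<sigma>) {a<..b} \<noteq> \<infinity>"
  by (simp add: trace_measure_def emeasure_interval_measure_Ioc_eq[OF trace_mono trace_right_continuous])

lemma form_density_exists:
  "\<exists>f :: real \<Rightarrow> real. f \<in> borel_measurable borel \<and> (\<forall>x. 0 \<le> f x) \<and>
    (\<forall>a b. a < b \<longrightarrow> has_bochner_integral (trace_measure \<sigma>) (\<lambda>x. indicator {a<..b} x *\<^sub>R f x)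
      (v \<bullet> ((\<sigma> b - \<sigma> a) *v v)))"
proof -
  define F where "F = (\<lambda>l. v \<bullet> (\<sigma> l *v v))"
  have diff: "F y - F x = v \<bullet> ((\<sigma> y - \<sigma> x) *v v)" for x y
    unfolding F_def by (simp add: linear_diff[OF bounded_linear.linear[OF bounded_linear_matrix_form]])
  have mono: "F x \<le> F y" if "x \<le> y" for x y
  proof -
    have "0 \<le> F y - F x"
      using nonneg_matrix_increment[OF that] unfolding diff by (simp add: nonneg_matrix_iff)
    then show ?thesis
      by simp
  qed
  have cont: "continuous (at_right a) F" for a
    unfolding F_def by (rule bounded_linear.continuous[OF bounded_linear_matrix_form rc])
  obtain C where C: "0 \<le> C" "\<And>M. nonneg_matrix M \<Longrightarrow> v \<bullet> (M *v v) \<le> C * Re (trace M)"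
    using form_le_trace[of v] by blast
  have "F y - F x \<le> C * (Re (trace (\<sigma> y)) - Re (trace (\<sigma> x)))" if "x \<le> y" for x y
    using C(2)[OF nonneg_matrix_increment[OF that]]
    by (simp add: diff linear_diff[OF bounded_linear.linear[OF bounded_linear_trace]])
  from interval_measure_density_exists[OF mono cont trace_mono trace_right_continuous this C(1)]
  obtain f :: "real \<Rightarrow> real" where "f \<in> borel_measurable borel" "\<And>x. 0 \<le> f x"
    "\<And>a b. a < b \<Longrightarrow> has_bochner_integral (trace_measure \<sigma>) (\<lambda>x. indicator {a<..b} x *\<^sub>R f x) (F b - F a)"
    unfolding trace_measure_def by blast
  then show ?thesis
    unfolding diff by blast
qed

text \<open>Scalar densities of the forms \<open>v \<bullet> (\<sigma> l *v v)\<close> are assembled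
  into a matrix by polarization. Without this, the choice in \<open>matrix_density\<close> would
  have no known property.\<close>

lemma is_matrix_density_exists: "\<exists>\<Phi>. is_matrix_density \<sigma> \<Phi>"
proof -
  define \<tau> where "\<tau> = trace_measure \<sigma>"
  note [measurable_cong] = sets_trace_measure[folded \<tau>_def]
  note sets = sets_trace_measure[folded \<tau>_def] and fin = emeasure_trace_measure_finite[folded \<tau>_def]
  have "\<forall>v. \<exists>f :: real \<Rightarrow> real. f \<in> borel_measurable borel \<and> (\<forall>x. 0 \<le> f x) \<and>
    (\<forall>a b. a < b \<longrightarrow> has_bochner_integral \<tau> (\<lambda>x. indicator {a<..b} x *\<^sub>R f x)
      (v \<bullet> ((\<sigma> b - \<sigma> a) *v v)))"
    unfolding \<tau>_def by (intro allI form_density_exists)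
  then obtain f :: "complex^'n \<Rightarrow> real \<Rightarrow> real" where f: "\<And>v. f v \<in> borel_measurable borel" "\<And>v x. 0 \<le> f v x"
    "\<And>v a b. a < b \<Longrightarrow> has_bochner_integral \<tau> (\<lambda>x. indicator {a<..b} x *\<^sub>R f v x) (v \<bullet> ((\<sigma> b - \<sigma> a) *v v))"
    by metis
  have "\<forall>b\<in>Basis. \<exists>p. \<forall>M :: complex^'n^'n. M \<bullet> b = fst p \<bullet> (M *v snd p)"
    by (intro ballI) (metis Basis_matrix_inner fst_conv snd_conv)
  then obtain p :: "complex^'n^'n \<Rightarrow> (complex^'n) \<times> (complex^'n)" where
    p: "\<And>b M. b \<in> Basis \<Longrightarrow> M \<bullet> b = fst (p b) \<bullet> (M *v snd (p b))"
    by metis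
  \<comment> \<open>The density of the coordinate \<open>b\<close>: polarization at the two vectors
    whose form represents that coordinate.\<close>
  define h where "h = (\<lambda>b x. (f (fst (p b) + snd (p b)) x - f (fst (p b)) x - f (snd (p b)) x) / 2)"
  define \<Phi> where "\<Phi> = (\<lambda>x. \<Sum>b\<in>Basis. h b x *\<^sub>R b)"
  have \<Phi>_borel: "\<Phi> \<in> borel_measurable borel"
    unfolding \<Phi>_def h_def using f(1) by measurable
  have int_h: "has_bochner_integral \<tau> (\<lambda>x. indicator {c<..d} x *\<^sub>R h b x) ((\<sigma> d - \<sigma> c) \<bullet> b)"
    if "c < d" "b \<in> Basis" for b c d
  proof -
    let ?u = "fst (p b)" and ?w = "snd (p b)" and ?M = "\<sigma> d - \<sigma> c"
    have "has_bochner_integral \<tau> (\<lambda>x. (indicator {c<..d} x *\<^sub>R f (?u + ?w) x - indicator {c<..d} x *\<^sub>R f ?u x -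
        indicator {c<..d} x *\<^sub>R f ?w x) / 2)
      (((?u + ?w) \<bullet> (?M *v (?u + ?w)) - ?u \<bullet> (?M *v ?u) - ?w \<bullet> (?M *v ?w)) / 2)"
      using f(3)[OF that(1)] by (intro has_bochner_integral_divide has_bochner_integral_diff) auto
    moreover have "self_adjoint ?M"
      using nonneg_matrix_increment[of c d] that(1) by (simp add: nonneg_matrix_iff)
    ultimately show ?thesis
      unfolding p[OF that(2)] by (subst form_polarization) (simp_all add: h_def right_diff_distrib)
  qed
  have int: "has_bochner_integral \<tau> (\<lambda>x. indicator {c<..d} x *\<^sub>R \<Phi> x) (\<sigma> d - \<sigma> c)" if "c < d" for c d
  proof -
    have "has_bochner_integral \<tau> (\<lambda>x. \<Sum>b\<in>Basis. (indicator {c<..d} x *\<^sub>R h b x) *\<^sub>R b)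
        (\<Sum>b\<in>Basis. ((\<sigma> d - \<sigma> c) \<bullet> b) *\<^sub>R b)"
      by (intro has_bochner_integral_sum has_bochner_integral_scaleR_left int_h that)
    then show ?thesis
      by (simp add: \<Phi>_def scaleR_sum_right euclidean_representation)
  qed
  have "AE x in \<tau>. \<Phi> x = cadjoint (\<Phi> x)"
  proof (rule AE_eq_Ioc[OF sets fin \<Phi>_borel])
    show "(\<lambda>x. cadjoint (\<Phi> x)) \<in> borel_measurable borel"
      using \<Phi>_borel by (rule borel_measurable_continuous_on[OF
          bounded_linear.continuous_on[OF bounded_linear_cadjoint continuous_on_id]])
    fix a b :: real assume ab: "a < b"
    have "cadjoint (\<sigma> b - \<sigma> a) = \<sigma> b - \<sigma> a"
      using nonneg_matrix_increment[of a b] ab by (simp add: nonneg_matrix_iff self_adjoint_def)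
    then show "has_bochner_integral \<tau> (\<lambda>x. indicator {a<..b} x *\<^sub>R cadjoint (\<Phi> x)) (\<sigma> b - \<sigma> a)"
      using has_bochner_integral_bounded_linear[OF bounded_linear_cadjoint int[OF ab]]
      by (simp add: linear_scale[OF bounded_linear.linear[OF bounded_linear_cadjoint]])
  qed (rule int)
  \<comment> \<open>An a.e. statement can be claimed for countably many \<open>v\<close> at once; a
    dense set suffices because the quadratic form is continuous in \<open>v\<close>.\<close>
  moreover obtain D :: "(complex^'n) set" where D: "countable D"
      "\<And>X. open X \<Longrightarrow> X \<noteq> {} \<Longrightarrow> \<exists>d\<in>D. d \<in> X"
    using countable_dense_setE by blast
  have "AE x in \<tau>. \<forall>v\<in>D. 0 \<le> v \<bullet> (\<Phi> x *v v)"
  proof (subst AE_ball_countable[OF D(1)], intro ballI)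
    fix v
    have "AE x in \<tau>. v \<bullet> (\<Phi> x *v v) = f v x"
    proof (rule AE_eq_Ioc[OF sets fin _ f(1)])
      show "(\<lambda>x. v \<bullet> (\<Phi> x *v v)) \<in> borel_measurable borel"
        using \<Phi>_borel by (rule borel_measurable_continuous_on[OF
            bounded_linear.continuous_on[OF bounded_linear_matrix_form continuous_on_id]])
      fix a b :: real assume ab: "a < b"
      show "has_bochner_integral \<tau> (\<lambda>x. indicator {a<..b} x *\<^sub>R (v \<bullet> (\<Phi> x *v v))) (v \<bullet> ((\<sigma> b - \<sigma> a) *v v))"
        using has_bochner_integral_bounded_linear[OF bounded_linear_matrix_form int[OF ab]]
        by (simp add: linear_scale[OF bounded_linear.linear[OF bounded_linear_matrix_form]])
    qed (rule f(3))
    then show "AE x in \<tau>. 0 \<le> v \<bullet> (\<Phi> x *v v)"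
      by eventually_elim (simp add: f(2))
  qed
  ultimately have "AE x in \<tau>. nonneg_matrix (\<Phi> x)"
  proof eventually_elim
    case (elim x)
    have "0 \<le> v \<bullet> (\<Phi> x *v v)" for v
    proof (rule ccontr)
      let ?X = "{v. v \<bullet> (\<Phi> x *v v) < 0}"
      assume "\<not> ?thesis"
      then have "?X \<noteq> {}"
        by (auto simp: not_le)
      moreover have "open ?X"
        by (intro open_Collect_less continuous_on_inner continuous_on_id continuous_on_const
            bounded_linear.continuous_on[OF bounded_linear_matrix_vector])
      ultimately obtain d where "d \<in> D" "d \<in> ?X"
        using D(2) by blast
      moreover have "0 \<le> d \<bullet> (\<Phi> x *v d)"
        using elim(2) \<open>d \<in> D\<close> by blast
      ultimately show False
        by simp
    qed
    with elim(1) show ?case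
      by (simp add: nonneg_matrix_iff self_adjoint_def)
  qed
  then obtain N where N: "N \<in> null_sets \<tau>" "\<And>x. x \<in> space \<tau> - N \<Longrightarrow> nonneg_matrix (\<Phi> x)"
    by (rule AE_E3) blast
  have N_borel: "N \<in> sets borel"
    using N(1) sets_trace_measure by (auto simp: \<tau>_def)
  \<comment> \<open>A matrix density has to be nonnegative at every point, so the exceptional null
    set is overwritten by 0.\<close>
  define \<Psi> where "\<Psi> = (\<lambda>x. if x \<in> N then 0 else \<Phi> x)"
  have \<Psi>_borel: "\<Psi> \<in> borel_measurable borel"
    unfolding \<Psi>_def using \<Phi>_borel N_borel by measurable
  have "space \<tau> = UNIV"
    by (simp add: \<tau>_def trace_measure_def)
  moreover have "nonneg_matrix (0 :: complex^'n^'n)"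
    using nonneg_matrix_increment[of 0 0] by simp
  ultimately have "nonneg_matrix (\<Psi> x)" for x
    using N(2) by (auto simp: \<Psi>_def)
  moreover have "has_bochner_integral \<tau> (\<lambda>x. indicator {a<..b} x *\<^sub>R \<Psi> x) (\<sigma> b - \<sigma> a)" if "a < b" for a b
  proof -
    have "AE x in \<tau>. indicator {a<..b} x *\<^sub>R \<Phi> x = indicator {a<..b} x *\<^sub>R \<Psi> x"
      using AE_not_in[OF N(1)] by eventually_elim (simp add: \<Psi>_def)
    moreover have "(\<lambda>x. indicator {a<..b} x *\<^sub>R \<Phi> x) \<in> borel_measurable \<tau>"
      "(\<lambda>x. indicator {a<..b} x *\<^sub>R \<Psi> x) \<in> borel_measurable \<tau>"
      using \<Phi>_borel \<Psi>_borel by measurable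
    ultimately show ?thesis
      using int[OF that] has_bochner_integral_cong_AE by blast
  qed
  ultimately have "is_matrix_density \<sigma> \<Psi>"
    unfolding is_matrix_density_def set_integrable_def set_lebesgue_integral_def \<tau>_def[symmetric]
      has_bochner_integral_iff
    by (intro conjI allI impI \<Psi>_borel) (simp_all only:)
  then show ?thesis
    by (intro exI[of _ \<Psi>])
qed

lemma matrix_density: "is_matrix_density \<sigma> (matrix_density \<sigma>)"
  unfolding matrix_density_def by (rule someI_ex[OF is_matrix_density_exists])

lemma matrix_density_unique:
  assumes "is_matrix_density \<sigma> \<Phi>"
  shows "AE x in trace_measure \<sigma>. matrix_density \<sigma> x = \<Phi> x"
  using assms matrix_density
  by (intro AE_eq_Ioc[OF sets_trace_measure emeasure_trace_measure_finite, where D = "\<lambda>a b. \<sigma> b - \<sigma> a"])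
     (simp_all add: is_matrix_density_def set_integrable_def set_lebesgue_integral_def has_bochner_integral_iff)

end

section \<open>The free problem\<close>

lemma pos_def_matrix_iff: "pos_def_matrix M \<longleftrightarrow> self_adjoint M \<and> (\<forall>v. v \<noteq> 0 \<longrightarrow> 0 < v \<bullet> (M *v v))"
  by (simp add: pos_def_matrix_def Re_quad_form)

lemma matrix_inv_of_ker:
  fixes M :: "complex^'n^'n"
  assumes "\<And>v. M *v v = 0 \<Longrightarrow> v = 0"
  shows "matrix_inv M ** M = mat 1" "M ** matrix_inv M = mat 1"
proof -
  have "invertible M"
    using assms invertible_left_inverse matrix_left_invertible_ker by blast
  then show "matrix_inv M ** M = mat 1" "M ** matrix_inv M = mat 1"
    using someI_ex[of "\<lambda>A'. M ** A' = mat 1 \<and> A' ** M = mat 1"]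
    unfolding invertible_def matrix_inv_def by simp_all
qed

lemma pos_def_matrix_pos: "pos_def_matrix M \<Longrightarrow> v \<noteq> 0 \<Longrightarrow> 0 < v \<bullet> (M *v v)"
  unfolding pos_def_matrix_iff by (drule conjunct2) (drule spec, erule mp)

lemma pos_def_matrix_inv:
  assumes "pos_def_matrix M"
  shows "matrix_inv M ** M = mat 1" "M ** matrix_inv M = mat 1"
proof -
  have ker: "v = 0" if "M *v v = 0" for v
    using pos_def_matrix_pos[OF assms, of v] unfolding that inner_zero_right by blast
  show "matrix_inv M ** M = mat 1"
    by (rule matrix_inv_of_ker(1)) (rule ker)
  show "M ** matrix_inv M = mat 1"
    by (rule matrix_inv_of_ker(2)) (rule ker)
qed

lemma self_adjoint_inverse:
  fixes M N :: "complex^'n^'n"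
  assumes "self_adjoint M" "M ** N = mat 1" "N ** M = mat 1"
  shows "self_adjoint N"
proof -
  have "cadjoint N ** M = mat 1"
    using arg_cong[OF assms(2), of cadjoint] assms(1) by (simp add: cadjoint_mult self_adjoint_def)
  then have "cadjoint N ** (M ** N) = N"
    by (simp add: matrix_mul_assoc)
  then show ?thesis
    by (simp add: assms(2) self_adjoint_def)
qed

lemma pos_def_matrix_inverse:
  assumes "pos_def_matrix M"
  shows "pos_def_matrix (matrix_inv M)"
proof -
  note inv = pos_def_matrix_inv[OF assms]
  have sa: "self_adjoint (matrix_inv M)"
    using assms unfolding pos_def_matrix_iff by (intro self_adjoint_inverse[OF _ inv(2,1)]) (rule conjunct1)
  have "0 < v \<bullet> (matrix_inv M *v v)" if "v \<noteq> 0" for v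
  proof -
    have v: "M *v (matrix_inv M *v v) = v"
      unfolding matrix_vector_mul_assoc inv by (rule matrix_vector_mul_lid)
    have "matrix_inv M *v v \<noteq> 0"
    proof
      assume "matrix_inv M *v v = 0"
      with v that show False
        by (simp only: matrix_vector_mult_0_right)
    qed
    from pos_def_matrix_pos[OF assms this] show ?thesis
      unfolding v by (subst inner_commute)
  qed
  with sa show ?thesis
    unfolding pos_def_matrix_iff by blast
qed

definition top_block :: "complex^('n + 'n) \<Rightarrow> complex^'n"
  where "top_block u = (\<chi> i. u $ Inl i)"

definition bot_block :: "complex^('n + 'n) \<Rightarrow> complex^'n"
  where "bot_block u = (\<chi> i. u $ Inr i)"

lemma sum_UNIV_Plus: "(\<Sum>i\<in>UNIV. f i) = (\<Sum>i\<in>UNIV. f (Inl i)) + (\<Sum>i\<in>UNIV. f (Inr i))"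
  for f :: "'a::finite + 'b::finite \<Rightarrow> 'c::comm_monoid_add"
  unfolding UNIV_Plus_UNIV[symmetric] by (subst sum.Plus) (simp_all add: o_def)

lemma inner_blocks: "u \<bullet> w = top_block u \<bullet> top_block w + bot_block u \<bullet> bot_block w"
  by (simp add: inner_vec_def sum_UNIV_Plus top_block_def bot_block_def)

lemma blocks_eq_iff: "u = w \<longleftrightarrow> top_block u = top_block w \<and> bot_block u = bot_block w"
  unfolding vec_eq_iff top_block_def bot_block_def split_sum_all by simp

lemma block_zero [simp]: "top_block 0 = 0" "bot_block 0 = 0"
  by (simp_all add: vec_eq_iff top_block_def bot_block_def)

lemma block_diag_mult:
  "top_block (block_diag A D *v u) = A *v top_block u"
  "bot_block (block_diag A D *v u) = D *v bot_block u"
  by (simp_all add: vec_eq_iff top_block_def bot_block_def block_diag_def matrix_vector_mult_def sum_UNIV_Plus)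

lemma cadjoint_block_col_mult:
  "cadjoint (block_col (mat 1) H) *v u = top_block u + cadjoint H *v bot_block u"
  by (simp add: vec_eq_iff top_block_def bot_block_def block_col_def matrix_vector_mult_def sum_UNIV_Plus
      mat_def if_distrib if_distribR cong: if_cong)

lemma self_adjoint_block_diag:
  assumes "self_adjoint A" "self_adjoint D"
  shows "self_adjoint (block_diag A (- D))"
  using assms by (auto simp: self_adjoint_def vec_eq_iff block_diag_def split: sum.split)

lemma continuous_on_e0:
  assumes "self_adjoint (matrix_inv B)"
  shows "continuous_on S (\<lambda>s. e0 B H s l)"
  unfolding e0_def
  by (intro bounded_bilinear.continuous_on[OF bounded_bilinear_matrix_mult] continuous_on_const
      continuous_on_matrix_exp assms)

lemma has_integral_cis:
  assumes "k \<noteq> 0" "0 \<le> x"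
  shows "((\<lambda>s. cis (- (k * s))) has_integral (cis (- (k * x)) - 1) / (- (\<i> * of_real k))) {0..x}"
proof -
  have "((\<lambda>s. cis (- (k * s))) has_integral
      cis (- (k * x)) / (- (\<i> * of_real k)) - cis (- (k * 0)) / (- (\<i> * of_real k))) {0..x}"
  proof (rule fundamental_theorem_of_calculus[OF assms(2)])
    fix s
    have "((\<lambda>z. exp (- (\<i> * of_real k) * z) / (- (\<i> * of_real k))) has_field_derivative
        exp (- (\<i> * of_real k) * of_real s)) (at (of_real s))"
      using assms(1) by (auto intro!: derivative_eq_intros)
    from has_vector_derivative_real_field[OF this]
    have "((\<lambda>s. exp (- (\<i> * of_real k) * of_real s) / (- (\<i> * of_real k))) has_vector_derivative
        exp (- (\<i> * of_real k) * of_real s)) (at s within {0..x})" .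
    then show "((\<lambda>s. cis (- (k * s)) / (- (\<i> * of_real k))) has_vector_derivative cis (- (k * s)))
        (at s within {0..x})"
      by (simp add: cis_conv_exp mult_ac)
  qed
  then show ?thesis
    by (simp add: diff_divide_distrib)
qed

text \<open>On an eigenvector the matrix exponential becomes a scalar oscillation with an elementary
  integral. Products of two such quotients are, up to a constant, the integrands of
  \<open>has_bochner_integral_cis_products\<close>.\<close>

lemma cadjoint_e0_tilde_eigenvector:
  assumes sa: "self_adjoint (matrix_inv B)" and u: "matrix_inv B *v u = \<beta> *\<^sub>R u"
    and "\<beta> \<noteq> 0" "l \<noteq> 0" "0 \<le> x"
  shows "cadjoint (e0_tilde B H x l) *v u =
    ((cis (- (l * \<beta> * x)) - 1) / (- (\<i> * of_real (l * \<beta>)))) *s (cadjoint (block_col (mat 1) H) *v u)"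
proof -
  have bl: "bounded_linear (\<lambda>M :: complex^'a^('a + 'a). cadjoint M *v u)"
    by (rule bounded_linear_compose[OF bounded_linear_matrix_vector_left bounded_linear_cadjoint])
  have "cadjoint (e0 B H s (of_real l)) *v u = cis (- (l * \<beta> * s)) *s (cadjoint (block_col (mat 1) H) *v u)" for s
    using cadjoint_matrix_exp_vector[OF sa u, of "l * s"]
    by (simp add: e0_def cadjoint_mult matrix_vector_mul_assoc[symmetric] matrix_mult_scalar_mult mult_ac)
  then have "cadjoint (e0_tilde B H x l) *v u =
      integral {0..x} (\<lambda>s. cis (- (l * \<beta> * s)) *s (cadjoint (block_col (mat 1) H) *v u))"
    using integral_linear[OF integrable_continuous_interval[OF continuous_on_e0[OF sa]] bl, of 0 x H "of_real l"]
    by (simp add: e0_tilde_def o_def)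
  also have "\<dots> = ((cis (- (l * \<beta> * x)) - 1) / (- (\<i> * of_real (l * \<beta>)))) *s (cadjoint (block_col (mat 1) H) *v u)"
    using has_integral_linear[OF has_integral_cis bounded_linear_scalar_mult, of "l * \<beta>" x] assms(3-5)
    by (intro integral_unique) (simp add: o_def)
  finally show ?thesis .
qed

section \<open>Free solutions paired with eigenvectors of \<open>matrix_inv B\<close>\<close>

context
  fixes B\<^sub>1 B\<^sub>2 H :: "complex^'n^'n" and B :: "complex^('n + 'n)^('n + 'n)"
  assumes B1: "pos_def_matrix B\<^sub>1" and B2: "pos_def_matrix B\<^sub>2"
    and B1_eq: "B\<^sub>1 = cadjoint H ** B\<^sub>2 ** H"
    and B_eq: "B = block_diag B\<^sub>1 (- B\<^sub>2)"
begin

lemma block_diag_inv: "matrix_inv B ** B = mat 1" "B ** matrix_inv B = mat 1"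
proof -
  have ker: "u = 0" if u: "B *v u = 0" for u
  proof -
    have "B\<^sub>1 *v top_block u = 0" "B\<^sub>2 *v bot_block u = 0"
      using arg_cong[OF u, of top_block] arg_cong[OF u, of bot_block]
      by (simp_all add: B_eq block_diag_mult linear_neg[OF bounded_linear.linear[OF bounded_linear_matrix_vector_left]])
    then have "top_block u = 0" "bot_block u = 0"
      using pos_def_matrix_pos[OF B1, of "top_block u"] pos_def_matrix_pos[OF B2, of "bot_block u"]
      by fastforce+
    then show ?thesis
      unfolding blocks_eq_iff by simp
  qed
  show "matrix_inv B ** B = mat 1"
    by (rule matrix_inv_of_ker(1)) (rule ker)
  show "B ** matrix_inv B = mat 1"
    by (rule matrix_inv_of_ker(2)) (rule ker)
qed

lemma self_adjoint_inv_B: "self_adjoint (matrix_inv B)"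
proof (rule self_adjoint_inverse[OF _ block_diag_inv(2,1)])
  show "self_adjoint B"
    unfolding B_eq using B1 B2 unfolding pos_def_matrix_iff by (intro self_adjoint_block_diag) blast+
qed

text \<open>The relation for \<open>B\<^sub>1\<close> makes
  \<open>B\<^sub>2 ** H ** matrix_inv B\<^sub>1\<close> a right inverse of
  \<open>cadjoint H\<close>, hence for square matrices also a left inverse. It lets the lower block
  be measured by \<open>matrix_inv B\<^sub>1\<close>, the matrix in
  \<open>\<sigma>\<^sub>0\<close>.\<close>

lemma inv_B2_eq: "matrix_inv B\<^sub>2 = H ** matrix_inv B\<^sub>1 ** cadjoint H"
proof -
  have "cadjoint H ** (B\<^sub>2 ** H ** matrix_inv B\<^sub>1) = mat 1"
    using pos_def_matrix_inv(2)[OF B1] by (subst (asm) (1) B1_eq) (simp add: matrix_mul_assoc)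
  then have "B\<^sub>2 ** H ** matrix_inv B\<^sub>1 ** cadjoint H = mat 1"
    by (rule matrix_left_right_inverse1)
  then have "matrix_inv B\<^sub>2 ** (B\<^sub>2 ** (H ** matrix_inv B\<^sub>1 ** cadjoint H)) = matrix_inv B\<^sub>2"
    by (simp add: matrix_mul_assoc)
  then show ?thesis
    by (simp add: matrix_mul_assoc pos_def_matrix_inv(1)[OF B2])
qed

text \<open>Definiteness of \<open>B\<^sub>1\<close> and \<open>B\<^sub>2\<close> forces
  eigenvectors for positive eigenvalues into the upper block and those for negative ones into the
  lower. In the lower block \<open>inv_B2_eq\<close> absorbs \<open>H\<close>, so both blocks yield
  the modulus of the eigenvalue. Opposite signs are excluded, as \<open>H\<close> would couple the
  blocks.\<close>

lemma initial_form_eigenvector: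
  assumes u: "matrix_inv B *v u = \<beta> *\<^sub>R u" and w: "matrix_inv B *v w = \<gamma> *\<^sub>R w"
    and nz: "\<beta> \<noteq> 0" "\<gamma> \<noteq> 0" and sign: "0 < \<beta> \<longleftrightarrow> 0 < \<gamma>"
  shows "(cadjoint (block_col (mat 1) H) *v u) \<bullet>
      (matrix_inv B\<^sub>1 *v (cadjoint (block_col (mat 1) H) *v w)) = \<bar>\<gamma>\<bar> * (u \<bullet> w)"
proof -
  note scaleR_right = bounded_bilinear.scaleR_right[OF bounded_bilinear_matrix_vector_mult]
  have eig: "B\<^sub>1 *v top_block v = (1 / r) *\<^sub>R top_block v"
      "B\<^sub>2 *v bot_block v = (- 1 / r) *\<^sub>R bot_block v"
    if "matrix_inv B *v v = r *\<^sub>R v" "r \<noteq> 0" for v r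
  proof -
    have "v = B *v (matrix_inv B *v v)"
      unfolding matrix_vector_mul_assoc block_diag_inv by (rule matrix_vector_mul_lid[symmetric])
    also have "\<dots> = r *\<^sub>R (B *v v)"
      unfolding that(1) scaleR_right ..
    finally have v: "v = r *\<^sub>R (B *v v)" .
    have "(1 / r) *\<^sub>R v = (1 / r) *\<^sub>R (r *\<^sub>R (B *v v))"
      by (rule arg_cong[OF v])
    then have "B *v v = (1 / r) *\<^sub>R v"
      using that(2) by simp
    from arg_cong[OF this, of top_block] arg_cong[OF this, of bot_block]
    have "B\<^sub>1 *v top_block v = (1 / r) *\<^sub>R top_block v" "- (B\<^sub>2 *v bot_block v) = (1 / r) *\<^sub>R bot_block v"
      unfolding B_eq block_diag_mult linear_neg[OF bounded_linear.linear[OF bounded_linear_matrix_vector_left]]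
      by (simp_all add: vec_eq_iff top_block_def bot_block_def)
    then show "B\<^sub>1 *v top_block v = (1 / r) *\<^sub>R top_block v"
      "B\<^sub>2 *v bot_block v = (- 1 / r) *\<^sub>R bot_block v"
      by (simp_all add: minus_equation_iff[of "B\<^sub>2 *v bot_block v"])
  qed
  have pos: "bot_block v = 0" if "matrix_inv B *v v = r *\<^sub>R v" "0 < r" for v r
  proof (rule ccontr)
    assume "bot_block v \<noteq> 0"
    from pos_def_matrix_pos[OF B2 this] show False
      using eig(2)[OF that(1)] that(2) inner_ge_zero[of "bot_block v"]
      by (simp add: divide_less_0_iff)
  qed
  have neg: "top_block v = 0" if "matrix_inv B *v v = r *\<^sub>R v" "r < 0" for v r
  proof (rule ccontr)
    assume "top_block v \<noteq> 0"
    from pos_def_matrix_pos[OF B1 this] show False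
      using eig(1)[OF that(1)] that(2) inner_ge_zero[of "top_block v"]
      by (simp add: zero_less_divide_iff)
  qed
  show ?thesis
  proof (cases "0 < \<gamma>")
    case True
    have "top_block w = matrix_inv B\<^sub>1 *v (B\<^sub>1 *v top_block w)"
      unfolding matrix_vector_mul_assoc pos_def_matrix_inv[OF B1] by (rule matrix_vector_mul_lid[symmetric])
    also have "\<dots> = (1 / \<gamma>) *\<^sub>R (matrix_inv B\<^sub>1 *v top_block w)"
      unfolding eig(1)[OF w nz(2)] scaleR_right ..
    finally have "\<gamma> *\<^sub>R top_block w = \<gamma> *\<^sub>R ((1 / \<gamma>) *\<^sub>R (matrix_inv B\<^sub>1 *v top_block w))"
      by (rule arg_cong)
    then have "matrix_inv B\<^sub>1 *v top_block w = \<gamma> *\<^sub>R top_block w"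
      using nz by simp
    then show ?thesis
      using True sign pos[OF u] pos[OF w] by (simp add: cadjoint_block_col_mult inner_blocks[of u])
  next
    case False
    then have "\<beta> < 0" "\<gamma> < 0"
      using sign nz by auto
    have "bot_block w = matrix_inv B\<^sub>2 *v (B\<^sub>2 *v bot_block w)"
      unfolding matrix_vector_mul_assoc pos_def_matrix_inv[OF B2] by (rule matrix_vector_mul_lid[symmetric])
    also have "\<dots> = (- 1 / \<gamma>) *\<^sub>R (matrix_inv B\<^sub>2 *v bot_block w)"
      unfolding eig(2)[OF w nz(2)] scaleR_right ..
    finally have "- \<gamma> *\<^sub>R bot_block w = - \<gamma> *\<^sub>R ((- 1 / \<gamma>) *\<^sub>R (matrix_inv B\<^sub>2 *v bot_block w))"
      by (rule arg_cong)
    then have *: "matrix_inv B\<^sub>2 *v bot_block w = - \<gamma> *\<^sub>R bot_block w"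
      using nz by simp
    have "(cadjoint H *v bot_block u) \<bullet> (matrix_inv B\<^sub>1 *v (cadjoint H *v bot_block w)) =
        bot_block u \<bullet> (matrix_inv B\<^sub>2 *v bot_block w)"
      unfolding inv_B2_eq by (simp add: matrix_vector_mul_assoc[symmetric] inner_matrix_vector_mult)
    then show ?thesis
      using neg[OF u \<open>\<beta> < 0\<close>] neg[OF w \<open>\<gamma> < 0\<close>] \<open>\<gamma> < 0\<close>
      unfolding * by (simp add: cadjoint_block_col_mult inner_blocks[of u])
  qed
qed

text \<open>Both sides are real-bilinear in \<open>u\<close> and \<open>w\<close>, so eigenvectors
  suffice. Equal eigenvalues produce \<open>min x t\<close>. Distinct ones give zero: for opposite
  signs because the Dirichlet value vanishes, for equal signs because \<open>u\<close> and
  \<open>w\<close> are orthogonal.\<close>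

lemma has_bochner_integral_free_form:
  assumes x: "0 \<le> x" and t: "0 \<le> t"
  shows "has_bochner_integral lborel
    (\<lambda>l. (cadjoint (e0_tilde B H x l) *v u) \<bullet> (matrix_inv B\<^sub>1 *v (cadjoint (e0_tilde B H t l) *v w)))
    (2 * pi * min x t * (u \<bullet> w))" (is "has_bochner_integral lborel (?f u w) (?I u w)")
proof -
  let ?E = "{u. \<exists>\<beta>::real. matrix_inv B *v u = \<beta> *\<^sub>R u}"
  note span = span_matrix_eigenvectors[OF self_adjoint_inv_B]
  note mult_right = bounded_bilinear.add_right[OF bounded_bilinear_matrix_vector_mult]
    bounded_bilinear.scaleR_right[OF bounded_bilinear_matrix_vector_mult]
    bounded_bilinear.zero_right[OF bounded_bilinear_matrix_vector_mult]
  \<comment> \<open>The zero vector solves the eigenvalue equation for every number, so 1 is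
    supplied; the later division by the eigenvalues requires nonzero ones.\<close>
  have nonzero: "\<exists>\<beta>. \<beta> \<noteq> 0 \<and> matrix_inv B *v u = \<beta> *\<^sub>R u" if "u \<in> ?E" for u
  proof (cases "u = 0")
    case False
    from that obtain \<beta> where \<beta>: "matrix_inv B *v u = \<beta> *\<^sub>R u"
      by auto
    have "B *v (matrix_inv B *v u) = u"
      unfolding matrix_vector_mul_assoc block_diag_inv by (rule matrix_vector_mul_lid)
    then have "\<beta> \<noteq> 0"
      using False unfolding \<beta> by (auto simp: mult_right)
    with \<beta> show ?thesis
      by blast
  qed (auto intro: exI[of _ 1])
  have eigen: "has_bochner_integral lborel (?f u w) (?I u w)" if uE: "u \<in> ?E" and wE: "w \<in> ?E" for u w
  proof -
    obtain \<beta> \<gamma> where nz: "\<beta> \<noteq> 0" "\<gamma> \<noteq> 0" and u: "matrix_inv B *v u = \<beta> *\<^sub>R u"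
      and w: "matrix_inv B *v w = \<gamma> *\<^sub>R w"
      using nonzero[OF uE] nonzero[OF wE] by blast
    define a where "a = cadjoint (block_col (mat 1) H) *v u"
    define b where "b = matrix_inv B\<^sub>1 *v (cadjoint (block_col (mat 1) H) *v w)"
    define E where "E = (\<lambda>l. (cis (\<beta> * x * l) - 1) * cnj (cis (\<gamma> * t * l) - 1) / complex_of_real (l\<^sup>2))"
    have f: "?f u w l = (Re (E l) * (a \<bullet> b) - Im (E l) * ((\<i> *s a) \<bullet> b)) / (\<beta> * \<gamma>)" if "l \<noteq> 0" for l
    proof -
      define c where "c = (cis (- (l * \<beta> * x)) - 1) / (- (\<i> * of_real (l * \<beta>)))"
      define d where "d = (cis (- (l * \<gamma> * t)) - 1) / (- (\<i> * of_real (l * \<gamma>)))"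
      have "cnj c * d = E l / of_real (\<beta> * \<gamma>)"
        using nz that by (simp add: c_def d_def E_def cis_cnj field_simps power2_eq_square)
      moreover have "?f u w l = (c *s a) \<bullet> (d *s b)"
        unfolding cadjoint_e0_tilde_eigenvector[OF self_adjoint_inv_B u nz(1) that x]
          cadjoint_e0_tilde_eigenvector[OF self_adjoint_inv_B w nz(2) that t]
        by (simp only: matrix_mult_scalar_mult a_def b_def c_def d_def)
      ultimately show ?thesis
        unfolding inner_scalar_mult by (simp add: diff_divide_distrib)
    qed
    have "has_bochner_integral lborel (\<lambda>l. (Re (E l) * (a \<bullet> b) - Im (E l) * ((\<i> *s a) \<bullet> b)) / (\<beta> * \<gamma>))
        ((pi * (\<bar>\<beta> * x\<bar> + \<bar>\<gamma> * t\<bar> - \<bar>\<beta> * x - \<gamma> * t\<bar>) * (a \<bullet> b) - 0 * ((\<i> *s a) \<bullet> b)) / (\<beta> * \<gamma>))"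
      using nz unfolding E_def
      by (intro has_bochner_integral_divide has_bochner_integral_diff has_bochner_integral_mult_left
          has_bochner_integral_cis_products)
    also have "(pi * (\<bar>\<beta> * x\<bar> + \<bar>\<gamma> * t\<bar> - \<bar>\<beta> * x - \<gamma> * t\<bar>) * (a \<bullet> b) - 0 * ((\<i> *s a) \<bullet> b)) / (\<beta> * \<gamma>) = ?I u w"
    proof (cases "0 < \<beta> \<longleftrightarrow> 0 < \<gamma>")
      case False
      then have "\<bar>\<beta> * x\<bar> + \<bar>\<gamma> * t\<bar> - \<bar>\<beta> * x - \<gamma> * t\<bar> = 0"
      proof (cases "0 < \<beta>")
        case True
        then have "0 \<le> \<beta> * x" "\<gamma> * t \<le> 0"
          using False x t by (auto intro: mult_nonpos_nonneg)
        then show ?thesis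
          by simp
      next
        case *: False
        then have "\<beta> * x \<le> 0" "0 \<le> \<gamma> * t"
          using False x t by (auto intro: mult_nonpos_nonneg)
        then show ?thesis
          by simp
      qed
      moreover have "u \<bullet> w = 0"
        using False by (intro eigenvectors_orthogonal[OF self_adjoint_inv_B u w]) auto
      ultimately show ?thesis
        by simp
    next
      case True
      have ab: "a \<bullet> b = \<bar>\<gamma>\<bar> * (u \<bullet> w)"
        unfolding a_def b_def using u w nz True by (rule initial_form_eigenvector)
      show ?thesis
      proof (cases "\<beta> = \<gamma>")
        case False
        then have "u \<bullet> w = 0"
          by (rule eigenvectors_orthogonal[OF self_adjoint_inv_B u w])
        then show ?thesis
          by (simp add: ab)
      next
        case True
        have "\<bar>\<beta> * x\<bar> + \<bar>\<gamma> * t\<bar> - \<bar>\<beta> * x - \<gamma> * t\<bar> = \<bar>\<gamma>\<bar> * (x + t - \<bar>x - t\<bar>)"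
          using x t by (simp add: True abs_mult right_diff_distrib[symmetric]) (simp add: algebra_simps)
        also have "\<dots> = \<bar>\<gamma>\<bar> * (2 * min x t)"
          by (simp add: min_def)
        finally show ?thesis
          using nz by (simp add: ab True field_simps flip: abs_mult)
      qed
    qed
    finally have *: "has_bochner_integral lborel
        (\<lambda>l. (Re (E l) * (a \<bullet> b) - Im (E l) * ((\<i> *s a) \<bullet> b)) / (\<beta> * \<gamma>)) (?I u w)" .
    show ?thesis
    proof (rule has_bochner_integralI_AE[OF *])
      note [measurable] = borel_measurable_has_bochner_integral[OF *]
      \<comment> \<open>The closed form is valid only off l = 0. Keeping the true value at this one
        point gives measurability, and the point itself is a null set.\<close>
      have "?f u w = (\<lambda>l. if l = 0 then ?f u w 0
          else (Re (E l) * (a \<bullet> b) - Im (E l) * ((\<i> *s a) \<bullet> b)) / (\<beta> * \<gamma>))"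
        using f by fastforce
      also have "\<dots> \<in> borel_measurable lborel"
        by measurable
      finally show "?f u w \<in> borel_measurable lborel" .
      show "AE l in lborel. (Re (E l) * (a \<bullet> b) - Im (E l) * ((\<i> *s a) \<bullet> b)) / (\<beta> * \<gamma>) = ?f u w l"
        using AE_lborel_singleton[of 0] by eventually_elim (simp add: f)
    qed
  qed
  have eigen_left: "has_bochner_integral lborel (?f u w) (?I u w)" if "u \<in> ?E" for u w
  proof (rule span_eq_UNIV_induct[OF span])
    show "subspace {w. has_bochner_integral lborel (?f u w) (?I u w)}"
      by (rule subspaceI)
        (auto simp: mult_right inner_add_right distrib_left has_bochner_integral_zero
          mult.left_commute intro: has_bochner_integral_add has_bochner_integral_mult_right)
  qed (rule eigen[OF that])
  show ?thesis
  proof (rule span_eq_UNIV_induct[OF span, where x = u])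
    show "subspace {u. has_bochner_integral lborel (?f u w) (?I u w)}"
      by (rule subspaceI)
        (auto simp: mult_right inner_add_left distrib_left has_bochner_integral_zero
          mult.left_commute intro: has_bochner_integral_add has_bochner_integral_mult_right)
  qed (rule eigen_left)
qed

end

lemma borel_measurable_matrix_vector_mult:
  fixes M :: "'x \<Rightarrow> complex^'b^'a"
  assumes "M \<in> borel_measurable N" "p \<in> borel_measurable N"
  shows "(\<lambda>x. M x *v p x) \<in> borel_measurable N"
proof (rule borel_measurable_continuous_Pair[OF assms])
  show "continuous_on UNIV (\<lambda>x :: (complex^'b^'a) \<times> (complex^'b). fst x *v snd x)"
    by (intro bounded_bilinear.continuous_on[OF bounded_bilinear_matrix_vector_mult] continuous_intros)
qed

lemma sandwich_form:
  "u \<bullet> ((U ** \<Phi> ** cadjoint V) *v w) = (cadjoint U *v u) \<bullet> (\<Phi> *v (cadjoint V *v (w :: complex^'n)))"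
  unfolding matrix_vector_mul_assoc[symmetric] inner_matrix_vector_mult ..

lemma cscale_of_real: "cscale (of_real r) A = r *\<^sub>R A"
  by (simp add: cscale_def vec_eq_iff scaleR_conv_of_real[where 'a=complex])

text \<open>A general \<open>\<sigma>\<close> may charge l = 0, so that point is kept as a separate
  case; elsewhere the explicit quotient applies. Invertibility of \<open>B\<close> leaves only u = 0
  for the eigenvalue 0.\<close>

lemma borel_measurable_cadjoint_e0_tilde:
  fixes H :: "complex^'n^'n"
  assumes sa: "self_adjoint (matrix_inv B)"
    and inv: "B ** matrix_inv B = mat 1" and x: "0 \<le> x"
  shows "(\<lambda>l. cadjoint (e0_tilde B H x l) *v u) \<in> borel_measurable borel"
proof (rule span_eq_UNIV_induct[OF span_matrix_eigenvectors[OF sa]])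
  note mult_right = bounded_bilinear.add_right[OF bounded_bilinear_matrix_vector_mult]
    bounded_bilinear.scaleR_right[OF bounded_bilinear_matrix_vector_mult]
    bounded_bilinear.zero_right[OF bounded_bilinear_matrix_vector_mult]
  show "subspace {u. (\<lambda>l. cadjoint (e0_tilde B H x l) *v u) \<in> borel_measurable borel}"
    by (rule subspaceI) (auto simp: mult_right)
  fix u assume "u \<in> {u. \<exists>\<beta>::real. matrix_inv B *v u = \<beta> *\<^sub>R u}"
  then obtain \<beta> :: real where \<beta>: "matrix_inv B *v u = \<beta> *\<^sub>R u"
    by auto
  show "(\<lambda>l. cadjoint (e0_tilde B H x l) *v u) \<in> borel_measurable borel"
  proof (cases "\<beta> = 0")
    case True
    have "u = B *v (matrix_inv B *v u)"
      unfolding matrix_vector_mul_assoc inv by (rule matrix_vector_mul_lid[symmetric])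
    also have "\<dots> = 0"
      unfolding \<beta> True by (simp add: mult_right)
    finally show ?thesis
      by (simp add: mult_right)
  next
    case False
    define c where "c = (\<lambda>l::real. (cis (- (l * \<beta> * x)) - 1) / (- (\<i> * of_real (l * \<beta>))))"
    have "c \<in> borel_measurable borel"
      unfolding c_def cis_conv_exp
      by (intro borel_measurable_divide borel_measurable_continuous_onI continuous_intros)
    then have "(\<lambda>l. c l *s (cadjoint (block_col (mat 1) H) *v u)) \<in> borel_measurable borel"
      by (rule borel_measurable_continuous_on[OF
          bounded_linear.continuous_on[OF bounded_linear_scalar_mult continuous_on_id]])
    then have "(\<lambda>l. if l = 0 then cadjoint (e0_tilde B H x 0) *v u
        else c l *s (cadjoint (block_col (mat 1) H) *v u)) \<in> borel_measurable borel"
      by measurable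
    also have "(\<lambda>l. if l = 0 then cadjoint (e0_tilde B H x 0) *v u
        else c l *s (cadjoint (block_col (mat 1) H) *v u)) = (\<lambda>l. cadjoint (e0_tilde B H x l) *v u)"
      using cadjoint_e0_tilde_eigenvector[OF sa \<beta> False _ x, of _ H] by (auto simp: c_def)
    finally show ?thesis .
  qed
qed

text \<open>The isometry supplies equalities of norms, given as extended nonnegative integrals.
  Their finiteness yields integrability, and polarization carries them over to the mixed
  form.\<close>

lemma has_bochner_integral_form_polarization:
  fixes p q :: "real \<Rightarrow> complex^'n"
  assumes sets: "sets \<tau> = sets borel" and \<Phi>: "\<Phi> \<in> borel_measurable borel" "\<And>l. nonneg_matrix (\<Phi> l)"
    and p: "p \<in> borel_measurable borel" and q: "q \<in> borel_measurable borel"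
    and N: "0 \<le> Np" "0 \<le> Nq" "0 \<le> Npq"
    and eq: "(\<integral>\<^sup>+l. ennreal (p l \<bullet> (\<Phi> l *v p l)) \<partial>\<tau>) = ennreal Np"
      "(\<integral>\<^sup>+l. ennreal (q l \<bullet> (\<Phi> l *v q l)) \<partial>\<tau>) = ennreal Nq"
      "(\<integral>\<^sup>+l. ennreal ((p l + q l) \<bullet> (\<Phi> l *v (p l + q l))) \<partial>\<tau>) = ennreal Npq"
  shows "has_bochner_integral \<tau> (\<lambda>l. p l \<bullet> (\<Phi> l *v q l)) ((Npq - Np - Nq) / 2)"
proof -
  have form: "has_bochner_integral \<tau> (\<lambda>l. r l \<bullet> (\<Phi> l *v r l)) n"
    if r: "r \<in> borel_measurable borel" and "0 \<le> n"
      "(\<integral>\<^sup>+l. ennreal (r l \<bullet> (\<Phi> l *v r l)) \<partial>\<tau>) = ennreal n" for r n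
  proof (rule has_bochner_integral_nn_integral)
    have "(\<lambda>l. r l \<bullet> (\<Phi> l *v r l)) \<in> borel_measurable borel"
      by (intro borel_measurable_inner borel_measurable_matrix_vector_mult r \<Phi>(1))
    then show "(\<lambda>l. r l \<bullet> (\<Phi> l *v r l)) \<in> borel_measurable \<tau>"
      using measurable_cong_sets[OF sets refl] by blast
  qed (use that \<Phi>(2) in \<open>auto simp: nonneg_matrix_iff\<close>)
  have "has_bochner_integral \<tau> (\<lambda>l. ((p l + q l) \<bullet> (\<Phi> l *v (p l + q l)) - p l \<bullet> (\<Phi> l *v p l) -
      q l \<bullet> (\<Phi> l *v q l)) / 2) ((Npq - Np - Nq) / 2)"
    by (intro has_bochner_integral_divide has_bochner_integral_diff form p q eq N borel_measurable_add)
  moreover have "p l \<bullet> (\<Phi> l *v q l) = ((p l + q l) \<bullet> (\<Phi> l *v (p l + q l)) - p l \<bullet> (\<Phi> l *v p l) -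
      q l \<bullet> (\<Phi> l *v q l)) / 2" for l
    using \<Phi>(2) by (intro form_polarization) (simp add: nonneg_matrix_iff)
  ultimately show ?thesis
    by (simp only:)
qed

section \<open>The free spectral function, its trace measure and its density\<close>

context
  fixes B\<^sub>1 B\<^sub>2 H :: "complex^'n^'n" and B :: "complex^('n + 'n)^('n + 'n)" and \<sigma>\<^sub>0
  assumes B1: "pos_def_matrix B\<^sub>1" and B2: "pos_def_matrix B\<^sub>2"
    and B1_eq: "B\<^sub>1 = cadjoint H ** B\<^sub>2 ** H"
    and B_eq: "B = block_diag B\<^sub>1 (- B\<^sub>2)"
    and \<sigma>0: "\<sigma>\<^sub>0 = (\<lambda>l. cscale (of_real (l / (2 * pi))) (matrix_inv B\<^sub>1))"
begin

lemma free_spectral_function: "\<sigma>\<^sub>0 l = (l / (2 * pi)) *\<^sub>R matrix_inv B\<^sub>1"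
  unfolding \<sigma>0 cscale_of_real ..

lemma trace_inv_pos: "0 < Re (trace (matrix_inv B\<^sub>1))"
proof -
  have "0 < axis i 1 \<bullet> (matrix_inv B\<^sub>1 *v axis i 1)" for i
    by (intro pos_def_matrix_pos pos_def_matrix_inverse B1) (simp add: axis_eq_0_iff)
  then have "0 < Re (matrix_inv B\<^sub>1 $ i $ i)" for i
    by (simp add: inner_axis' matrix_vector_axis inner_complex_def)
  then show ?thesis
    by (simp add: trace_def sum_pos)
qed

lemma nonneg_matrix_scaled_inv: "0 \<le> r \<Longrightarrow> nonneg_matrix (r *\<^sub>R matrix_inv B\<^sub>1)"
proof -
  assume r: "0 \<le> r"
  have sa: "self_adjoint (matrix_inv B\<^sub>1)"
    using pos_def_matrix_inverse[OF B1] unfolding pos_def_matrix_iff by blast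
  have "0 \<le> v \<bullet> (matrix_inv B\<^sub>1 *v v)" for v
  proof (cases "v = 0")
    case False
    then show ?thesis
      using pos_def_matrix_pos[OF pos_def_matrix_inverse[OF B1]] less_imp_le by blast
  qed simp
  then show ?thesis
    using sa r unfolding nonneg_matrix_iff self_adjoint_def
    by (simp add: linear_scale[OF bounded_linear.linear[OF bounded_linear_cadjoint]]
        bounded_bilinear.scaleR_left[OF bounded_bilinear_matrix_vector_mult])
qed

lemma free_increasing: "increasing_matrix \<sigma>\<^sub>0"
proof -
  have "self_adjoint (r *\<^sub>R matrix_inv B\<^sub>1)" for r
    using nonneg_matrix_scaled_inv[of 1] unfolding nonneg_matrix_iff self_adjoint_def
    by (simp add: linear_scale[OF bounded_linear.linear[OF bounded_linear_cadjoint]])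
  moreover have "\<sigma>\<^sub>0 l - \<sigma>\<^sub>0 m = ((l - m) / (2 * pi)) *\<^sub>R matrix_inv B\<^sub>1" for l m
    by (simp add: free_spectral_function scaleR_diff_left diff_divide_distrib)
  ultimately show ?thesis
    by (simp add: increasing_matrix_def free_spectral_function nonneg_matrix_scaled_inv)
qed

lemma free_right_continuous: "continuous (at_right l) \<sigma>\<^sub>0"
  unfolding free_spectral_function[abs_def] by (intro continuous_intros) auto

lemma trace_free: "Re (trace (\<sigma>\<^sub>0 l)) = Re (trace (matrix_inv B\<^sub>1)) / (2 * pi) * l"
  by (simp add: free_spectral_function linear_scale[OF bounded_linear.linear[OF bounded_linear_trace]])

lemma trace_measure_free:
  "trace_measure \<sigma>\<^sub>0 = density lborel (\<lambda>_. ennreal (Re (trace (matrix_inv B\<^sub>1)) / (2 * pi)))"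
proof (rule borel_measure_eqI_Ioc)
  let ?c = "Re (trace (matrix_inv B\<^sub>1)) / (2 * pi)"
  have c: "0 < ?c"
    using trace_inv_pos by simp
  show "emeasure (trace_measure \<sigma>\<^sub>0) {a<..b} = emeasure (density lborel (\<lambda>_. ennreal ?c)) {a<..b}"
    if "a < b" for a b
  proof -
    have "emeasure (trace_measure \<sigma>\<^sub>0) {a<..b} = ennreal (?c * b - ?c * a)"
      unfolding trace_measure_def trace_free using that trace_inv_pos
      by (intro emeasure_interval_measure_Ioc) (auto intro!: mult_left_mono divide_right_mono continuous_intros)
    also have "\<dots> = ennreal ?c * ennreal (b - a)"
      using that c by (simp add: ennreal_mult[symmetric] right_diff_distrib)
    also have "\<dots> = emeasure (density lborel (\<lambda>_. ennreal ?c)) {a<..b}"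
      using that by (simp add: emeasure_density nn_integral_cmult_indicator)
    finally show ?thesis .
  qed
  show "emeasure (trace_measure \<sigma>\<^sub>0) {a<..b} \<noteq> \<infinity>" for a b
    by (rule emeasure_trace_measure_finite[OF free_increasing free_right_continuous])
qed (simp_all add: trace_measure_def)

text \<open>Dividing by the trace compensates the trace in \<open>trace_measure_free\<close>;
  together they leave \<open>matrix_inv B\<^sub>1\<close> times Lebesgue measure over 2 pi.\<close>

lemma is_matrix_density_free:
  "is_matrix_density \<sigma>\<^sub>0 (\<lambda>_. (1 / Re (trace (matrix_inv B\<^sub>1))) *\<^sub>R matrix_inv B\<^sub>1)"
proof -
  let ?A = "matrix_inv B\<^sub>1" and ?t = "Re (trace (matrix_inv B\<^sub>1))"
  have "has_bochner_integral (trace_measure \<sigma>\<^sub>0) (\<lambda>s. indicator {m<..l} s *\<^sub>R ((1 / ?t) *\<^sub>R ?A)) (\<sigma>\<^sub>0 l - \<sigma>\<^sub>0 m)"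
    if "m < l" for m l
  proof -
    have "measure (trace_measure \<sigma>\<^sub>0) {m<..l} = ?t / (2 * pi) * (l - m)"
      using that trace_inv_pos
      by (simp add: trace_measure_free measure_def emeasure_density nn_integral_cmult_indicator enn2real_mult)
    moreover have "has_bochner_integral (trace_measure \<sigma>\<^sub>0) (\<lambda>s. indicator {m<..l} s *\<^sub>R ((1 / ?t) *\<^sub>R ?A))
        (measure (trace_measure \<sigma>\<^sub>0) {m<..l} *\<^sub>R ((1 / ?t) *\<^sub>R ?A))"
      using emeasure_trace_measure_finite[OF free_increasing free_right_continuous, of m l]
      by (intro has_bochner_integral_indicator) (auto simp: trace_measure_def less_top)
    ultimately show ?thesis
      using trace_inv_pos by (simp add: free_spectral_function scaleR_diff_left[symmetric] diff_divide_distrib)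
  qed
  moreover have "nonneg_matrix ((1 / ?t) *\<^sub>R ?A)"
    using nonneg_matrix_scaled_inv[of "1 / ?t"] trace_inv_pos by simp
  ultimately show ?thesis
    unfolding is_matrix_density_def set_integrable_def set_lebesgue_integral_def has_bochner_integral_iff
    by (intro conjI allI impI borel_measurable_const) (simp_all only:)
qed

text \<open>The factor 1 / (2 pi) in \<open>\<sigma>\<^sub>0\<close> cancels the 2 pi of the
  Dirichlet integrals. What remains is Parseval for the indicator functions of [0, x] and [0, t],
  whose inner product is \<open>min x t\<close>.\<close>

lemma free_sigma_integral:
  assumes x: "0 \<le> x" and t: "0 \<le> t"
  shows "sigma_integrable \<sigma>\<^sub>0 (e0_tilde B H x) (e0_tilde B H t)"
    and "sigma_integral \<sigma>\<^sub>0 (e0_tilde B H x) (e0_tilde B H t) = min x t *\<^sub>R mat 1"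
proof -
  let ?A = "matrix_inv B\<^sub>1" and ?t = "Re (trace (matrix_inv B\<^sub>1))"
  note inv = block_diag_inv[OF B1 B2 B1_eq B_eq] and sa = self_adjoint_inv_B[OF B1 B2 B1_eq B_eq]
  have form: "has_bochner_integral (trace_measure \<sigma>\<^sub>0) (\<lambda>l. u \<bullet> ((e0_tilde B H x l **
      matrix_density \<sigma>\<^sub>0 l ** cadjoint (e0_tilde B H t l)) *v w)) (u \<bullet> ((min x t *\<^sub>R mat 1) *v w))"
    for u w
  proof -
    define f where "f = (\<lambda>l. (cadjoint (e0_tilde B H x l) *v u) \<bullet> (?A *v (cadjoint (e0_tilde B H t l) *v w)))"
    define g where "g = (\<lambda>l. (cadjoint (e0_tilde B H x l) *v u) \<bullet>
        (matrix_density \<sigma>\<^sub>0 l *v (cadjoint (e0_tilde B H t l) *v w)))"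
    have f: "has_bochner_integral lborel f (2 * pi * min x t * (u \<bullet> w))"
      unfolding f_def by (rule has_bochner_integral_free_form[OF B1 B2 B1_eq B_eq x t])
    have "has_bochner_integral lborel (\<lambda>l. (?t / (2 * pi)) *\<^sub>R ((1 / ?t) * f l))
        ((?t / (2 * pi)) *\<^sub>R ((1 / ?t) * (2 * pi * min x t * (u \<bullet> w))))"
      by (intro has_bochner_integral_scaleR_right has_bochner_integral_mult_right f)
    then have "has_bochner_integral lborel (\<lambda>l. (?t / (2 * pi)) *\<^sub>R ((1 / ?t) * f l)) (min x t * (u \<bullet> w))"
      using trace_inv_pos by simp
    then have *: "has_bochner_integral (trace_measure \<sigma>\<^sub>0) (\<lambda>l. (1 / ?t) * f l) (min x t * (u \<bullet> w))"
      unfolding trace_measure_free using trace_inv_pos borel_measurable_has_bochner_integral[OF f]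
      by (intro has_bochner_integral_density) auto
    have "g \<in> borel_measurable borel"
      unfolding g_def using matrix_density[OF free_increasing free_right_continuous]
      by (intro borel_measurable_inner borel_measurable_matrix_vector_mult
          borel_measurable_cadjoint_e0_tilde[OF sa inv(2)] x t) (simp_all add: is_matrix_density_def)
    then have "g \<in> borel_measurable (trace_measure \<sigma>\<^sub>0)"
      unfolding trace_measure_def by simp
    \<comment> \<open>The chosen density is determined up to null sets only; here it is exchanged
      for the explicit one.\<close>
    moreover have "AE l in trace_measure \<sigma>\<^sub>0. (1 / ?t) * f l = g l"
      using matrix_density_unique[OF free_increasing free_right_continuous is_matrix_density_free]
      by eventually_elim
        (simp add: f_def g_def bounded_bilinear.scaleR_left[OF bounded_bilinear_matrix_vector_mult])
    ultimately have "has_bochner_integral (trace_measure \<sigma>\<^sub>0) g (min x t * (u \<bullet> w))"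
      by (rule has_bochner_integralI_AE[OF *])
    then show ?thesis
      unfolding sandwich_form g_def
      by (simp add: bounded_bilinear.scaleR_left[OF bounded_bilinear_matrix_vector_mult])
  qed
  show "sigma_integrable \<sigma>\<^sub>0 (e0_tilde B H x) (e0_tilde B H t)"
    unfolding sigma_integrable_def by (rule integral_matrixI(1)[OF form])
  show "sigma_integral \<sigma>\<^sub>0 (e0_tilde B H x) (e0_tilde B H t) = min x t *\<^sub>R mat 1"
    unfolding sigma_integral_def by (rule integral_matrixI(2)[OF form])
qed

end

section \<open>Parseval identity for the perturbed problem\<close>

lemmas continuous_on_matrix_mult = bounded_bilinear.continuous_on[OF bounded_bilinear_matrix_mult]

lemmas matrix_mult_integral_right =
  integral_linear[OF _ bounded_bilinear.bounded_linear_right[OF bounded_bilinear_matrix_mult], unfolded o_def]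

lemmas matrix_mult_integral_left =
  integral_linear[OF _ bounded_bilinear.bounded_linear_left[OF bounded_bilinear_matrix_mult], unfolded o_def]

lemma continuous_on_section:
  assumes "continuous_on S (\<lambda>(x, t). K x t)" "continuous_on U f" "continuous_on U g"
    "\<And>z. z \<in> U \<Longrightarrow> (f z, g z) \<in> S"
  shows "continuous_on U (\<lambda>z. K (f z) (g z))"
  using continuous_on_compose2[OF assms(1) continuous_on_Pair[OF assms(2,3)]] assms(4) by auto

text \<open>The construction of \<open>R\<close> provides a right inverse, (I + K)(I + R) = I. Hence
  (I + R) Y and \<open>e\<close> both solve the Volterra equation (I + K) z = Y, and uniqueness
  identifies them.\<close>

lemma volterra_resolvent_inverts:
  fixes K R :: "real \<Rightarrow> real \<Rightarrow> complex^'m^'m" and e Y :: "real \<Rightarrow> complex^'n^'m"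
  assumes K: "continuous_on {(x, t). 0 \<le> t \<and> t \<le> x} (\<lambda>(x, t). K x t)"
    and R: "continuous_on UNIV (\<lambda>(x, t). R x t)"
    and res: "\<And>x t. 0 \<le> t \<Longrightarrow> t \<le> x \<Longrightarrow> x \<le> X \<Longrightarrow>
      R x t + K x t + integral {t..x} (\<lambda>s. K x s ** R s t) = 0"
    and e: "continuous_on {0..X} e" and Y: "continuous_on {0..X} Y"
    and Y_eq: "\<And>x. x \<in> {0..X} \<Longrightarrow> Y x = e x + integral {0..x} (\<lambda>t. K x t ** e t)"
    and x: "x \<in> {0..X}"
  shows "e x = Y x + integral {0..x} (\<lambda>t. R x t ** Y t)"
proof -
  define z where "z = (\<lambda>x. Y x + integral {0..x} (\<lambda>t. R x t ** Y t))"
  have Kx: "continuous_on {a..x} (K x)" if "0 \<le> a" for a x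
    using that by (intro continuous_on_section[OF K] continuous_intros) auto
  have contRY: "continuous_on {0..X} (\<lambda>x. integral {0..x} (\<lambda>t. R x t ** Y t))"
  proof (rule continuous_on_integral_bounds)
    show "continuous_on {(p, s). p \<in> {0..X} \<and> 0 \<le> s \<and> s \<le> p} (\<lambda>(p, s). R p s ** Y s)"
      unfolding case_prod_beta'
      by (intro continuous_on_matrix_mult continuous_on_section[OF R] continuous_on_compose2[OF Y]
          continuous_intros) auto
  qed (auto intro: continuous_intros)
  then have z: "continuous_on {0..X} z"
    unfolding z_def by (intro continuous_intros Y)
  have z_eq: "z x + integral {0..x} (\<lambda>s. K x s ** z s) = Y x" if x: "x \<in> {0..X}" for x
  proof -
    define N where "N = (\<lambda>s t. K x s ** R s t ** Y t)"
    have Yx: "continuous_on {0..x} Y"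
      using x by (intro continuous_on_subset[OF Y]) auto
    have RYx: "continuous_on {0..x} (\<lambda>x. integral {0..x} (\<lambda>t. R x t ** Y t))"
      using x by (intro continuous_on_subset[OF contRY]) auto
    have RYs: "continuous_on {0..s} (\<lambda>t. R s t ** Y t)" if "s \<in> {0..x}" for s
      using that x by (intro continuous_on_matrix_mult continuous_on_section[OF R] continuous_intros
          continuous_on_subset[OF Y]) auto
    have KR: "continuous_on {t..x} (\<lambda>s. K x s ** R s t)" if "t \<in> {0..x}" for t
      using that by (intro continuous_on_matrix_mult Kx continuous_on_section[OF R] continuous_intros) auto
    have N: "continuous_on {(s, t). 0 \<le> t \<and> t \<le> x \<and> t \<le> s \<and> s \<le> x} (\<lambda>(s, t). N s t)"
      unfolding N_def case_prod_beta' using x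
      by (intro continuous_on_matrix_mult continuous_on_section[OF R] continuous_on_compose2[OF Y]
          continuous_on_section[OF K, of _ "\<lambda>_. x"] continuous_intros) auto
    have KRY: "continuous_on {0..x} (\<lambda>t. integral {t..x} (\<lambda>s. K x s ** R s t) ** Y t)"
    proof (intro continuous_on_matrix_mult Yx continuous_on_integral_bounds)
      show "continuous_on {(p, s). p \<in> {0..x} \<and> p \<le> s \<and> s \<le> x} (\<lambda>(p, s). K x s ** R s p)"
        unfolding case_prod_beta'
        by (intro continuous_on_matrix_mult continuous_on_section[OF R]
            continuous_on_section[OF K, of _ "\<lambda>_. x"] continuous_intros) auto
    qed (use x in \<open>auto intro: continuous_intros\<close>)
    have "integral {0..x} (\<lambda>s. K x s ** z s) =
        integral {0..x} (\<lambda>s. K x s ** Y s) + integral {0..x} (\<lambda>s. K x s ** integral {0..s} (\<lambda>t. R s t ** Y t))"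
      unfolding z_def bounded_bilinear.add_right[OF bounded_bilinear_matrix_mult]
      by (intro Henstock_Kurzweil_Integration.integral_add integrable_continuous_interval
          continuous_on_matrix_mult Kx Yx RYx) simp_all
    also have "integral {0..x} (\<lambda>s. K x s ** integral {0..s} (\<lambda>t. R s t ** Y t)) =
        integral {0..x} (\<lambda>s. integral {0..min s x} (N s))"
    proof (intro integral_cong)
      fix s assume s: "s \<in> {0..x}"
      have "K x s ** integral {0..s} (\<lambda>t. R s t ** Y t) = integral {0..s} (\<lambda>t. K x s ** (R s t ** Y t))"
        by (rule matrix_mult_integral_right[symmetric]) (intro integrable_continuous_interval RYs s)
      then show "K x s ** integral {0..s} (\<lambda>t. R s t ** Y t) = integral {0..min s x} (N s)"
        using s by (simp add: N_def matrix_mul_assoc min_def)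
    qed
    also have "\<dots> = integral {0..min x x} (\<lambda>t. integral {t..x} (\<lambda>s. N s t))"
      using x by (intro integral_swap_trapezoid[symmetric] N) auto
    also have "\<dots> = integral {0..x} (\<lambda>t. integral {t..x} (\<lambda>s. K x s ** R s t) ** Y t)"
      unfolding N_def min.idem
      by (intro integral_cong matrix_mult_integral_left integrable_continuous_interval KR)
    also have "integral {0..x} (\<lambda>t. K x t ** Y t) + \<dots> =
        integral {0..x} (\<lambda>t. K x t ** Y t + integral {t..x} (\<lambda>s. K x s ** R s t) ** Y t)"
      by (intro Henstock_Kurzweil_Integration.integral_add[symmetric] integrable_continuous_interval
          continuous_on_matrix_mult Kx Yx KRY) simp
    also have "\<dots> = integral {0..x} (\<lambda>t. - (R x t ** Y t))"
    proof (intro integral_cong)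
      fix t assume "t \<in> {0..x}"
      then have "K x t + integral {t..x} (\<lambda>s. K x s ** R s t) = - R x t"
        using res[of t x] x by (simp add: eq_neg_iff_add_eq_0 add_ac)
      then show "K x t ** Y t + integral {t..x} (\<lambda>s. K x s ** R s t) ** Y t = - (R x t ** Y t)"
        by (simp add: bounded_bilinear.add_left[OF bounded_bilinear_matrix_mult, symmetric]
            bounded_bilinear.minus_left[OF bounded_bilinear_matrix_mult])
    qed
    also have "\<dots> = - integral {0..x} (\<lambda>t. R x t ** Y t)"
      by simp
    finally show ?thesis
      by (simp add: z_def)
  qed
  have "e x - z x = 0"
  proof (rule volterra_unique[OF K _ _ x])
    show "continuous_on {0..X} (\<lambda>x. e x - z x)"
      by (intro continuous_intros e z)
    fix x assume x: "x \<in> {0..X}"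
    have "integral {0..x} (\<lambda>t. K x t ** (e t - z t)) =
        integral {0..x} (\<lambda>t. K x t ** e t) - integral {0..x} (\<lambda>t. K x t ** z t)"
      unfolding bounded_bilinear.diff_right[OF bounded_bilinear_matrix_mult] using x
      by (intro Henstock_Kurzweil_Integration.integral_diff integrable_continuous_interval
          continuous_on_matrix_mult Kx continuous_on_subset[OF e] continuous_on_subset[OF z]) auto
    then have "e x - z x + integral {0..x} (\<lambda>t. K x t ** (e t - z t)) =
        (e x + integral {0..x} (\<lambda>t. K x t ** e t)) - (z x + integral {0..x} (\<lambda>t. K x t ** z t))"
      by simp
    then show "e x - z x + integral {0..x} (\<lambda>t. K x t ** (e t - z t)) = 0"
      unfolding z_eq[OF x] Y_eq[OF x, symmetric] by simp
  qed
  then show ?thesis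
    by (simp add: z_def)
qed

text \<open>Norms and transforms are Lebesgue integrals over the half-line, while kernels are
  integrated by gauge integrals over compact intervals; the two meet here.\<close>

lemma has_bochner_integral_halfline:
  fixes f :: "real \<Rightarrow> 'a::euclidean_space"
  assumes f: "continuous_on {0..x} f"
  shows "has_bochner_integral (lebesgue_on {0..}) (\<lambda>s. if s \<in> {0..x} then f s else 0) (integral {0..x} f)"
proof -
  have "set_integrable lborel {0..x} f"
    by (rule borel_integrable_atLeastAtMost'[OF f])
  then have int: "integrable lborel (\<lambda>s. indicator {0..x} s *\<^sub>R f s)"
    and eq: "integral\<^sup>L lborel (\<lambda>s. indicator {0..x} s *\<^sub>R f s) = integral {0..x} f"
    using set_borel_integral_eq_integral(2) by (auto simp: set_integrable_def set_lebesgue_integral_def)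
  have meas: "(\<lambda>s. indicator {0..x} s *\<^sub>R f s) \<in> borel_measurable lborel"
    using int by (rule borel_measurable_integrable)
  have "has_bochner_integral lebesgue (\<lambda>s. indicator {0..x} s *\<^sub>R f s) (integral {0..x} f)"
    using int eq by (simp add: has_bochner_integral_iff integrable_completion[OF meas] integral_completion[OF meas])
  moreover have "(\<lambda>s. indicator {0..} s *\<^sub>R (if s \<in> {0..x} then f s else 0)) = (\<lambda>s. indicator {0..x} s *\<^sub>R f s)"
    by (auto simp: indicator_def)
  ultimately show ?thesis
    by (subst has_bochner_integral_restrict_space) auto
qed

text \<open>Integrating (I + R) f over [0, x] and exchanging the order produces the integral of
  \<open>adjoint_factor R x s\<close> applied to f(s). Accordingly
  \<open>adjoint_cutoff R x u\<close> is the adjoint of I + R applied to \<open>u\<close> times the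
  indicator of [0, x].\<close>

definition adjoint_factor :: "(real \<Rightarrow> real \<Rightarrow> complex^'m^'m) \<Rightarrow> real \<Rightarrow> real \<Rightarrow> complex^'m^'m"
  where "adjoint_factor R x s = mat 1 + integral {s..x} (\<lambda>y. R y s)"

definition adjoint_cutoff :: "(real \<Rightarrow> real \<Rightarrow> complex^'m^'m) \<Rightarrow> real \<Rightarrow> complex^'m \<Rightarrow> real \<Rightarrow> complex^'m"
  where "adjoint_cutoff R x u s = (if s \<in> {0..x} then cadjoint (adjoint_factor R x s) *v u else 0)"

context
  fixes R :: "real \<Rightarrow> real \<Rightarrow> complex^'m^'m"
  assumes R: "continuous_on UNIV (\<lambda>(x, t). R x t)"
begin

lemma continuous_on_adjoint_factor:
  "continuous_on {(x, s). s \<le> x} (\<lambda>(x, s). adjoint_factor R x s)"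
  unfolding adjoint_factor_def case_prod_beta'
proof (intro continuous_intros continuous_on_integral_bounds)
  show "continuous_on {(p, y). p \<in> {x. snd x \<le> fst x} \<and> snd p \<le> y \<and> y \<le> fst p} (\<lambda>(p, y). R y (snd p))"
    unfolding case_prod_beta' by (intro continuous_on_section[OF R] continuous_intros) auto
qed auto

lemma continuous_on_adjoint_factor_section:
  "continuous_on {0..min x t} (adjoint_factor R x)"
  by (intro continuous_on_section[OF continuous_on_adjoint_factor] continuous_intros) auto

lemma adjoint_cutoff_inner:
  "has_bochner_integral (lebesgue_on {0..}) (\<lambda>s. adjoint_cutoff R x u s \<bullet> adjoint_cutoff R t w s)
    (integral {0..min x t} (\<lambda>s. (cadjoint (adjoint_factor R x s) *v u) \<bullet> (cadjoint (adjoint_factor R t s) *v w)))"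
proof -
  have "continuous_on {0..min x t}
      (\<lambda>s. (cadjoint (adjoint_factor R x s) *v u) \<bullet> (cadjoint (adjoint_factor R t s) *v w))"
    using continuous_on_adjoint_factor_section[of x t] continuous_on_adjoint_factor_section[of t x]
    by (intro continuous_on_inner bounded_linear.continuous_on[OF bounded_linear_matrix_vector_left]
        bounded_linear.continuous_on[OF bounded_linear_cadjoint]) (auto simp: min.commute)
  from has_bochner_integral_halfline[OF this] show ?thesis
    by (rule has_bochner_integral_cong[THEN iffD1, rotated -1])
       (auto simp: adjoint_cutoff_def)
qed

lemma L2_comp_adjoint_cutoff:
  assumes "f = (\<lambda>s. adjoint_cutoff R x u s + adjoint_cutoff R t w s)"
  shows "f \<in> L2_comp"
    and "L2_normsq f = ennreal (
      integral {0..min x x} (\<lambda>s. (cadjoint (adjoint_factor R x s) *v u) \<bullet> (cadjoint (adjoint_factor R x s) *v u)) +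
      integral {0..min t t} (\<lambda>s. (cadjoint (adjoint_factor R t s) *v w) \<bullet> (cadjoint (adjoint_factor R t s) *v w)) +
      2 * integral {0..min x t} (\<lambda>s. (cadjoint (adjoint_factor R x s) *v u) \<bullet> (cadjoint (adjoint_factor R t s) *v w)))"
proof -
  have meas: "adjoint_cutoff R x u \<in> borel_measurable (lebesgue_on {0..})" for x u
  proof -
    have "continuous_on {0..x} (\<lambda>s. cadjoint (adjoint_factor R x s) *v u)"
      using continuous_on_adjoint_factor_section[of x x]
      by (intro bounded_linear.continuous_on[OF bounded_linear_matrix_vector_left]
        bounded_linear.continuous_on[OF bounded_linear_cadjoint]) simp
    from borel_measurable_has_bochner_integral[OF has_bochner_integral_halfline[OF this]]
    show ?thesis
      unfolding adjoint_cutoff_def .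
  qed
  have sq: "(norm (f s))\<^sup>2 = adjoint_cutoff R x u s \<bullet> adjoint_cutoff R x u s +
      adjoint_cutoff R t w s \<bullet> adjoint_cutoff R t w s + 2 * (adjoint_cutoff R x u s \<bullet> adjoint_cutoff R t w s)" for s
    unfolding assms power2_norm_eq_inner by (simp add: inner_add_left inner_add_right inner_commute)
  have int: "has_bochner_integral (lebesgue_on {0..}) (\<lambda>s. (norm (f s))\<^sup>2) (
      integral {0..min x x} (\<lambda>s. (cadjoint (adjoint_factor R x s) *v u) \<bullet> (cadjoint (adjoint_factor R x s) *v u)) +
      integral {0..min t t} (\<lambda>s. (cadjoint (adjoint_factor R t s) *v w) \<bullet> (cadjoint (adjoint_factor R t s) *v w)) +
      2 * integral {0..min x t} (\<lambda>s. (cadjoint (adjoint_factor R x s) *v u) \<bullet> (cadjoint (adjoint_factor R t s) *v w)))"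
    unfolding sq by (intro has_bochner_integral_add has_bochner_integral_mult_right adjoint_cutoff_inner)
  then show norm: "L2_normsq f = ennreal (
      integral {0..min x x} (\<lambda>s. (cadjoint (adjoint_factor R x s) *v u) \<bullet> (cadjoint (adjoint_factor R x s) *v u)) +
      integral {0..min t t} (\<lambda>s. (cadjoint (adjoint_factor R t s) *v w) \<bullet> (cadjoint (adjoint_factor R t s) *v w)) +
      2 * integral {0..min x t} (\<lambda>s. (cadjoint (adjoint_factor R x s) *v u) \<bullet> (cadjoint (adjoint_factor R t s) *v w)))"
    unfolding L2_normsq_def has_bochner_integral_iff by (subst nn_integral_eq_integral) auto
  have "f s = 0" if "max x t < s" for s
    using that by (simp add: assms adjoint_cutoff_def)
  then have "\<exists>r. \<forall>s>r. f s = 0"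
    by blast
  moreover have "f \<in> borel_measurable (lebesgue_on {0..})"
    unfolding assms by (intro borel_measurable_add meas)
  ultimately show "f \<in> L2_comp"
    by (simp add: L2_comp_def L2_halfline_def norm)
qed

text \<open>By duality: transforming the adjoint of I + R applied to a cut-off vector amounts to
  integrating (I + R) Y over [0, x], and (I + R) Y is \<open>e\<close>.\<close>

lemma Y_transform_adjoint_cutoff:
  fixes Y e :: "real \<Rightarrow> complex \<Rightarrow> complex^'n^'m"
  assumes Y: "continuous_on {0..} (\<lambda>s. Y s (of_real l))"
    and e: "\<And>y. y \<in> {0..x} \<Longrightarrow>
      e y (of_real l) = Y y (of_real l) + integral {0..y} (\<lambda>s. R y s ** Y s (of_real l))"
    and x: "0 \<le> x"
  shows "has_bochner_integral (lebesgue_on {0..}) (\<lambda>s. cadjoint (Y s (of_real l)) *v adjoint_cutoff R x u s)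
    (cadjoint (integral {0..x} (\<lambda>s. e s (of_real l))) *v u)"
proof -
  define y where "y = (\<lambda>s. Y s (of_real l))"
  have y: "continuous_on {0..x} y"
    using Y unfolding y_def by (rule continuous_on_subset) auto
  have G: "continuous_on {0..x} (adjoint_factor R x)"
    using continuous_on_adjoint_factor_section[of x x] by simp
  have Gy: "continuous_on {0..x} (\<lambda>s. adjoint_factor R x s ** y s)"
    by (intro continuous_on_matrix_mult G y)
  have bl: "bounded_linear (\<lambda>M :: complex^'n^'m. cadjoint M *v u)"
    by (rule bounded_linear_compose[OF bounded_linear_matrix_vector_left bounded_linear_cadjoint])
  have Ry: "continuous_on {s..x} (\<lambda>y. R y s)" for s
    by (intro continuous_on_section[OF R] continuous_intros) auto
  have int_R: "continuous_on {0..x} (\<lambda>s. integral {s..x} (\<lambda>y. R y s))"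
    using continuous_on_diff[OF G continuous_on_const[of _ "mat 1"]] by (simp add: adjoint_factor_def)
  have int_y: "continuous_on {0..x} (\<lambda>r. integral {0..r} (\<lambda>s. R r s ** y s))"
  proof (rule continuous_on_integral_bounds)
    show "continuous_on {(p, s). p \<in> {0..x} \<and> 0 \<le> s \<and> s \<le> p} (\<lambda>(p, s). R p s ** y s)"
      unfolding case_prod_beta'
      by (intro continuous_on_matrix_mult continuous_on_section[OF R] continuous_on_compose2[OF y]
          continuous_intros) auto
  qed (auto intro: continuous_intros)
  have "integral {0..x} (\<lambda>s. adjoint_factor R x s ** y s) =
      integral {0..x} y + integral {0..x} (\<lambda>s. integral {s..x} (\<lambda>y. R y s) ** y s)"
    unfolding adjoint_factor_def bounded_bilinear.add_left[OF bounded_bilinear_matrix_mult] matrix_mul_lid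
    by (intro Henstock_Kurzweil_Integration.integral_add integrable_continuous_interval
        continuous_on_matrix_mult y int_R)
  also have "integral {0..x} (\<lambda>s. integral {s..x} (\<lambda>y. R y s) ** y s) =
      integral {0..min x x} (\<lambda>s. integral {s..x} (\<lambda>r. R r s ** y s))"
    unfolding min.idem
    by (intro integral_cong matrix_mult_integral_left[symmetric] integrable_continuous_interval Ry)
  also have "\<dots> = integral {0..x} (\<lambda>r. integral {0..min r x} (\<lambda>s. R r s ** y s))"
  proof (rule integral_swap_trapezoid[OF x x])
    show "continuous_on {(r, s). 0 \<le> s \<and> s \<le> x \<and> s \<le> r \<and> r \<le> x} (\<lambda>(r, s). R r s ** y s)"
      unfolding case_prod_beta'
      by (intro continuous_on_matrix_mult continuous_on_section[OF R] continuous_on_compose2[OF y]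
          continuous_intros) auto
  qed
  also have "\<dots> = integral {0..x} (\<lambda>r. integral {0..r} (\<lambda>s. R r s ** y s))"
    by (intro integral_cong) simp
  also have "integral {0..x} y + \<dots> = integral {0..x} (\<lambda>r. y r + integral {0..r} (\<lambda>s. R r s ** y s))"
    by (intro Henstock_Kurzweil_Integration.integral_add[symmetric] integrable_continuous_interval y int_y)
  also have "\<dots> = integral {0..x} (\<lambda>s. e s (of_real l))"
    by (intro integral_cong) (simp add: e y_def)
  finally have Gy_eq: "integral {0..x} (\<lambda>s. adjoint_factor R x s ** y s) = integral {0..x} (\<lambda>s. e s (of_real l))" .
  have "continuous_on {0..x} (\<lambda>s. cadjoint (adjoint_factor R x s ** y s) *v u)"
    by (rule bounded_linear.continuous_on[OF bl Gy])
  from has_bochner_integral_halfline[OF this]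
  have "has_bochner_integral (lebesgue_on {0..})
      (\<lambda>s. if s \<in> {0..x} then cadjoint (adjoint_factor R x s ** y s) *v u else 0)
      (cadjoint (integral {0..x} (\<lambda>s. e s (of_real l))) *v u)"
    using integral_linear[OF integrable_continuous_interval[OF Gy] bl] by (simp add: o_def Gy_eq)
  moreover have "(\<lambda>s. if s \<in> {0..x} then cadjoint (adjoint_factor R x s ** y s) *v u else 0) =
      (\<lambda>s. cadjoint (Y s (of_real l)) *v adjoint_cutoff R x u s)"
    by (rule ext) (simp add: adjoint_cutoff_def y_def cadjoint_mult matrix_vector_mul_assoc)
  ultimately show ?thesis
    by (simp only:)
qed

text \<open>Parseval for \<open>Y\<close>, applied to \<open>(I + R)\<^sup>*\<close> of the indicator functions of \<open>[0, x]\<close> and \<open>[0, t]\<close>;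
  polarization turns the norm identity into one for the bilinear form.\<close>

lemma spectral_sigma_integral:
  fixes Y e :: "real \<Rightarrow> complex \<Rightarrow> complex^'n^'m" and \<sigma> :: "real \<Rightarrow> complex^'n^'n"
  assumes spec: "is_spectral_function Y \<sigma>"
    and Y: "\<And>l. continuous_on {0..} (\<lambda>s. Y s l)"
    and e: "\<And>y l. y \<in> {0..X} \<Longrightarrow> e y l = Y y l + integral {0..y} (\<lambda>s. R y s ** Y s l)"
    and E: "E = (\<lambda>x l. integral {0..x} (\<lambda>s. e s (of_real l)))"
    and x: "x \<in> {0..X}" and t: "t \<in> {0..X}"
    and meas: "\<And>x u. 0 \<le> x \<Longrightarrow> (\<lambda>l. cadjoint (E x l) *v u) \<in> borel_measurable borel"
  shows "sigma_integrable \<sigma> (E x) (E t)"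
    and "sigma_integral \<sigma> (E x) (E t) =
      integral {0..min x t} (\<lambda>s. adjoint_factor R x s ** cadjoint (adjoint_factor R t s))"
proof -
  let ?g = "\<lambda>x u s. cadjoint (adjoint_factor R x s) *v u"
  define I where "I = (\<lambda>x u t w. integral {0..min x t} (\<lambda>s. ?g x u s \<bullet> ?g t w s))"
  obtain V where inc: "increasing_matrix \<sigma>" and rc: "\<And>l. continuous (at_right l) \<sigma>"
    and V: "\<And>f. f \<in> L2_halfline \<Longrightarrow> sigma_normsq \<sigma> (V f) = L2_normsq f"
      "\<And>f. f \<in> L2_comp \<Longrightarrow> V f = Y_transform Y f"
    using spec unfolding is_spectral_function_def is_L2_isometry_def by blast
  have dens: "matrix_density \<sigma> \<in> borel_measurable borel" "\<And>l. nonneg_matrix (matrix_density \<sigma> l)"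
    using matrix_density[OF inc rc] by (auto simp: is_matrix_density_def)
  \<comment> \<open>Stated for a sum of two cut-offs because the vector 0 in the second place
    recovers a single norm, so all three inputs of the polarization are instances.\<close>
  have parseval: "(\<integral>\<^sup>+l. ennreal ((cadjoint (E a l) *v u + cadjoint (E b l) *v w) \<bullet> (matrix_density \<sigma> l *v
      (cadjoint (E a l) *v u + cadjoint (E b l) *v w))) \<partial>trace_measure \<sigma>) =
      ennreal (I a u a u + I b w b w + 2 * I a u b w)"
    if "a \<in> {0..X}" "b \<in> {0..X}" for a b u w
  proof -
    define f where "f = (\<lambda>s. adjoint_cutoff R a u s + adjoint_cutoff R b w s)"
    have f: "f \<in> L2_comp"
      by (rule L2_comp_adjoint_cutoff(1)[OF f_def])
    have "Y_transform Y f l = cadjoint (E a l) *v u + cadjoint (E b l) *v w" for l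
    proof -
      have "has_bochner_integral (lebesgue_on {0..}) (\<lambda>s. cadjoint (Y s (of_real l)) *v adjoint_cutoff R a u s +
          cadjoint (Y s (of_real l)) *v adjoint_cutoff R b w s) (cadjoint (E a l) *v u + cadjoint (E b l) *v w)"
        unfolding E using that
        by (intro has_bochner_integral_add Y_transform_adjoint_cutoff Y e) auto
      then show ?thesis
        by (simp add: Y_transform_def f_def matrix_vector_right_distrib has_bochner_integral_iff)
    qed
    moreover have "sigma_normsq \<sigma> (Y_transform Y f) = L2_normsq f"
      using V(1)[of f] V(2)[OF f] f by (simp add: L2_comp_def)
    ultimately show ?thesis
      unfolding sigma_normsq_def Re_quad_form L2_comp_adjoint_cutoff(2)[OF f_def] I_def by simp
  qed
  have zero: "cadjoint (E b l) *v 0 = 0" "I a u b 0 = 0" "I a 0 b u = 0" for a b u l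
    by (simp_all add: I_def)
  have I_nonneg: "0 \<le> I a u a u" for a u
    unfolding I_def
  proof (rule Henstock_Kurzweil_Integration.integral_nonneg)
    show "(\<lambda>s. ?g a u s \<bullet> ?g a u s) integrable_on {0..min a a}"
      by (intro integrable_continuous_interval continuous_on_inner
          bounded_linear.continuous_on[OF bounded_linear_matrix_vector_left]
          bounded_linear.continuous_on[OF bounded_linear_cadjoint] continuous_on_adjoint_factor_section)
  qed simp
  have form: "has_bochner_integral (trace_measure \<sigma>)
      (\<lambda>l. u \<bullet> ((E x l ** matrix_density \<sigma> l ** cadjoint (E t l)) *v w))
      (u \<bullet> (integral {0..min x t} (\<lambda>s. adjoint_factor R x s ** cadjoint (adjoint_factor R t s)) *v w))" for u w
  proof -
    \<comment> \<open>\<open>ennreal\<close> sends negative numbers to 0, so this sum must be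
      recognised as a squared norm before the extended integral determines it.\<close>
    have sum_nonneg: "0 \<le> I x u x u + I t w t w + 2 * I x u t w"
    proof -
      have "0 \<le> integral\<^sup>L (lebesgue_on {0..}) (\<lambda>s. (norm (adjoint_cutoff R x u s + adjoint_cutoff R t w s))\<^sup>2)"
        by simp
      also have "\<dots> = I x u x u + I t w t w + 2 * I x u t w"
        unfolding power2_norm_eq_inner inner_add_left inner_add_right I_def
        using has_bochner_integral_add[OF
            has_bochner_integral_add[OF adjoint_cutoff_inner[of x u x u] adjoint_cutoff_inner[of x u t w]]
            has_bochner_integral_add[OF adjoint_cutoff_inner[of x u t w] adjoint_cutoff_inner[of t w t w]]]
        by (simp add: has_bochner_integral_iff inner_commute algebra_simps)
      finally show ?thesis .
    qed
    have "has_bochner_integral (trace_measure \<sigma>)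
        (\<lambda>l. (cadjoint (E x l) *v u) \<bullet> (matrix_density \<sigma> l *v (cadjoint (E t l) *v w)))
        ((I x u x u + I t w t w + 2 * I x u t w - I x u x u - I t w t w) / 2)"
    proof (rule has_bochner_integral_form_polarization[OF sets_trace_measure[OF inc rc] dens])
      show "(\<integral>\<^sup>+l. ennreal ((cadjoint (E x l) *v u) \<bullet> (matrix_density \<sigma> l *v (cadjoint (E x l) *v u))) \<partial>trace_measure \<sigma>)
          = ennreal (I x u x u)"
        using parseval[OF x x, of u 0] by (simp add: zero)
      show "(\<integral>\<^sup>+l. ennreal ((cadjoint (E t l) *v w) \<bullet> (matrix_density \<sigma> l *v (cadjoint (E t l) *v w))) \<partial>trace_measure \<sigma>)
          = ennreal (I t w t w)"
        using parseval[OF t t, of w 0] by (simp add: zero)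
    qed (use x t in \<open>auto intro: meas I_nonneg sum_nonneg parseval\<close>)
    moreover have "I x u t w = u \<bullet> (integral {0..min x t} (\<lambda>s. adjoint_factor R x s ** cadjoint (adjoint_factor R t s)) *v w)"
    proof -
      have "continuous_on {0..min x t} (\<lambda>s. adjoint_factor R x s ** cadjoint (adjoint_factor R t s))"
        using continuous_on_adjoint_factor_section[of x t] continuous_on_adjoint_factor_section[of t x]
        by (intro continuous_on_matrix_mult bounded_linear.continuous_on[OF bounded_linear_cadjoint])
          (simp_all add: min.commute)
      moreover have "?g x u s \<bullet> ?g t w s = u \<bullet> ((adjoint_factor R x s ** cadjoint (adjoint_factor R t s)) *v w)" for s
        unfolding matrix_vector_mul_assoc[symmetric] by (rule inner_matrix_vector_mult[symmetric])
      ultimately show ?thesis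
        using integral_linear[OF integrable_continuous_interval bounded_linear_matrix_form[of u w]]
        unfolding I_def o_def by simp
    qed
    ultimately show ?thesis
      unfolding sandwich_form by simp
  qed
  show "sigma_integrable \<sigma> (E x) (E t)"
    unfolding sigma_integrable_def by (rule integral_matrixI(1)[OF form])
  show "sigma_integral \<sigma> (E x) (E t) =
      integral {0..min x t} (\<lambda>s. adjoint_factor R x s ** cadjoint (adjoint_factor R t s))"
    unfolding sigma_integral_def by (rule integral_matrixI(2)[OF form])
qed

end

section \<open>The Gelfand-Levitan equation\<close>

text \<open>\<open>vector_derivative\<close> is a choice that is pinned down only at a limit point
  of the domain; the end 0 is one, approached from the right.\<close>

lemma at_within_halfline_neq_bot:
  assumes "0 \<le> (t::real)"
  shows "at t within {0..} \<noteq> bot"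
proof -
  have "at_right t \<le> at t within {0..}"
    using assms by (intro at_le) auto
  then show ?thesis
    using trivial_limit_at_right_real[of t] by (metis bot_unique)
qed

lemma has_vector_derivative_halfline_integral:
  fixes f :: "real \<Rightarrow> 'a::euclidean_space"
  assumes "continuous_on {0..} f" "0 \<le> t"
  shows "((\<lambda>t. integral {0..t} f) has_vector_derivative f t) (at t within {0..})"
proof -
  have "((\<lambda>t. integral {0..t} f) has_vector_derivative f t) (at t within {0..t + 1})"
    using assms by (intro integral_has_vector_derivative) (auto intro: continuous_on_subset)
  then show ?thesis
    using assms(2) by (subst (asm) at_within_nhd[of t "{..<t + 1}" _ "{0..}"]) auto
qed

section \<open>Closed form of \<open>F_tilde\<close> and its derivatives\<close>

definition kernel_tail :: "(real \<Rightarrow> real \<Rightarrow> complex^'m^'m) \<Rightarrow> real \<Rightarrow> real \<Rightarrow> complex^'m^'m"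
  where "kernel_tail R x s = integral {s..x} (\<lambda>y. R y s)"

text \<open>This is \<open>F_tilde\<close> on a square where \<open>R\<close> is the resolvent of
  \<open>K\<close>; the subtracted term is the contribution of
  \<open>\<sigma>\<^sub>0\<close>.\<close>

definition factor_product :: "(real \<Rightarrow> real \<Rightarrow> complex^'m^'m) \<Rightarrow> real \<Rightarrow> real \<Rightarrow> complex^'m^'m"
  where "factor_product R x t =
    integral {0..min x t} (\<lambda>s. adjoint_factor R x s ** cadjoint (adjoint_factor R t s)) - min x t *\<^sub>R mat 1"

definition factor_product_dt :: "(real \<Rightarrow> real \<Rightarrow> complex^'m^'m) \<Rightarrow> real \<Rightarrow> real \<Rightarrow> complex^'m^'m"
  where "factor_product_dt R x t =
    kernel_tail R x t + integral {0..min t x} (\<lambda>s. (mat 1 + kernel_tail R x s) ** cadjoint (R t s))"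

text \<open>Off the diagonal, the kernel of (I + R)(I + R)^* - I: \<open>R\<close> from one
  triangle, its adjoint from the other, and the product of the two. The branch taken at x = t is
  immaterial.\<close>

definition factor_product_dxdt :: "(real \<Rightarrow> real \<Rightarrow> complex^'m^'m) \<Rightarrow> real \<Rightarrow> real \<Rightarrow> complex^'m^'m"
  where "factor_product_dxdt R x t =
    (if t < x then R x t else cadjoint (R t x)) + integral {0..min x t} (\<lambda>s. R x s ** cadjoint (R t s))"

context
  fixes R :: "real \<Rightarrow> real \<Rightarrow> complex^'m^'m"
  assumes R: "continuous_on UNIV (\<lambda>(x, t). R x t)"
begin

lemma adjoint_factor_tail: "adjoint_factor R x s = mat 1 + kernel_tail R x s"
  by (simp add: adjoint_factor_def kernel_tail_def)

lemma tail_eq_0: "x \<le> s \<Longrightarrow> kernel_tail R x s = 0"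
  by (cases "x = s") (auto simp: kernel_tail_def)

lemma continuous_on_tail: "continuous_on UNIV (\<lambda>(x, s). kernel_tail R x s)"
proof -
  \<comment> \<open>\<open>max\<close> keeps the bounds in order. Both versions vanish when the
    upper bound does not exceed the lower one, so the tail is continuous across the
    diagonal.\<close>
  have "continuous_on UNIV (\<lambda>p. integral {snd p..max (fst p) (snd p)} (\<lambda>y. R y (snd p)))"
  proof (rule continuous_on_integral_bounds)
    show "continuous_on {(p, y). p \<in> UNIV \<and> snd p \<le> y \<and> y \<le> max (fst p) (snd p)} (\<lambda>(p, y). R y (snd p))"
      unfolding case_prod_beta' by (intro continuous_on_section[OF R] continuous_intros) auto
  qed (auto intro!: continuous_intros)
  moreover have "integral {s..max x s} (\<lambda>y. R y s) = kernel_tail R x s" for x s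
    using tail_eq_0[of x s] by (cases "x \<le> s") (auto simp: kernel_tail_def max_def)
  ultimately show ?thesis
    by (simp add: case_prod_beta')
qed

lemma continuous_on_R [continuous_intros]:
  "continuous_on S f \<Longrightarrow> continuous_on S g \<Longrightarrow> continuous_on S (\<lambda>z. R (f z) (g z))"
  by (rule continuous_on_section[OF R]) auto

lemma continuous_on_tail' [continuous_intros]:
  "continuous_on S f \<Longrightarrow> continuous_on S g \<Longrightarrow> continuous_on S (\<lambda>z. kernel_tail R (f z) (g z))"
  by (rule continuous_on_section[OF continuous_on_tail]) auto

lemmas [continuous_intros] = continuous_on_matrix_mult bounded_linear.continuous_on[OF bounded_linear_cadjoint]

text \<open>The identity term cancels \<open>min x t\<close>. The tail of \<open>x\<close> vanishes
  beyond \<open>x\<close>, so its range extends to \<open>t\<close>, and the remaining term takes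
  the trapezoid shape that can be differentiated in \<open>t\<close>.\<close>

lemma factor_product_eq:
  assumes x: "0 \<le> x" and t: "0 \<le> t"
  shows "factor_product R x t = integral {0..t} (kernel_tail R x) +
    integral {0..min x t} (\<lambda>s. integral {s..t} (\<lambda>z. (mat 1 + kernel_tail R x s) ** cadjoint (R z s)))"
proof -
  have int: "(\<lambda>s. (mat 1 + kernel_tail R x s) ** cadjoint (kernel_tail R t s)) integrable_on {0..min x t}"
    by (intro integrable_continuous_interval continuous_intros)
  have "integral {0..min x t} (\<lambda>s. adjoint_factor R x s ** cadjoint (adjoint_factor R t s)) =
      integral {0..min x t} (\<lambda>s. mat 1 + (kernel_tail R x s + (mat 1 + kernel_tail R x s) ** cadjoint (kernel_tail R t s)))"
    unfolding adjoint_factor_tail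
    by (simp add: bounded_bilinear.add_right[OF bounded_bilinear_matrix_mult]
        linear_add[OF bounded_linear.linear[OF bounded_linear_cadjoint]] add_ac)
  also have "\<dots> = integral {0..min x t} (\<lambda>s. mat 1) + (integral {0..min x t} (kernel_tail R x) +
      integral {0..min x t} (\<lambda>s. (mat 1 + kernel_tail R x s) ** cadjoint (kernel_tail R t s)))"
    by (subst Henstock_Kurzweil_Integration.integral_add;
        intro integrable_continuous_interval continuous_intros Henstock_Kurzweil_Integration.integral_add
          arg_cong2[where f=plus] refl)
  also have "integral {0..min x t} (\<lambda>s. (mat 1 :: complex^'m^'m)) = min x t *\<^sub>R mat 1"
    using x t by simp
  also have "integral {0..min x t} (kernel_tail R x) = integral {0..t} (kernel_tail R x)"
  proof (cases "x \<le> t")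
    case True
    have "integral {0..t} (kernel_tail R x) = integral {0..x} (kernel_tail R x) + integral {x..t} (kernel_tail R x)"
      using True x by (intro Henstock_Kurzweil_Integration.integral_combine[symmetric]
          integrable_continuous_interval continuous_intros) auto
    also have "integral {x..t} (kernel_tail R x) = integral {x..t} (\<lambda>_. 0)"
      by (intro integral_cong) (simp add: tail_eq_0)
    finally show ?thesis
      using True by (simp add: min_def)
  qed (simp add: min_def)
  also have "integral {0..min x t} (\<lambda>s. (mat 1 + kernel_tail R x s) ** cadjoint (kernel_tail R t s)) =
      integral {0..min x t} (\<lambda>s. integral {s..t} (\<lambda>z. (mat 1 + kernel_tail R x s) ** cadjoint (R z s)))"
  proof (intro integral_cong)
    fix s
    have int: "(\<lambda>z. R z s) integrable_on {s..t}"
      by (intro integrable_continuous_interval continuous_intros)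
    have "bounded_linear (\<lambda>M. (mat 1 + kernel_tail R x s) ** cadjoint M)"
      by (rule bounded_linear_compose[OF bounded_bilinear.bounded_linear_right[OF bounded_bilinear_matrix_mult]
            bounded_linear_cadjoint])
    from integral_linear[OF int this]
    show "(mat 1 + kernel_tail R x s) ** cadjoint (kernel_tail R t s) = integral {s..t} (\<lambda>z. (mat 1 + kernel_tail R x s) ** cadjoint (R z s))"
      by (simp add: o_def kernel_tail_def)
  qed
  finally show ?thesis
    by (simp add: factor_product_def)
qed

lemma has_vector_derivative_factor_product:
  assumes x: "0 \<le> x" and t: "0 \<le> t"
  shows "(factor_product R x has_vector_derivative factor_product_dt R x t) (at t within {0..})"
proof -
  have "((\<lambda>t. integral {0..t} (kernel_tail R x) +
    integral {0..min x t} (\<lambda>s. integral {s..t} (\<lambda>z. (mat 1 + kernel_tail R x s) ** cadjoint (R z s))))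
    has_vector_derivative factor_product_dt R x t) (at t within {0..})"
    unfolding factor_product_dt_def
  proof (intro has_vector_derivative_add has_vector_derivative_halfline_integral
      has_vector_derivative_trapezoid x t)
    show "continuous_on UNIV (\<lambda>(y, s). (mat 1 + kernel_tail R x s) ** cadjoint (R y s))"
      unfolding case_prod_beta' by (intro continuous_intros)
  qed (intro continuous_intros)
  then show ?thesis
    by (rule has_vector_derivative_transform[rotated 2]) (use x t in \<open>auto simp: factor_product_eq\<close>)
qed

text \<open>Two summands have a kink at x = t: the tail is 0 until \<open>x\<close> exceeds
  \<open>t\<close>, and the integral of the adjoint of \<open>R t s\<close> is constant from there
  on. Their slopes need not match, whence \<open>x \<noteq> t\<close>. The trapezoid term is
  differentiable throughout.\<close>

lemma has_vector_derivative_factor_product_dt: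
  assumes x: "0 \<le> x" and t: "0 \<le> t" and "x \<noteq> t"
  shows "((\<lambda>x. factor_product_dt R x t) has_vector_derivative factor_product_dxdt R x t) (at x within {0..})"
proof -
  define C where "C = (\<lambda>x. integral {0..min t x} (\<lambda>s. integral {s..x} (\<lambda>y. R y s ** cadjoint (R t s))))"
  define A where "A = (\<lambda>x. kernel_tail R x t + integral {0..min t x} (\<lambda>s. cadjoint (R t s)))"
  have C: "(C has_vector_derivative integral {0..min x t} (\<lambda>s. R x s ** cadjoint (R t s))) (at x within {0..})"
    unfolding C_def
  proof (rule has_vector_derivative_trapezoid[OF t x])
    show "continuous_on UNIV (\<lambda>(y, s). R y s ** cadjoint (R t s))"
      unfolding case_prod_beta' by (intro continuous_intros)
  qed
  have AC: "factor_product_dt R x t = A x + C x" for x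
  proof -
    have "integral {0..min t x} (\<lambda>s. (mat 1 + kernel_tail R x s) ** cadjoint (R t s)) =
        integral {0..min t x} (\<lambda>s. cadjoint (R t s)) + integral {0..min t x} (\<lambda>s. kernel_tail R x s ** cadjoint (R t s))"
      unfolding bounded_bilinear.add_left[OF bounded_bilinear_matrix_mult] matrix_mul_lid
      by (intro Henstock_Kurzweil_Integration.integral_add integrable_continuous_interval continuous_intros)
    also have "integral {0..min t x} (\<lambda>s. kernel_tail R x s ** cadjoint (R t s)) = C x"
      unfolding C_def kernel_tail_def
      by (intro integral_cong matrix_mult_integral_left[symmetric] integrable_continuous_interval continuous_intros)
    finally show ?thesis
      by (simp add: factor_product_dt_def A_def)
  qed
  have "(A has_vector_derivative (if t < x then R x t else cadjoint (R t x))) (at x within {0..})"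
  proof (cases "t < x")
    case True
    have "((\<lambda>x. integral {t..x} (\<lambda>y. R y t)) has_vector_derivative R x t) (at x within {t..x + 1})"
      using True by (intro integral_has_vector_derivative continuous_intros) auto
    then have "((\<lambda>x. kernel_tail R x t) has_vector_derivative R x t) (at x within {0..})"
      using True t by (subst (asm) at_within_nhd[of x "{t<..<x + 1}" _ "{0..}"]) (auto simp: kernel_tail_def)
    then have "((\<lambda>x. kernel_tail R x t + integral {0..t} (\<lambda>s. cadjoint (R t s))) has_vector_derivative R x t) (at x within {0..})"
      by (auto intro!: derivative_eq_intros)
    \<comment> \<open>Within distance x - t the argument stays beyond \<open>t\<close>, where the
      upper limit \<open>min t x\<close> is constantly \<open>t\<close>.\<close>
    then have "(A has_vector_derivative R x t) (at x within {0..})"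
      by (rule has_vector_derivative_transform_within[of _ _ _ _ "x - t"])
         (use True t in \<open>auto simp: A_def dist_real_def min_def\<close>)
    then show ?thesis
      using True by simp
  next
    case False
    have "((\<lambda>x. integral {0..x} (\<lambda>s. cadjoint (R t s))) has_vector_derivative cadjoint (R t x)) (at x within {0..})"
      by (intro has_vector_derivative_halfline_integral x continuous_intros)
    then have "(A has_vector_derivative cadjoint (R t x)) (at x within {0..})"
      by (rule has_vector_derivative_transform_within[of _ _ _ _ "t - x"])
         (use False x assms(3) in \<open>auto simp: A_def dist_real_def min_def tail_eq_0\<close>)
    then show ?thesis
      using False by simp
  qed
  from has_vector_derivative_add[OF this C] show ?thesis
    unfolding AC factor_product_dxdt_def .
qed

text \<open>Write \<open>F\<close> as a triangular part plus the product term \<open>C\<close>.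
  After exchanging the order, the resolvent equation turns the integral of
  \<open>K x s ** C s\<close> into minus that of \<open>K x s ** cadjoint (R t s)\<close> minus
  \<open>C x\<close>. This cancels the contribution of s < t and the \<open>C x\<close> inside
  \<open>F x t\<close>; the rest is the resolvent equation at (x, t).\<close>

lemma gelfand_levitan_resolvent:
  fixes K :: "real \<Rightarrow> real \<Rightarrow> complex^'m^'m"
  assumes K: "continuous_on {(x, t). 0 \<le> t \<and> t \<le> x} (\<lambda>(x, t). K x t)"
    and res: "\<And>t. 0 \<le> t \<Longrightarrow> t \<le> x \<Longrightarrow> R x t + K x t + integral {t..x} (\<lambda>s. K x s ** R s t) = 0"
    and t: "0 \<le> t" and tx: "t < x"
    and F: "\<And>s. s \<in> {0..x} \<Longrightarrow> s \<noteq> t \<Longrightarrow> F s t = factor_product_dxdt R s t"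
  shows "(\<lambda>s. K x s ** F s t) integrable_on {0..x}"
    and "F x t + K x t + integral {0..x} (\<lambda>s. K x s ** F s t) = 0"
proof -
  have Kx: "continuous_on S (\<lambda>z. K x (g z))"
    if "continuous_on S g" "\<And>z. z \<in> S \<Longrightarrow> 0 \<le> g z \<and> g z \<le> x" for S :: "'z::topological_space set" and g
    using that by (intro continuous_on_section[OF K] continuous_on_const) auto
  define C where "C = (\<lambda>s. integral {0..min s t} (\<lambda>u. R s u ** cadjoint (R t u)))"
  have C: "continuous_on {0..x} C"
    unfolding C_def
  proof (rule continuous_on_integral_bounds)
    show "continuous_on {(p, s). p \<in> {0..x} \<and> 0 \<le> s \<and> s \<le> min p t} (\<lambda>(p, s). R p s ** cadjoint (R t s))"
      unfolding case_prod_beta' by (intro continuous_intros)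
  qed (use t in \<open>auto intro: continuous_intros\<close>)
  have C0: "continuous_on {0..t} C" and Ct: "continuous_on {t..x} C"
    using t tx by (auto intro: continuous_on_subset[OF C])
  have K0: "continuous_on {0..t} (K x)" and Kt: "continuous_on {u..x} (K x)" if "0 \<le> u" for u
    using that t tx by (auto intro!: Kx continuous_intros)
  have "((\<lambda>s. K x s ** (cadjoint (R t s) + C s)) has_integral
      integral {0..t} (\<lambda>s. K x s ** (cadjoint (R t s) + C s))) {0..t}"
    by (intro integrable_integral integrable_continuous_interval continuous_intros C0 K0[OF order_refl])
  \<comment> \<open>The value of \<open>F\<close> at s = t is unspecified, which a single point
    allows.\<close>
  then have 1: "((\<lambda>s. K x s ** F s t) has_integral
      integral {0..t} (\<lambda>s. K x s ** (cadjoint (R t s) + C s))) {0..t}"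
    by (rule has_integral_spike_finite[of "{t}", rotated 2])
       (use tx in \<open>auto simp: F factor_product_dxdt_def C_def\<close>)
  have "((\<lambda>s. K x s ** (R s t + C s)) has_integral
      integral {t..x} (\<lambda>s. K x s ** (R s t + C s))) {t..x}"
    by (intro integrable_integral integrable_continuous_interval continuous_intros Ct Kt t)
  then have 2: "((\<lambda>s. K x s ** F s t) has_integral
      integral {t..x} (\<lambda>s. K x s ** (R s t + C s))) {t..x}"
    by (rule has_integral_spike_finite[of "{t}", rotated 2])
       (use t in \<open>auto simp: F factor_product_dxdt_def C_def\<close>)
  have 3: "((\<lambda>s. K x s ** F s t) has_integral integral {0..t} (\<lambda>s. K x s ** (cadjoint (R t s) + C s)) +
      integral {t..x} (\<lambda>s. K x s ** (R s t + C s))) {0..x}"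
    using has_integral_combine[OF t less_imp_le[OF tx] 1 2] .
  then show "(\<lambda>s. K x s ** F s t) integrable_on {0..x}"
    by (rule has_integral_integrable)
  have I1: "integral {0..t} (\<lambda>s. K x s ** (cadjoint (R t s) + C s)) =
      integral {0..t} (\<lambda>s. K x s ** cadjoint (R t s)) + integral {0..t} (\<lambda>s. K x s ** C s)"
    unfolding bounded_bilinear.add_right[OF bounded_bilinear_matrix_mult]
    by (intro Henstock_Kurzweil_Integration.integral_add integrable_continuous_interval continuous_intros
        C0 K0[OF order_refl])
  have I2: "integral {t..x} (\<lambda>s. K x s ** (R s t + C s)) =
      integral {t..x} (\<lambda>s. K x s ** R s t) + integral {t..x} (\<lambda>s. K x s ** C s)"
    unfolding bounded_bilinear.add_right[OF bounded_bilinear_matrix_mult]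
    by (intro Henstock_Kurzweil_Integration.integral_add integrable_continuous_interval continuous_intros
        Ct Kt t)
  have I3: "integral {0..t} (\<lambda>s. K x s ** C s) + integral {t..x} (\<lambda>s. K x s ** C s) = integral {0..x} (\<lambda>s. K x s ** C s)"
    using t tx by (intro Henstock_Kurzweil_Integration.integral_combine integrable_continuous_interval continuous_intros
        C Kt) auto
  define N where "N = (\<lambda>s u. K x s ** R s u ** cadjoint (R t u))"
  have "integral {0..x} (\<lambda>s. K x s ** C s) = integral {0..x} (\<lambda>s. integral {0..min s t} (N s))"
  proof (intro integral_cong)
    fix s
    have "(\<lambda>u. R s u ** cadjoint (R t u)) integrable_on {0..min s t}"
      by (intro integrable_continuous_interval continuous_intros)
    from matrix_mult_integral_right[OF this, of "K x s"]
    show "K x s ** C s = integral {0..min s t} (N s)"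
      by (simp add: C_def N_def matrix_mul_assoc)
  qed
  also have "\<dots> = integral {0..min t x} (\<lambda>u. integral {u..x} (\<lambda>s. N s u))"
  proof (intro integral_swap_trapezoid[symmetric] t)
    show "continuous_on {(y, s). 0 \<le> s \<and> s \<le> t \<and> s \<le> y \<and> y \<le> x} (\<lambda>(y, s). N y s)"
      unfolding case_prod_beta' N_def by (intro continuous_intros Kx) auto
  qed (use t tx in auto)
  also have "\<dots> = integral {0..t} (\<lambda>u. - (K x u ** cadjoint (R t u)) - R x u ** cadjoint (R t u))"
  proof -
    have "integral {u..x} (\<lambda>s. N s u) = - (K x u ** cadjoint (R t u)) - R x u ** cadjoint (R t u)"
      if "u \<in> {0..t}" for u
    proof -
      have "integral {u..x} (\<lambda>s. N s u) = integral {u..x} (\<lambda>s. K x s ** R s u) ** cadjoint (R t u)"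
        unfolding N_def using that
        by (intro matrix_mult_integral_left integrable_continuous_interval continuous_intros Kt) auto
      also have "integral {u..x} (\<lambda>s. K x s ** R s u) = - K x u - R x u"
        using res[of u] that tx by (simp add: eq_diff_eq eq_neg_iff_add_eq_0 add_ac)
      finally show ?thesis
        by (simp add: bounded_bilinear.diff_left[OF bounded_bilinear_matrix_mult]
            bounded_bilinear.minus_left[OF bounded_bilinear_matrix_mult])
    qed
    then have "integral {0..t} (\<lambda>u. integral {u..x} (\<lambda>s. N s u)) =
        integral {0..t} (\<lambda>u. - (K x u ** cadjoint (R t u)) - R x u ** cadjoint (R t u))"
      by (rule integral_cong)
    then show ?thesis
      using tx by (simp add: min_def)
  qed
  also have "\<dots> = integral {0..t} (\<lambda>u. - (K x u ** cadjoint (R t u))) - integral {0..t} (\<lambda>u. R x u ** cadjoint (R t u))"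
    by (intro Henstock_Kurzweil_Integration.integral_diff integrable_continuous_interval continuous_intros
        K0[OF order_refl])
  also have "\<dots> = - integral {0..t} (\<lambda>s. K x s ** cadjoint (R t s)) - C x"
    using tx by (simp add: C_def min_def)
  finally have I4: "integral {0..x} (\<lambda>s. K x s ** C s) = - integral {0..t} (\<lambda>s. K x s ** cadjoint (R t s)) - C x" .
  have "integral {0..x} (\<lambda>s. K x s ** F s t) =
      integral {0..t} (\<lambda>s. K x s ** cadjoint (R t s)) + integral {t..x} (\<lambda>s. K x s ** R s t) +
      (integral {0..t} (\<lambda>s. K x s ** C s) + integral {t..x} (\<lambda>s. K x s ** C s))"
    unfolding integral_unique[OF 3] I1 I2 by simp
  then have "integral {0..x} (\<lambda>s. K x s ** F s t) = integral {t..x} (\<lambda>s. K x s ** R s t) - C x"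
    unfolding I3 I4 by simp
  moreover have "F x t = R x t + C x"
    using t tx by (simp add: F factor_product_dxdt_def C_def)
  ultimately have "F x t + K x t + integral {0..x} (\<lambda>s. K x s ** F s t) =
      R x t + K x t + integral {t..x} (\<lambda>s. K x s ** R s t)"
    by simp
  then show "F x t + K x t + integral {0..x} (\<lambda>s. K x s ** F s t) = 0"
    using res[of t] t tx by simp
qed

end

section \<open>Assembly for the boundary value problem\<close>

context
  fixes B\<^sub>1 B\<^sub>2 H :: "complex^'n^'n" and B :: "complex^('n + 'n)^('n + 'n)"
    and Q :: "real \<Rightarrow> complex^('n + 'n)^('n + 'n)"
    and Y :: "real \<Rightarrow> complex \<Rightarrow> complex^'n^('n + 'n)"
    and K :: "real \<Rightarrow> real \<Rightarrow> complex^('n + 'n)^('n + 'n)"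
    and \<sigma> \<sigma>\<^sub>0 :: "real \<Rightarrow> complex^'n^'n"
  assumes B1: "pos_def_matrix B\<^sub>1" and B2: "pos_def_matrix B\<^sub>2"
    and B1_eq: "B\<^sub>1 = cadjoint H ** B\<^sub>2 ** H"
    and B_eq: "B = block_diag B\<^sub>1 (- B\<^sub>2)"
    and sol: "is_fundamental_solution B H Q Y"
    and ker: "is_transformation_kernel B H Y K"
    and spec: "is_spectral_function Y \<sigma>"
    and \<sigma>0: "\<sigma>\<^sub>0 = (\<lambda>l. cscale (of_real (l / (2 * pi))) (matrix_inv B\<^sub>1))"
begin

lemma kernel_continuous: "continuous_on {(x, t). 0 \<le> t \<and> t \<le> x} (\<lambda>(x, t). K x t)"
  using ker by (simp add: is_transformation_kernel_def)

text \<open>\<open>R\<close> depends on \<open>X\<close> and is quantified jointly with its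
  resolvent equation, because the final cancellation requires the same \<open>R\<close> there and in
  \<open>F_tilde\<close>.\<close>

lemma F_tilde_factorization:
  assumes X: "0 \<le> X"
  shows "\<exists>R. continuous_on UNIV (\<lambda>(x, t). R x t) \<and>
    (\<forall>x t. 0 \<le> t \<and> t \<le> x \<and> x \<le> X \<longrightarrow> R x t + K x t + integral {t..x} (\<lambda>s. K x s ** R s t) = 0) \<and>
    (\<forall>x\<in>{0..X}. \<forall>t\<in>{0..X}. sigma_integrable \<sigma> (e0_tilde B H x) (e0_tilde B H t) \<and>
      F_tilde B H \<sigma> \<sigma>\<^sub>0 x t = factor_product R x t)"
proof -
  obtain R :: "real \<Rightarrow> real \<Rightarrow> complex^('n + 'n)^('n + 'n)" where
    R: "continuous_on UNIV (\<lambda>(x, t). R x t)"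
    and res: "\<And>x t. 0 \<le> t \<Longrightarrow> t \<le> x \<Longrightarrow> x \<le> X \<Longrightarrow>
      R x t + K x t + integral {t..x} (\<lambda>s. K x s ** R s t) = 0"
    using volterra_resolvent_exists[OF kernel_continuous X] by blast
  note inv = block_diag_inv[OF B1 B2 B1_eq B_eq] and sa = self_adjoint_inv_B[OF B1 B2 B1_eq B_eq]
  have Y: "continuous_on {0..} (\<lambda>s. Y s l)" for l
    using sol by (auto simp: is_fundamental_solution_def continuous_on_eq_continuous_within
        intro: differentiable_imp_continuous_within)
  have e: "e0 B H y l = Y y l + integral {0..y} (\<lambda>s. R y s ** Y s l)" if "y \<in> {0..X}" for y l
    using ker that
    by (intro volterra_resolvent_inverts[OF kernel_continuous R res] continuous_on_e0 sa
        continuous_on_subset[OF Y]) (auto simp: is_transformation_kernel_def)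
  have E: "e0_tilde B H = (\<lambda>x l. integral {0..x} (\<lambda>s. e0 B H s (of_real l)))"
    by (simp add: e0_tilde_def fun_eq_iff)
  have sigma: "sigma_integrable \<sigma> (e0_tilde B H x) (e0_tilde B H t)"
    "sigma_integral \<sigma> (e0_tilde B H x) (e0_tilde B H t) =
      integral {0..min x t} (\<lambda>s. adjoint_factor R x s ** cadjoint (adjoint_factor R t s))"
    if "x \<in> {0..X}" "t \<in> {0..X}" for x t
    by (rule spectral_sigma_integral[OF R spec Y _ E that];
        (rule e | rule borel_measurable_cadjoint_e0_tilde[OF sa inv(2)]); assumption)+
  have "F_tilde B H \<sigma> \<sigma>\<^sub>0 x t = factor_product R x t" if "x \<in> {0..X}" "t \<in> {0..X}" for x t
    using sigma(2)[OF that] free_sigma_integral(2)[OF B1 B2 B1_eq B_eq \<sigma>0, of x t] that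
    by (simp add: F_tilde_def factor_product_def)
  then show ?thesis
    using R res sigma(1) by (intro exI[of _ R]) blast
qed

text \<open>Derivatives within \<open>{0..}\<close> look to the right, so both points lie strictly
  below \<open>X\<close>, leaving room where the closed form persists. The first derivative is
  established for all \<open>x\<close> up to \<open>X\<close>, as the second one needs it in a
  neighbourhood.\<close>

lemma F_tilde_derivatives:
  assumes R: "continuous_on UNIV (\<lambda>(x, t). R x t)"
    and F: "\<And>x t. x \<in> {0..X} \<Longrightarrow> t \<in> {0..X} \<Longrightarrow> F_tilde B H \<sigma> \<sigma>\<^sub>0 x t = factor_product R x t"
    and x: "x \<in> {0..<X}" and t: "t \<in> {0..<X}"
  shows "(F_tilde B H \<sigma> \<sigma>\<^sub>0 x has_vector_derivative factor_product_dt R x t) (at t within {0..})"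
    and "x \<noteq> t \<Longrightarrow> ((\<lambda>x. F_tilde_dt B H \<sigma> \<sigma>\<^sub>0 x t) has_vector_derivative
      factor_product_dxdt R x t) (at x within {0..})"
proof -
  have dt: "(F_tilde B H \<sigma> \<sigma>\<^sub>0 x has_vector_derivative factor_product_dt R x t) (at t within {0..})"
    if x: "x \<in> {0..X}" for x
  proof -
    have "(factor_product R x has_vector_derivative factor_product_dt R x t) (at t within {0..})"
      using x t by (intro has_vector_derivative_factor_product R) auto
    then show ?thesis
      by (rule has_vector_derivative_transform_within[of _ _ _ _ "X - t"])
         (use x t in \<open>auto simp: dist_real_def F\<close>)
  qed
  then show "(F_tilde B H \<sigma> \<sigma>\<^sub>0 x has_vector_derivative factor_product_dt R x t) (at t within {0..})"
    using x by simp
  have F_dt: "F_tilde_dt B H \<sigma> \<sigma>\<^sub>0 x t = factor_product_dt R x t" if "x \<in> {0..X}" for x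
    unfolding F_tilde_dt_def using t
    by (intro vector_derivative_within at_within_halfline_neq_bot dt that) auto
  assume "x \<noteq> t"
  with x t have "((\<lambda>x. factor_product_dt R x t) has_vector_derivative factor_product_dxdt R x t) (at x within {0..})"
    by (intro has_vector_derivative_factor_product_dt R) auto
  then show "((\<lambda>x. F_tilde_dt B H \<sigma> \<sigma>\<^sub>0 x t) has_vector_derivative
      factor_product_dxdt R x t) (at x within {0..})"
    by (rule has_vector_derivative_transform_within[of _ _ _ _ "X - x"])
       (use x in \<open>auto simp: dist_real_def F_dt\<close>)
qed

end

theorem theorem4p8:
  fixes B\<^sub>1 B\<^sub>2 H :: "complex^'n^'n"
    and B :: "complex^('n + 'n)^('n + 'n)"
    and Q :: "real \<Rightarrow> complex^('n + 'n)^('n + 'n)"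
    and Y :: "real \<Rightarrow> complex \<Rightarrow> complex^'n^('n + 'n)"
    and K F :: "real \<Rightarrow> real \<Rightarrow> complex^('n + 'n)^('n + 'n)"
    and \<sigma> \<sigma>\<^sub>0 :: "real \<Rightarrow> complex^'n^'n"
  assumes "pos_def_matrix B\<^sub>1" and "pos_def_matrix B\<^sub>2"
    and "B\<^sub>1 = cadjoint H ** B\<^sub>2 ** H"
    and "B = block_diag B\<^sub>1 (- B\<^sub>2)"
    and "continuous_on {0..} Q" and "\<forall>x\<ge>0. self_adjoint (Q x)"
    and "is_fundamental_solution B H Q Y"
    and "is_transformation_kernel B H Y K"
    and "is_spectral_function Y \<sigma>"
    and "\<sigma>\<^sub>0 = (\<lambda>l. cscale (of_real (l / (2 * pi))) (matrix_inv B\<^sub>1))"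
    and "F = F_kernel B H \<sigma> \<sigma>\<^sub>0"
  shows "
    \<comment> \<open>the integrals defining \<open>F_tilde\<close> converge\<close>
    (\<forall>x\<ge>0. \<forall>t\<ge>0. sigma_integrable \<sigma> (e0_tilde B H x) (e0_tilde B H t) \<and>
        sigma_integrable \<sigma>\<^sub>0 (e0_tilde B H x) (e0_tilde B H t)) \<and>
    \<comment> \<open>the derivatives defining \<open>F\<close> exist off the diagonal\<close>
    (\<forall>x\<ge>0. \<forall>t\<ge>0. (\<lambda>t'. F_tilde B H \<sigma> \<sigma>\<^sub>0 x t') differentiable (at t within {0..})) \<and>
    (\<forall>x\<ge>0. \<forall>t\<ge>0. x \<noteq> t \<longrightarrow>
        (\<lambda>x'. F_tilde_dt B H \<sigma> \<sigma>\<^sub>0 x' t) differentiable (at x within {0..})) \<and>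
    \<comment> \<open>the Gelfand-Levitan equation\<close>
    (\<forall>x t. 0 \<le> t \<and> t < x \<longrightarrow>
        (\<lambda>s. K x s ** F s t) integrable_on {0..x} \<and>
        F x t + K x t + integral {0..x} (\<lambda>s. K x s ** F s t) = 0)"
proof (intro conjI allI impI)
  note factorization = F_tilde_factorization[OF assms(1-4) assms(7-10)]
  note derivatives = F_tilde_derivatives[OF assms(1-4) assms(7-10)]
  {
    fix x t :: real assume xt: "0 \<le> x" "0 \<le> t"
    \<comment> \<open>The side exceeds both points by 1, which places them in the half-open range
      required for derivatives.\<close>
    have max: "0 \<le> max x t + 1" and mem: "x \<in> {0..<max x t + 1}" "t \<in> {0..<max x t + 1}"
      using xt by auto
    obtain R where R: "continuous_on UNIV (\<lambda>(x, t). R x t)"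
      and F: "\<forall>x'\<in>{0..max x t + 1}. \<forall>t'\<in>{0..max x t + 1}.
        sigma_integrable \<sigma> (e0_tilde B H x') (e0_tilde B H t') \<and>
        F_tilde B H \<sigma> \<sigma>\<^sub>0 x' t' = factor_product R x' t'"
      using factorization[OF max] by (elim exE conjE) (rule that)
    have F': "F_tilde B H \<sigma> \<sigma>\<^sub>0 x' t' = factor_product R x' t'"
      if "x' \<in> {0..max x t + 1}" "t' \<in> {0..max x t + 1}" for x' t'
      by (rule conjunct2[OF bspec[OF bspec[OF F that(1)] that(2)]])
    have "x \<in> {0..max x t + 1}" "t \<in> {0..max x t + 1}"
      using mem by simp_all
    then show "sigma_integrable \<sigma> (e0_tilde B H x) (e0_tilde B H t)"
      by (intro conjunct1[OF bspec[OF bspec[OF F]]])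
    show "sigma_integrable \<sigma>\<^sub>0 (e0_tilde B H x) (e0_tilde B H t)"
      by (rule free_sigma_integral(1)[OF assms(1-4) assms(10) xt])
    show "F_tilde B H \<sigma> \<sigma>\<^sub>0 x differentiable (at t within {0..})"
      by (rule differentiableI_vector[OF derivatives(1)[OF R F' mem]])
    show "(\<lambda>x'. F_tilde_dt B H \<sigma> \<sigma>\<^sub>0 x' t) differentiable (at x within {0..})" if "x \<noteq> t"
      by (rule differentiableI_vector[OF derivatives(2)[OF R F' mem that]])
  next
    fix x t :: real assume "0 \<le> t \<and> t < x"
    \<comment> \<open>Side x + 1 serves every s in [0, x], including the end s = x, so one resolvent
      covers the whole integral.\<close>
    then have t: "0 \<le> t" "t < x" and x: "0 \<le> x + 1"
      by auto
    obtain R where R: "continuous_on UNIV (\<lambda>(x, t). R x t)"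
      and res: "\<forall>y s. 0 \<le> s \<and> s \<le> y \<and> y \<le> x + 1 \<longrightarrow>
        R y s + K y s + integral {s..y} (\<lambda>r. K y r ** R r s) = 0"
      and F: "\<forall>x'\<in>{0..x + 1}. \<forall>t'\<in>{0..x + 1}.
        sigma_integrable \<sigma> (e0_tilde B H x') (e0_tilde B H t') \<and>
        F_tilde B H \<sigma> \<sigma>\<^sub>0 x' t' = factor_product R x' t'"
      using factorization[OF x] by (elim exE conjE) (rule that)
    have F': "F_tilde B H \<sigma> \<sigma>\<^sub>0 x' t' = factor_product R x' t'"
      if "x' \<in> {0..x + 1}" "t' \<in> {0..x + 1}" for x' t'
      by (rule conjunct2[OF bspec[OF bspec[OF F that(1)] that(2)]])
    have res': "R x s + K x s + integral {s..x} (\<lambda>r. K x r ** R r s) = 0" if "0 \<le> s" "s \<le> x" for s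
      using that by (intro res[rule_format]) simp
    have Fs: "F s t = factor_product_dxdt R s t" if "s \<in> {0..x}" "s \<noteq> t" for s
    proof -
      have "s \<in> {0..<x + 1}" "t \<in> {0..<x + 1}" "0 \<le> s"
        using that t by auto
      then show ?thesis
        unfolding assms(11) F_kernel_def
        by (intro vector_derivative_within at_within_halfline_neq_bot derivatives(2)[OF R F' _ _ that(2)])
    qed
    note gl = gelfand_levitan_resolvent[OF R kernel_continuous[OF assms(1-4) assms(7-10)] res' t, of F]
    show "(\<lambda>s. K x s ** F s t) integrable_on {0..x}"
      by (rule gl(1)) (assumption | rule Fs)+
    show "F x t + K x t + integral {0..x} (\<lambda>s. K x s ** F s t) = 0"
      by (rule gl(2)) (assumption | rule Fs)+
  }
qed

end
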